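(* Assume $\Bbbk$ is uncountable. Let $M$ be a simple holonomic $A\mathcal{V}$-module. Then $M\cong P\otimes Q$ as $A\mathcal{V}$-modules, where $P$ is a simple holonomic $\mathcal{D}$-module and $Q$ is a simple finite-dimensional $\mathfrak{gl}_n$-module, regarded as an $\mathcal{L}_+$-module via $\mathcal{L}_+\to\mathcal{L}_0\cong\mathfrak{gl}_n$.
   Context: Setup: $\Bbbk$ algebraically closed, characteristic $0$; $A=\Bbbk[x_1,\dots,x_n]$; $\mathcal{V}=\mathrm{Der}(A)$. An $A\mathcal{V}$-module is an $A$-module and $\mathcal{V}$-module with $\eta(fm)=\eta(f)m+f(\eta m)$, i.e. a module over the smash product $A\#U(\mathcal{V})$. $\mathcal{D}$ is the Weyl algebra (subalgebra of $\mathrm{End}_\Bbbk(A)$ generated by $A$ and $\mathcal{V}$). $\mathcal{L}=\mathrm{Der}(\Bbbk[X_1,\dots,X_n])$, $\mathfrak{m}=(X_1,\dots,X_n)$, $\mathcal{L}_+=\mathfrak{m}\mathcal{L}=\bigoplus_{d\ge0}\mathcal{L}_d$ with $\mathcal{L}_d$ spanned by $X^k\partial/\partial X_i$, $|k|=d+1$; $\mathcal{L}_0\cong\mathfrak{gl}_n$ via $X_i\partial/\partial X_j\mapsto E_{ij}$, and $\mathcal{L}_+\to\mathcal{L}_0$ is the projection with kernel the ideal $\bigoplus_{d\ge1}\mathcal{L}_d$. There is an algebra isomorphism $\varphi:A\#U(\mathcal{V})\to\mathcal{D}\otimes U(\mathcal{L}_+)$, the natural embedding on $A$, with $\varphi(x^k\partial/\partial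 x_p)=x^k\partial/\partial x_p\otimes1+\sum_{0<m\le k}\binom{k}{m}x^{k-m}\otimes X^m\partial/\partial X_p$ (multi-index notation); via $\varphi$, $P\otimes Q$ is an $A\mathcal{V}$-module for any $\mathcal{D}$-module $P$ and $\mathcal{L}_+$-module $Q$. A finitely generated $A\mathcal{V}$-module is holonomic if it is $0$ or has Gelfand–Kirillov dimension $n$ over $A\#U(\mathcal{V})$; a finitely generated $\mathcal{D}$-module is holonomic if it is $0$ or has GK dimension $n$ over $\mathcal{D}$ (GK dimension of a module over a finitely generated algebra: $\limsup_m\log_m\dim(C^mM_0)$ for finite-dimensional generating subspaces $C\ni 1$, $M_0$). *)

theory Defs
  imports Main "HOL-Library.Poly_Mapping" "HOL-Computational_Algebra.Polynomial"
    "HOL-Library.Extended_Real" "HOL-Library.Liminf_Limsup" "HOL-Library.Countable_Set"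
begin

type_synonym 'k mpol = "(nat \<Rightarrow>\<^sub>0 nat) \<Rightarrow>\<^sub>0 'k"

definition alg_closed :: "'k::field itself \<Rightarrow> bool" where
  "alg_closed _ \<longleftrightarrow> (\<forall>p :: 'k poly. degree p > 0 \<longrightarrow> (\<exists>x. poly p x = 0))"

definition inA :: "nat \<Rightarrow> 'k::comm_ring_1 mpol \<Rightarrow> bool" where
  "inA n f \<longleftrightarrow> (\<forall>m :: nat \<Rightarrow>\<^sub>0 nat. m \<in> Poly_Mapping.keys f \<longrightarrow> Poly_Mapping.keys m \<subseteq> {..<n})"

definition cst :: "'k::comm_ring_1 \<Rightarrow> 'k mpol" where
  "cst c = Poly_Mapping.single 0 c"

definition Xv :: "nat \<Rightarrow> 'k::comm_ring_1 mpol" where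
  "Xv p = Poly_Mapping.single (Poly_Mapping.single p 1) 1"

definition pd :: "nat \<Rightarrow> 'k::comm_ring_1 mpol \<Rightarrow> 'k mpol" where
  "pd i f = (\<Sum>m::nat \<Rightarrow>\<^sub>0 nat \<in> Poly_Mapping.keys f. Poly_Mapping.single (m - Poly_Mapping.single i 1)
                              (of_nat (Poly_Mapping.lookup m i) * Poly_Mapping.lookup f m))"

text \<open>multiplication operator by f, as a k-linear endomorphism of A
  (extended by 0 outside A so that endomorphisms of A are represented uniquely)\<close>
definition mulop :: "nat \<Rightarrow> 'k::comm_ring_1 mpol \<Rightarrow> 'k mpol \<Rightarrow> 'k mpol" where
  "mulop n f = (\<lambda>g. if inA n g then f * g else 0)"

definition Der :: "nat \<Rightarrow> ('k::comm_ring_1 mpol \<Rightarrow> 'k mpol) set" where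
  "Der n = {\<delta>. (\<forall>f. \<not> inA n f \<longrightarrow> \<delta> f = 0)
     \<and> (\<forall>f. inA n f \<longrightarrow> inA n (\<delta> f))
     \<and> (\<forall>f g. inA n f \<longrightarrow> inA n g \<longrightarrow> \<delta> (f + g) = \<delta> f + \<delta> g)
     \<and> (\<forall>c f. inA n f \<longrightarrow> \<delta> (cst c * f) = cst c * \<delta> f)
     \<and> (\<forall>f g. inA n f \<longrightarrow> inA n g \<longrightarrow> \<delta> (f * g) = \<delta> f * g + f * \<delta> g)}"

definition der_add :: "('k::comm_ring_1 mpol \<Rightarrow> 'k mpol) \<Rightarrow> ('k mpol \<Rightarrow> 'k mpol) \<Rightarrow> 'k mpol \<Rightarrow> 'k mpol" where
  "der_add \<delta> \<epsilon> = (\<lambda>g. \<delta> g + \<epsilon> g)"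

definition der_smult :: "'k::comm_ring_1 \<Rightarrow> ('k mpol \<Rightarrow> 'k mpol) \<Rightarrow> 'k mpol \<Rightarrow> 'k mpol" where
  "der_smult c \<delta> = (\<lambda>g. cst c * \<delta> g)"

definition der_br :: "('k::comm_ring_1 mpol \<Rightarrow> 'k mpol) \<Rightarrow> ('k mpol \<Rightarrow> 'k mpol) \<Rightarrow> 'k mpol \<Rightarrow> 'k mpol" where
  "der_br \<delta> \<epsilon> = (\<lambda>g. \<delta> (\<epsilon> g) - \<epsilon> (\<delta> g))"

inductive_set Weyl :: "nat \<Rightarrow> ('k::comm_ring_1 mpol \<Rightarrow> 'k mpol) set" for n where
  mult: "inA n f \<Longrightarrow> mulop n f \<in> Weyl n"
| der: "\<delta> \<in> Der n \<Longrightarrow> \<delta> \<in> Weyl n"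
| add: "S \<in> Weyl n \<Longrightarrow> T \<in> Weyl n \<Longrightarrow> (\<lambda>g. S g + T g) \<in> Weyl n"
| comp: "S \<in> Weyl n \<Longrightarrow> T \<in> Weyl n \<Longrightarrow> S \<circ> T \<in> Weyl n"

definition op_submodule :: "('k::field \<Rightarrow> 'm::ab_group_add \<Rightarrow> 'm) \<Rightarrow> ('m \<Rightarrow> 'm) set \<Rightarrow> 'm set \<Rightarrow> 'm set \<Rightarrow> bool" where
  "op_submodule sc Ops X N \<longleftrightarrow> N \<subseteq> X \<and> module.subspace sc N \<and> (\<forall>T\<in>Ops. \<forall>x\<in>N. T x \<in> N)"

definition op_simple :: "('k::field \<Rightarrow> 'm::ab_group_add \<Rightarrow> 'm) \<Rightarrow> ('m \<Rightarrow> 'm) set \<Rightarrow> 'm set \<Rightarrow> bool" where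
  "op_simple sc Ops X \<longleftrightarrow> X \<noteq> {0} \<and>
     (\<forall>N. op_submodule sc Ops X N \<longrightarrow> N = {0} \<or> N = X)"

definition op_fin_gen :: "('k::field \<Rightarrow> 'm::ab_group_add \<Rightarrow> 'm) \<Rightarrow> ('m \<Rightarrow> 'm) set \<Rightarrow> 'm set \<Rightarrow> bool" where
  "op_fin_gen sc Ops X \<longleftrightarrow> (\<exists>S. finite S \<and> S \<subseteq> X \<and>
     (\<forall>N. op_submodule sc Ops X N \<and> S \<subseteq> N \<longrightarrow> N = X))"

definition words :: "('m \<Rightarrow> 'm) set \<Rightarrow> nat \<Rightarrow> ('m \<Rightarrow> 'm) set" where
  "words F m = {foldr (\<circ>) ws id | ws. set ws \<subseteq> F \<and> length ws \<le> m}"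

text \<open>dim (C^m M_0) where C = span (1 and F)\<close>
definition growth :: "('k::field \<Rightarrow> 'm::ab_group_add \<Rightarrow> 'm) \<Rightarrow> ('m \<Rightarrow> 'm) set \<Rightarrow> 'm set \<Rightarrow> nat \<Rightarrow> nat" where
  "growth sc F M0 m = vector_space.dim sc {w x | w x. w \<in> words F m \<and> x \<in> M0}"

definition GKdim :: "('k::field \<Rightarrow> 'm::ab_group_add \<Rightarrow> 'm) \<Rightarrow> ('m \<Rightarrow> 'm) set \<Rightarrow> 'm set \<Rightarrow> ereal" where
  "GKdim sc Ops X = (SUP FM \<in> {(F, M0). finite F \<and> F \<subseteq> Ops \<and> finite M0 \<and> M0 \<subseteq> X}.
      limsup (\<lambda>m. let g = growth sc (fst FM) (snd FM) m in
                   if g = 0 then 0 else ereal (log (real m) (real g))))"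

definition op_holonomic :: "nat \<Rightarrow> ('k::field \<Rightarrow> 'm::ab_group_add \<Rightarrow> 'm) \<Rightarrow> ('m \<Rightarrow> 'm) set \<Rightarrow> 'm set \<Rightarrow> bool" where
  "op_holonomic n sc Ops X \<longleftrightarrow> op_fin_gen sc Ops X \<and> (X = {0} \<or> GKdim sc Ops X = ereal (real n))"

definition AV_module :: "nat \<Rightarrow> ('k::field \<Rightarrow> 'm::ab_group_add \<Rightarrow> 'm)
   \<Rightarrow> ('k mpol \<Rightarrow> 'm \<Rightarrow> 'm) \<Rightarrow> (('k mpol \<Rightarrow> 'k mpol) \<Rightarrow> 'm \<Rightarrow> 'm) \<Rightarrow> bool" where
  "AV_module n sc a v \<longleftrightarrow> vector_space sc
   \<and> (\<forall>f. inA n f \<longrightarrow> Vector_Spaces.linear sc sc (a f))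
   \<and> (\<forall>f g x. inA n f \<longrightarrow> inA n g \<longrightarrow> a (f + g) x = a f x + a g x)
   \<and> (\<forall>c f x. inA n f \<longrightarrow> a (cst c * f) x = sc c (a f x))
   \<and> (\<forall>f g x. inA n f \<longrightarrow> inA n g \<longrightarrow> a (f * g) x = a f (a g x))
   \<and> (\<forall>x. a 1 x = x)
   \<and> (\<forall>\<delta>\<in>Der n. Vector_Spaces.linear sc sc (v \<delta>))
   \<and> (\<forall>\<delta>\<in>Der n. \<forall>\<epsilon>\<in>Der n. \<forall>x. v (der_add \<delta> \<epsilon>) x = v \<delta> x + v \<epsilon> x)
   \<and> (\<forall>c. \<forall>\<delta>\<in>Der n. \<forall>x. v (der_smult c \<delta>) x = sc c (v \<delta> x))
   \<and> (\<forall>\<delta>\<in>Der n. \<forall>\<epsilon>\<in>Der n. \<forall>x. v (der_br \<delta> \<epsilon>) x = v \<delta> (v \<epsilon> x) - v \<epsilon> (v \<delta> x))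
   \<and> (\<forall>\<delta>\<in>Der n. \<forall>f x. inA n f \<longrightarrow> v \<delta> (a f x) = a (\<delta> f) x + a f (v \<delta> x))"

definition AV_ops :: "nat \<Rightarrow> ('k::comm_ring_1 mpol \<Rightarrow> 'm \<Rightarrow> 'm) \<Rightarrow> (('k mpol \<Rightarrow> 'k mpol) \<Rightarrow> 'm \<Rightarrow> 'm) \<Rightarrow> ('m \<Rightarrow> 'm) set" where
  "AV_ops n a v = {a f | f. inA n f} \<union> {v \<delta> | \<delta>. \<delta> \<in> Der n}"

definition D_module :: "nat \<Rightarrow> ('k::field \<Rightarrow> 'm::ab_group_add \<Rightarrow> 'm) \<Rightarrow> 'm set
   \<Rightarrow> (('k mpol \<Rightarrow> 'k mpol) \<Rightarrow> 'm \<Rightarrow> 'm) \<Rightarrow> bool" where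
  "D_module n sc P dP \<longleftrightarrow> module.subspace sc P
   \<and> (\<forall>T\<in>Weyl n. \<forall>x\<in>P. dP T x \<in> P)
   \<and> (\<forall>T\<in>Weyl n. \<forall>x\<in>P. \<forall>y\<in>P. dP T (x + y) = dP T x + dP T y)
   \<and> (\<forall>T\<in>Weyl n. \<forall>c. \<forall>x\<in>P. dP T (sc c x) = sc c (dP T x))
   \<and> (\<forall>S\<in>Weyl n. \<forall>T\<in>Weyl n. \<forall>x\<in>P. dP (\<lambda>g. S g + T g) x = dP S x + dP T x)
   \<and> (\<forall>S\<in>Weyl n. \<forall>T\<in>Weyl n. \<forall>x\<in>P. dP (S \<circ> T) x = dP S (dP T x))
   \<and> (\<forall>c. \<forall>x\<in>P. dP (mulop n (cst c)) x = sc c x)"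

definition D_ops :: "nat \<Rightarrow> (('k::comm_ring_1 mpol \<Rightarrow> 'k mpol) \<Rightarrow> 'm \<Rightarrow> 'm) \<Rightarrow> ('m \<Rightarrow> 'm) set" where
  "D_ops n dP = {dP T | T. T \<in> Weyl n}"

type_synonym 'k mat = "nat \<Rightarrow> nat \<Rightarrow> 'k"

definition is_mat :: "nat \<Rightarrow> 'k::zero mat \<Rightarrow> bool" where
  "is_mat n X \<longleftrightarrow> (\<forall>i j. (n \<le> i \<or> n \<le> j) \<longrightarrow> X i j = 0)"

definition mat_mult :: "nat \<Rightarrow> 'k::comm_ring_1 mat \<Rightarrow> 'k mat \<Rightarrow> 'k mat" where
  "mat_mult n X Y = (\<lambda>i j. \<Sum>k<n. X i k * Y k j)"

definition mat_br :: "nat \<Rightarrow> 'k::comm_ring_1 mat \<Rightarrow> 'k mat \<Rightarrow> 'k mat" where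
  "mat_br n X Y = (\<lambda>i j. mat_mult n X Y i j - mat_mult n Y X i j)"

definition Emat :: "nat \<Rightarrow> nat \<Rightarrow> 'k::comm_ring_1 mat" where
  "Emat i j = (\<lambda>a b. if a = i \<and> b = j then 1 else 0)"

definition gl_rep :: "nat \<Rightarrow> nat \<Rightarrow> ('k::comm_ring_1 mat \<Rightarrow> 'k mat) \<Rightarrow> bool" where
  "gl_rep n d R \<longleftrightarrow>
     (\<forall>X. is_mat n X \<longrightarrow> is_mat d (R X))
   \<and> (\<forall>X Y. is_mat n X \<longrightarrow> is_mat n Y \<longrightarrow> R (\<lambda>i j. X i j + Y i j) = (\<lambda>i j. R X i j + R Y i j))
   \<and> (\<forall>c X. is_mat n X \<longrightarrow> R (\<lambda>i j. c * X i j) = (\<lambda>i j. c * R X i j))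
   \<and> (\<forall>X Y. is_mat n X \<longrightarrow> is_mat n Y \<longrightarrow> R (mat_br n X Y) = mat_br d (R X) (R Y))"

definition kvec :: "nat \<Rightarrow> (nat \<Rightarrow> 'k::zero) set" where
  "kvec d = {q. \<forall>j\<ge>d. q j = 0}"

definition simple_fd_gl :: "nat \<Rightarrow> nat \<Rightarrow> ('k::comm_ring_1 mat \<Rightarrow> 'k mat) \<Rightarrow> bool" where
  "simple_fd_gl n d R \<longleftrightarrow> gl_rep n d R \<and> d > 0 \<and>
     (\<forall>W. W \<subseteq> kvec d \<and> (\<lambda>_. 0) \<in> W \<and> (\<forall>q\<in>W. \<forall>q'\<in>W. (\<lambda>j. q j + q' j) \<in> W)
        \<and> (\<forall>c. \<forall>q\<in>W. (\<lambda>j. c * q j) \<in> W)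
        \<and> (\<forall>X. is_mat n X \<longrightarrow> (\<forall>q\<in>W. (\<lambda>j. \<Sum>l<d. R X j l * q l) \<in> W))
      \<longrightarrow> W = {\<lambda>_. 0} \<or> W = kvec d)"

section \<open>The AV-module P \<otimes> Q, with P \<otimes> k^d identified with P^d
  (u = (u_0,...,u_{d-1}) corresponds to \<Sum>_j u_j \<otimes> e_j)\<close>

definition tensor_carrier :: "'m::zero set \<Rightarrow> nat \<Rightarrow> (nat \<Rightarrow> 'm) set" where
  "tensor_carrier P d = {u. (\<forall>j<d. u j \<in> P) \<and> (\<forall>j\<ge>d. u j = 0)}"

definition tensor_actA :: "nat \<Rightarrow> nat \<Rightarrow> (('k::comm_ring_1 mpol \<Rightarrow> 'k mpol) \<Rightarrow> 'm::ab_group_add \<Rightarrow> 'm)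
    \<Rightarrow> 'k mpol \<Rightarrow> (nat \<Rightarrow> 'm) \<Rightarrow> (nat \<Rightarrow> 'm)" where
  "tensor_actA n d dP f u = (\<lambda>j. if j < d then dP (mulop n f) (u j) else 0)"

text \<open>Via phi, x^k d/dx_p acts as x^k d/dx_p \<otimes> 1 + \<Sum>_{0<m\<le>k} binom(k,m) x^{k-m} \<otimes> X^m d/dX_p.
  On Q only the terms with |m| = 1, m = e_i, survive (the ideal \<Oplus>_{d\<ge>1} L_d acts by 0),
  X_i d/dX_p acts as E_{ip}, and binom(k,e_i) x^{k-e_i} = d/dx_i (x^k).
  Hence \<delta> \<in> Der(A) acts as \<delta> \<otimes> 1 + \<Sum>_{i,p} d/dx_i(\<delta>(x_p)) \<otimes> E_{ip}.\<close>
definition tensor_actV :: "nat \<Rightarrow> ('k::field \<Rightarrow> 'm::ab_group_add \<Rightarrow> 'm) \<Rightarrow> nat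
    \<Rightarrow> (('k mpol \<Rightarrow> 'k mpol) \<Rightarrow> 'm \<Rightarrow> 'm) \<Rightarrow> ('k mat \<Rightarrow> 'k mat)
    \<Rightarrow> ('k mpol \<Rightarrow> 'k mpol) \<Rightarrow> (nat \<Rightarrow> 'm) \<Rightarrow> (nat \<Rightarrow> 'm)" where
  "tensor_actV n sc d dP R \<delta> u = (\<lambda>j. if j < d then
      dP \<delta> (u j) + (\<Sum>i<n. \<Sum>p<n. \<Sum>l<d. sc (R (Emat i p) j l) (dP (mulop n (pd i (\<delta> (Xv p)))) (u l)))
    else 0)"

definition AV_iso_tensor :: "nat \<Rightarrow> ('k::field \<Rightarrow> 'm::ab_group_add \<Rightarrow> 'm)
   \<Rightarrow> ('k mpol \<Rightarrow> 'm \<Rightarrow> 'm) \<Rightarrow> (('k mpol \<Rightarrow> 'k mpol) \<Rightarrow> 'm \<Rightarrow> 'm)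
   \<Rightarrow> 'm set \<Rightarrow> (('k mpol \<Rightarrow> 'k mpol) \<Rightarrow> 'm \<Rightarrow> 'm) \<Rightarrow> nat \<Rightarrow> ('k mat \<Rightarrow> 'k mat)
   \<Rightarrow> ('m \<Rightarrow> (nat \<Rightarrow> 'm)) \<Rightarrow> bool" where
  "AV_iso_tensor n sc a v P dP d R \<Phi> \<longleftrightarrow>
     bij_betw \<Phi> UNIV (tensor_carrier P d)
   \<and> (\<forall>x y. \<Phi> (x + y) = (\<lambda>j. \<Phi> x j + \<Phi> y j))
   \<and> (\<forall>c x. \<Phi> (sc c x) = (\<lambda>j. sc c (\<Phi> x j)))
   \<and> (\<forall>f x. inA n f \<longrightarrow> \<Phi> (a f x) = tensor_actA n d dP f (\<Phi> x))
   \<and> (\<forall>\<delta>\<in>Der n. \<forall>x. \<Phi> (v \<delta> x) = tensor_actV n sc d dP R \<delta> (\<Phi> x))"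

end

theory Submission
  imports Defs "HOL-Library.FuncSet" "HOL-Real_Asymp.Real_Asymp"
begin

text \<open>
  Through x_i and the coordinate derivatives, a simple holonomic AV-module M is a module over the
  Weyl algebra D. The difference between the action of the derivation f \<partial>_p and the composite of
  f with the action of \<partial>_p is A-linear; expanding it in powers of X - x yields operators that
  commute with D and represent L_+.

  Growth of M below order n + 1 is automatically of order n, because any n + 1 generators of D
  satisfy a relation on a given vector. Together with Bernstein's inequality, in Joseph's form, this
  bounds the length of chains of D-submodules, so M contains a simple D-submodule D u. Let Q be the
  space of vectors annihilated by the annihilator of u. By Dixmier's lemma and the density theorem
  the tensor product of D u and Q embeds into M. An infinite-dimensional L_+-orbit in Q would make M
  grow with order n + 1, so such orbits are finite-dimensional. In a finite-dimensional orbit, an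
  eigenvector of the Euler field with maximal eigenvalue is killed by all elements of positive
  degree. The vectors killed in this way form a finite-dimensional invariant subspace W of Q, and
  the image of the tensor product of D u and W is an AV-submodule, hence all of M.
\<close>

section \<open>Polynomials and partial derivatives\<close>

text \<open>The Gelfand-Kirillov dimension is a limsup of logarithms, so it bounds the growth of M
  only up to factors m^\<epsilon>, while the bound on the length of chains needs a true estimate C
  m^n. This is why a bound of order n + 1/2 is sharpened by standard monomials before Bernstein's
  inequality is applied to chains. Differential operators with prescribed zeros are found by
  comparing the number of their coefficients with the number of linear conditions; this counting
  takes the place of Hilbert polynomials and multiplicities. The dimension also speaks of finite
  sets of operators, whereas L_+ is infinite-dimensional. Only elements of L_+ with monomial
  coefficients of degree at most 3 n + 2 enter the growth estimate; brackets with X_q^2 d/dX_q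
  extend vanishing on a vector to all higher degrees. Q stands for the space of D-homomorphisms from
  D u to M, realized inside M by the images of u. The isomorphism with the tensor product enters
  through operators on M, and an element of D, given as a function on A, acts on M through its
  normal-ordered symbol.\<close>

abbreviation keys :: "('a \<Rightarrow>\<^sub>0 'b::zero) \<Rightarrow> 'a set" where
  "keys \<equiv> Poly_Mapping.keys"

abbreviation lookup :: "('a \<Rightarrow>\<^sub>0 'b::zero) \<Rightarrow> 'a \<Rightarrow> 'b" where
  "lookup \<equiv> Poly_Mapping.lookup"

abbreviation single :: "'a \<Rightarrow> 'b \<Rightarrow> 'a \<Rightarrow>\<^sub>0 'b::zero" where
  "single \<equiv> Poly_Mapping.single"

abbreviation ex :: "nat \<Rightarrow> (nat \<Rightarrow>\<^sub>0 nat)" where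
  "ex i \<equiv> single i (Suc 0)"

lemma keys_subset_lessThan_iff:
  "keys s \<subseteq> {..<n} \<longleftrightarrow> (\<forall>j\<ge>n. lookup s j = 0)" for n :: nat
proof
  assume "\<forall>j\<ge>n. lookup s j = 0"
  then show "keys s \<subseteq> {..<n}"
    by (metis in_keys_iff lessThan_iff not_le subsetI)
qed (auto simp: in_keys_iff subset_iff)

lemma poly_mapping_sum_single:
  fixes f :: "'a \<Rightarrow>\<^sub>0 'b::comm_monoid_add"
  shows "(\<Sum>m\<in>keys f. single m (lookup f m)) = f"
proof (rule poly_mapping_eqI)
  fix k
  show "lookup (\<Sum>m\<in>keys f. single m (lookup f m)) k
     = lookup f k"
    by (auto simp: lookup_sum lookup_single when_def in_keys_iff)
qed

lemma poly_mapping_add_induct [case_names zero single add]: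
  fixes f :: "'a \<Rightarrow>\<^sub>0 'b::comm_monoid_add"
  assumes "P 0"
    and "\<And>m c. m \<in> keys f \<Longrightarrow> P (single m c)"
    and "\<And>g h. P g \<Longrightarrow> P h \<Longrightarrow> P (g + h)"
  shows "P f"
proof -
  have "P (\<Sum>m\<in>S. single m (lookup f m))"
    if "finite S" "S \<subseteq> keys f" for S
    using that by (induction S) (auto intro: assms)
  from this[OF finite_keys subset_refl] show ?thesis
    by (simp only: poly_mapping_sum_single)
qed

lemma cst_mult_single: "cst c * single s d = single s (c * d)"
  by (simp add: cst_def mult_single)

lemma cst_add: "cst (c + d) = cst c + cst d"
  by (simp add: cst_def single_add)

lemma cst_mult: "cst (c * d) = cst c * cst d"
  by (simp add: cst_def mult_single)

lemma cst_0 [simp]: "cst 0 = 0" and cst_1 [simp]: "cst 1 = 1"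
  by (simp_all add: cst_def)

lemma cst_uminus: "cst (- c) = - cst c"
  by (simp add: cst_def single_uminus)

lemma Xv_mult_single: "Xv i * single s d = single (ex i + s) d"
  by (simp add: Xv_def mult_single)

lemma inA_0 [simp]: "inA n 0" and inA_cst [simp]: "inA n (cst c)"
  by (auto simp: inA_def cst_def)

lemma inA_1 [simp]: "inA n 1"
  by (metis inA_cst cst_1)

lemma inA_Xv [simp]: "i < n \<Longrightarrow> inA n (Xv i)"
  by (auto simp: inA_def Xv_def)

lemma inA_add [simp]: "inA n f \<Longrightarrow> inA n g \<Longrightarrow> inA n (f + g)"
  unfolding inA_def using keys_add by fastforce

lemma inA_uminus [simp]: "inA n (- f) = inA n f"
  unfolding inA_def by (simp add: in_keys_iff)

lemma inA_diff [simp]: "inA n f \<Longrightarrow> inA n g \<Longrightarrow> inA n (f - g)"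
  using inA_add[of n f "- g"] by simp

lemma inA_mult [simp]: "inA n f \<Longrightarrow> inA n g \<Longrightarrow> inA n (f * g)"
  unfolding inA_def
proof (intro allI impI)
  fix m assume f: "\<forall>m. m \<in> keys f \<longrightarrow> keys m \<subseteq> {..<n}"
    and g: "\<forall>m. m \<in> keys g \<longrightarrow> keys m \<subseteq> {..<n}"
    and m: "m \<in> keys (f * g)"
  obtain s t where "m = s + t" "s \<in> keys f" "t \<in> keys g"
    using m keys_mult by blast
  then show "keys m \<subseteq> {..<n}"
    using f g keys_add[of s t] by blast
qed

lemma inA_sum [simp]: "(\<And>i. i \<in> S \<Longrightarrow> inA n (f i)) \<Longrightarrow> inA n (sum f S)"
  by (induction S rule: infinite_finite_induct) auto

lemma inA_mono: "inA n f \<Longrightarrow> n \<le> m \<Longrightarrow> inA m f"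
  by (fastforce simp: inA_def)

lemma inA_single: "inA n (single s c) \<longleftrightarrow> c = 0 \<or> keys s \<subseteq> {..<n}"
  by (auto simp: inA_def)

lemma exponent_induct [consumes 1, case_names zero step]:
  fixes s :: "nat \<Rightarrow>\<^sub>0 nat"
  assumes "keys s \<subseteq> {..<n}" "P 0"
    and "\<And>i s. i < n \<Longrightarrow> keys s \<subseteq> {..<n} \<Longrightarrow> P s \<Longrightarrow> P (ex i + s)"
  shows "P s"
  using assms(1)
proof (induction "\<Sum>j<n. lookup s j" arbitrary: s)
  case 0
  have "s = 0"
  proof (rule poly_mapping_eqI)
    fix k show "lookup s k = lookup 0 k"
    proof (cases "k < n")
      case False
      then show ?thesis using 0(2) by (auto simp: in_keys_iff subset_iff)
    qed (use 0 in auto)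
  qed
  then show ?case using assms(2) by simp
next
  case (Suc d)
  have "\<exists>i<n. lookup s i \<noteq> 0"
  proof (rule ccontr)
    assume "\<not> (\<exists>i<n. lookup s i \<noteq> 0)"
    then have "(\<Sum>j<n. lookup s j) = 0" by simp
    then show False using Suc(2) by simp
  qed
  then obtain i where i: "i < n" "lookup s i \<noteq> 0" by blast
  let ?t = "s - ex i"
  have s: "s = ex i + ?t"
    by (rule poly_mapping_eqI) (use i in \<open>auto simp: lookup_add lookup_minus lookup_single when_def\<close>)
  have k: "keys ?t \<subseteq> {..<n}"
    using Suc(3) by (simp add: keys_subset_lessThan_iff lookup_minus)
  have "(\<Sum>j<n. lookup s j) = (\<Sum>j<n. (if j = i then 1 else 0) + lookup ?t j)"
    by (subst s) (auto simp: lookup_add lookup_single when_def intro!: sum.cong)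
  also have "\<dots> = 1 + (\<Sum>j<n. lookup ?t j)"
    using i by (simp add: sum.distrib)
  finally have "d = (\<Sum>j<n. lookup ?t j)" using Suc(2) by simp
  then have "P ?t" using Suc(1) k by blast
  then show ?case using assms(3)[OF i(1) k] s by simp
qed

lemma inA_induct [consumes 1, case_names cst add Xv]:
  assumes "inA n f"
    and "\<And>c. P (cst c)"
    and "\<And>f g. inA n f \<Longrightarrow> inA n g \<Longrightarrow> P f \<Longrightarrow> P g \<Longrightarrow> P (f + g)"
    and "\<And>i f. i < n \<Longrightarrow> inA n f \<Longrightarrow> P f \<Longrightarrow> P (Xv i * f)"
  shows "P f"
proof -
  have sg: "P (single s c)" if "keys s \<subseteq> {..<n}" for s c
    using that
  proof (induction rule: exponent_induct)
    case zero
    then show ?case using assms(2)[of c] by (simp add: cst_def)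
  next
    case (step i s)
    then show ?case using assms(4)[OF step(1) _ step(3)] by (simp add: inA_single Xv_mult_single)
  qed
  have "inA n f \<and> P f"
  proof (induction f rule: poly_mapping_add_induct)
    case zero
    then show ?case using assms(2)[of 0] by simp
  next
    case (single m c)
    then have "keys m \<subseteq> {..<n}" using assms(1) by (auto simp: inA_def)
    then show ?case using sg by (simp add: inA_single)
  next
    case (add g h)
    then show ?case using assms(3) by simp
  qed
  then show ?thesis by simp
qed

lemma pd_eq_sum:
  assumes "finite S" "keys f \<subseteq> S"
  shows "pd i f = (\<Sum>m\<in>S. single (m - ex i) (of_nat (lookup m i) * lookup f m))"
  unfolding pd_def One_nat_def by (rule sum.mono_neutral_left) (use assms in \<open>auto simp: in_keys_iff\<close>)

lemma pd_add [simp]: "pd i (f + g) = pd i f + pd i g"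
proof -
  let ?S = "keys f \<union> keys g"
  have "finite ?S" "keys (f + g) \<subseteq> ?S" by (auto dest: keys_add[THEN subsetD])
  then show ?thesis
    by (simp add: pd_eq_sum[of ?S] lookup_add algebra_simps single_add sum.distrib)
qed

lemma pd_single: "pd i (single m c) = single (m - ex i) (of_nat (lookup m i) * c)"
  by (simp add: pd_eq_sum[of "{m}"])

lemma pd_0 [simp]: "pd i 0 = 0"
  by (simp add: pd_def)

lemma pd_cst [simp]: "pd i (cst c) = 0"
  by (simp add: cst_def pd_single)

lemma pd_1 [simp]: "pd i 1 = 0"
  by (metis pd_cst cst_1)

lemma pd_Xv: "pd i (Xv j) = (if i = j then 1 else 0)"
  by (auto simp: Xv_def pd_single lookup_single when_def)

lemma pd_mult: "pd i (f * g) = pd i f * g + f * pd i g"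
proof (induction f rule: poly_mapping_add_induct)
  case (single s c)
  show ?case
  proof (induction g rule: poly_mapping_add_induct)
    case (single t d)
    have "single (s - ex i + t) (of_nat (lookup s i) * (c * d))
        = single (s + t - ex i) (of_nat (lookup s i) * (c * d))"
    proof (cases "lookup s i = 0")
      case False
      then have "s - ex i + t = s + t - ex i"
        by (intro poly_mapping_eqI) (auto simp: lookup_add lookup_minus lookup_single when_def)
      then show ?thesis by simp
    qed simp
    moreover have "single (s + (t - ex i)) (of_nat (lookup t i) * (c * d))
        = single (s + t - ex i) (of_nat (lookup t i) * (c * d))"
    proof (cases "lookup t i = 0")
      case False
      then have "s + (t - ex i) = s + t - ex i"
        by (intro poly_mapping_eqI) (auto simp: lookup_add lookup_minus lookup_single when_def)
      then show ?thesis by simp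
    qed simp
    ultimately show ?case
      by (simp add: mult_single pd_single lookup_add algebra_simps single_add)
  qed (simp_all add: algebra_simps)
qed (simp_all add: algebra_simps)

lemma pd_cst_mult [simp]: "pd i (cst c * f) = cst c * pd i f"
  by (simp add: pd_mult)

lemma pd_commute: "pd i (pd j f) = pd j (pd i f)"
proof (cases "i = j")
  case False
  show ?thesis
  proof (induction f rule: poly_mapping_add_induct)
    case (single s c)
    have "s - ex j - ex i = s - ex i - ex j"
      by (intro poly_mapping_eqI) (auto simp: lookup_minus)
    then show ?case using False
      by (simp add: pd_single lookup_minus lookup_single when_def algebra_simps)
  qed simp_all
qed simp

text \<open>In characteristic 0 the factor is nonzero, so every coefficient of f with a positive
  exponent at i survives in \<open>pd i f\<close>. Hence a polynomial all of whose partial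
  derivatives vanish is constant, which is where Joseph's descent stops.\<close>

lemma lookup_pd:
  "lookup (pd i f) s = of_nat (Suc (lookup s i)) * lookup f (ex i + s)"
proof (induction f rule: poly_mapping_add_induct)
  case (single m c)
  show ?case
  proof (cases "lookup m i = 0")
    case True
    then have "m \<noteq> ex i + s" by (auto simp: lookup_add)
    then show ?thesis using True by (simp add: pd_single lookup_single when_def)
  next
    case False
    then have "m = ex i + (m - ex i)"
      by (intro poly_mapping_eqI) (auto simp: lookup_add lookup_minus lookup_single when_def)
    then have "m - ex i = s \<longleftrightarrow> m = ex i + s" by auto
    then show ?thesis
      by (auto simp: pd_single lookup_single lookup_add when_def)
  qed
qed (simp_all add: lookup_add algebra_simps)

lemma keys_pd: "s \<in> keys (pd i f) \<Longrightarrow> ex i + s \<in> keys f"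
  by (auto simp: in_keys_iff lookup_pd)

lemma inA_pd [simp]: "inA n f \<Longrightarrow> inA n (pd i f)"
proof -
  assume f: "inA n f"
  show ?thesis unfolding inA_def
  proof (intro allI impI)
    fix m assume "m \<in> keys (pd i f)"
    then have "keys (ex i + m) \<subseteq> {..<n}" using f keys_pd by (auto simp: inA_def)
    then show "keys m \<subseteq> {..<n}" by (simp add: keys_subset_lessThan_iff lookup_add)
  qed
qed

section \<open>Modules over the Weyl algebra\<close>

definition prodY :: "(nat \<Rightarrow> 'm \<Rightarrow> 'm) \<Rightarrow> nat list \<Rightarrow> (nat \<Rightarrow>\<^sub>0 nat) \<Rightarrow> 'm \<Rightarrow> 'm" where
  "prodY Y l s = foldr (\<lambda>j g. (Y j ^^ lookup s j) \<circ> g) l id"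

definition wmon :: "nat \<Rightarrow> (nat \<Rightarrow> 'm \<Rightarrow> 'm) \<Rightarrow> (nat \<Rightarrow>\<^sub>0 nat) \<Rightarrow> 'm \<Rightarrow> 'm" where
  "wmon n Y s = prodY Y [0..<n] s \<circ> prodY Y [n..<2*n] s"

text \<open>Polynomials in 2n variables serve as normal-ordered differential operators: the variable
  with index i < n stands for multiplication by x_i, the one with index n + i for the derivative
  in direction i, and all derivatives are applied first.\<close>

definition wop :: "('k::comm_ring_1 \<Rightarrow> 'm::ab_group_add \<Rightarrow> 'm) \<Rightarrow> nat \<Rightarrow> (nat \<Rightarrow> 'm \<Rightarrow> 'm) \<Rightarrow> 'k mpol \<Rightarrow> 'm \<Rightarrow> 'm" where
  "wop sc n Y c x = (\<Sum>s\<in>keys c. sc (lookup c s) (wmon n Y s x))"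

definition mdeg :: "nat \<Rightarrow> (nat \<Rightarrow>\<^sub>0 nat) \<Rightarrow> nat" where
  "mdeg N s = (\<Sum>j<N. lookup s j)"

text \<open>Multiplications and derivatives get equal weight, as in the Bernstein filtration, so
  that each piece is finite-dimensional.\<close>

definition exps :: "nat \<Rightarrow> nat \<Rightarrow> (nat \<Rightarrow>\<^sub>0 nat) set" where
  "exps N m = {s. keys s \<subseteq> {..<N} \<and> mdeg N s \<le> m}"

lemma prodY_Nil [simp]: "prodY Y [] s = id"
  and prodY_Cons [simp]: "prodY Y (j # l) s = (Y j ^^ lookup s j) \<circ> prodY Y l s"
  by (simp_all add: prodY_def)

lemma prodY_cong: "(\<And>j. j \<in> set l \<Longrightarrow> lookup s j = lookup t j) \<Longrightarrow> prodY Y l s = prodY Y l t"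
  by (induction l) auto

lemma funpow_commute: "(\<And>x. Z (f x) = f (Z x)) \<Longrightarrow> Z ((f ^^ k) x) = (f ^^ k) (Z x)"
  by (induction k) auto

lemma prodY_commute:
  assumes "\<And>j x. j \<in> set l \<Longrightarrow> Z (Y j x) = Y j (Z x)"
  shows "Z (prodY Y l s x) = prodY Y l s (Z x)"
  using assms
proof (induction l)
  case (Cons j l)
  then show ?case by (simp add: funpow_commute[of Z "Y j"])
qed simp

lemma prodY_0 [simp]: "prodY Y l 0 = id"
  by (induction l) auto

lemma prodY_step:
  assumes "distinct l" "i \<in> set l" "\<And>j x. j \<in> set l \<Longrightarrow> Y i (Y j x) = Y j (Y i x)"
  shows "prodY Y l (ex i + s) x = Y i (prodY Y l s x)"
  using assms
proof (induction l)
  case (Cons j l)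
  show ?case
  proof (cases "i = j")
    case True
    then have "prodY Y l (ex i + s) = prodY Y l s"
      using Cons(2) by (intro prodY_cong) (auto simp: lookup_add lookup_single when_def)
    then show ?thesis using True by (simp add: lookup_add)
  next
    case False
    then have "prodY Y l (ex i + s) x = Y i (prodY Y l s x)" using Cons by auto
    then show ?thesis using False Cons(4)[of j]
      by (simp add: lookup_add lookup_single funpow_commute[of "Y i" "Y j"])
  qed
qed simp

lemma prodY_skip: "i \<notin> set l \<Longrightarrow> prodY Y l (ex i + s) = prodY Y l s"
  by (rule prodY_cong) (auto simp: lookup_add lookup_single when_def)

lemma mdeg_0 [simp]: "mdeg N 0 = 0"
  by (simp add: mdeg_def)

lemma mdeg_add: "mdeg N (s + t) = mdeg N s + mdeg N t"
  by (simp add: mdeg_def lookup_add sum.distrib)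

lemma mdeg_ex: "i < N \<Longrightarrow> mdeg N (ex i) = 1"
  by (simp add: mdeg_def lookup_single when_def)

lemma finite_exps [simp]: "finite (exps N m)"
proof -
  let ?f = "\<lambda>s j. if j < N then lookup s j else 0"
  have "?f ` exps N m \<subseteq> (\<lambda>g j. if j < N then g j else 0) ` ({..<N} \<rightarrow>\<^sub>E {..m})"
  proof
    fix g assume "g \<in> ?f ` exps N m"
    then obtain s where s: "s \<in> exps N m" "g = ?f s" by blast
    have "lookup s j \<le> m" if "j < N" for j
      using s(1) member_le_sum[of j "{..<N}" "lookup s"] that
      by (auto simp: exps_def mdeg_def)
    then have "(\<lambda>j\<in>{..<N}. lookup s j) \<in> ({..<N} \<rightarrow>\<^sub>E {..m})" by auto
    then show "g \<in> (\<lambda>g j. if j < N then g j else 0) ` ({..<N} \<rightarrow>\<^sub>E {..m})"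
      by (rule rev_image_eqI) (auto simp: s(2) fun_eq_iff)
  qed
  then have "finite (?f ` exps N m)"
    by (rule finite_subset) (intro finite_imageI finite_PiE; simp)
  moreover have "inj_on ?f (exps N m)"
  proof (rule inj_onI)
    fix s t assume st: "s \<in> exps N m" "t \<in> exps N m" "?f s = ?f t"
    show "s = t"
    proof (rule poly_mapping_eqI)
      fix k show "lookup s k = lookup t k"
        using st(1,2) fun_cong[OF st(3), of k]
        by (cases "k < N") (auto simp: exps_def keys_subset_lessThan_iff)
    qed
  qed
  ultimately show ?thesis by (rule finite_imageD)
qed

lemma zero_in_exps [simp]: "0 \<in> exps N m"
  by (simp add: exps_def)

text \<open>Only the canonical commutation relations are recorded. Thus the same lemmas serve an
  AV-module (locale \<open>av\<close>) and the polynomial ring itself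
  (\<open>weyl_rep_A\<close>).\<close>

locale weyl_rep = vector_space sc
  for sc :: "'k::field_char_0 \<Rightarrow> 'm::ab_group_add \<Rightarrow> 'm" +
  fixes n :: nat and Y :: "nat \<Rightarrow> 'm \<Rightarrow> 'm"
  assumes linear_Y: "Vector_Spaces.linear sc sc (Y j)"
    and XX: "i < n \<Longrightarrow> j < n \<Longrightarrow> Y i (Y j x) = Y j (Y i x)"
    and DD: "i < n \<Longrightarrow> j < n \<Longrightarrow> Y (n + i) (Y (n + j) x) = Y (n + j) (Y (n + i) x)"
    and DX: "i < n \<Longrightarrow> j < n \<Longrightarrow> Y (n + i) (Y j x) = Y j (Y (n + i) x) + (if i = j then x else 0)"
begin

abbreviation op :: "'k mpol \<Rightarrow> 'm \<Rightarrow> 'm" where "op \<equiv> wop sc n Y"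
abbreviation mon :: "(nat \<Rightarrow>\<^sub>0 nat) \<Rightarrow> 'm \<Rightarrow> 'm" where "mon \<equiv> wmon n Y"

lemma Y_add [simp]: "Y j (x + y) = Y j x + Y j y"
  and Y_scale [simp]: "Y j (sc c x) = sc c (Y j x)"
  using linear_Y[of j] by (auto simp: Vector_Spaces.linear_iff)

lemma Y_0 [simp]: "Y j 0 = 0"
  using Y_scale[of j 0 0] by simp

lemma linear_id: "Vector_Spaces.linear sc sc id" "Vector_Spaces.linear sc sc (\<lambda>x. x)"
  by (auto simp: Vector_Spaces.linear_iff vector_space_axioms)

lemma linear_comp: "Vector_Spaces.linear sc sc f \<Longrightarrow> Vector_Spaces.linear sc sc g \<Longrightarrow> Vector_Spaces.linear sc sc (f \<circ> g)"
  by (auto simp: Vector_Spaces.linear_iff)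

lemma linear_funpow: "Vector_Spaces.linear sc sc f \<Longrightarrow> Vector_Spaces.linear sc sc (f ^^ k)"
  by (induction k) (auto simp: linear_id intro: linear_comp)

lemma linear_prodY: "Vector_Spaces.linear sc sc (prodY Y l s)"
  by (induction l) (auto simp: linear_id simp del: o_apply intro!: linear_comp linear_funpow linear_Y)

lemma linear_mon: "Vector_Spaces.linear sc sc (mon s)"
  unfolding wmon_def by (intro linear_comp linear_prodY)

lemma linear_op: "Vector_Spaces.linear sc sc (op c)"
proof -
  have "mon s (x + y) = mon s x + mon s y" "mon s (sc d x) = sc d (mon s x)" for s x y d
    using linear_mon[of s] by (auto simp: Vector_Spaces.linear_iff)
  then show ?thesis
    unfolding Vector_Spaces.linear_iff wop_def
    by (auto simp: vector_space_axioms scale_right_distrib sum.distrib scale_sum_right mult.commute)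
qed

lemma op_add_right [simp]: "op c (x + y) = op c x + op c y"
  and op_scale_right [simp]: "op c (sc d x) = sc d (op c x)"
  using linear_op[of c] by (auto simp: Vector_Spaces.linear_iff)

lemma op_0_right [simp]: "op c 0 = 0"
  using op_scale_right[of c 0 0] by simp

lemma op_uminus_right [simp]: "op c (- x) = - op c x"
  using op_scale_right[of c "-1" x] by simp

lemma op_diff_right [simp]: "op c (x - y) = op c x - op c y"
  using op_add_right[of c x "- y"] by simp

lemma op_sum_right: "op c (sum f S) = (\<Sum>i\<in>S. op c (f i))"
  by (induction S rule: infinite_finite_induct) auto

lemma op_eq_sum:
  assumes "finite S" "keys c \<subseteq> S"
  shows "op c x = (\<Sum>s\<in>S. sc (lookup c s) (mon s x))"
  unfolding wop_def by (rule sum.mono_neutral_left) (use assms in \<open>auto simp: in_keys_iff\<close>)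

lemma op_add [simp]: "op (c + d) x = op c x + op d x"
proof -
  let ?S = "keys c \<union> keys d"
  have "finite ?S" "keys (c + d) \<subseteq> ?S" by (auto dest: keys_add[THEN subsetD])
  then show ?thesis
    by (simp add: op_eq_sum[of ?S] lookup_add scale_left_distrib sum.distrib)
qed

lemma op_0 [simp]: "op 0 x = 0"
  by (simp add: wop_def)

lemma op_single: "op (single s c) x = sc c (mon s x)"
  by (subst op_eq_sum[of "{s}"]) auto

lemma op_cst [simp]: "op (cst c) x = sc c x"
  by (simp add: cst_def op_single wmon_def)

lemma op_1 [simp]: "op 1 x = x"
  by (metis op_cst cst_1 scale_one)

lemma op_uminus [simp]: "op (- c) x = - op c x"
  using op_add[of c "- c" x] by (simp add: eq_neg_iff_add_eq_0 add.commute del: op_add)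

lemma op_diff [simp]: "op (c - d) x = op c x - op d x"
  using op_add[of c "- d" x] by simp

lemma op_sum: "op (sum f S) x = (\<Sum>i\<in>S. op (f i) x)"
  by (induction S rule: infinite_finite_induct) auto

lemma op_cst_mult [simp]: "op (cst c * d) x = sc c (op d x)"
  by (induction d rule: poly_mapping_add_induct)
    (auto simp: cst_mult_single op_single distrib_left scale_right_distrib)

lemma mon_X: "i < n \<Longrightarrow> mon (ex i + s) x = Y i (mon s x)"
  using prodY_step[of "[0..<n]" i Y s] by (simp add: wmon_def prodY_skip XX)

lemma mon_D: "i < n \<Longrightarrow> mon (ex (n + i) + s) x = mon s (Y (n + i) x)"
proof -
  assume i: "i < n"
  have c: "Y (n + i) (Y j y) = Y j (Y (n + i) y)" if "j \<in> set [n..<2*n]" for j y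
    using DD[OF i, of "j - n" y] that by auto
  show ?thesis
    unfolding wmon_def using i prodY_step[of "[n..<2*n]" "n + i" Y s x] prodY_commute[of "[n..<2*n]" "Y (n + i)" Y s x] c
    by (simp add: prodY_skip)
qed

lemma op_X: "i < n \<Longrightarrow> op (Xv i * c) x = Y i (op c x)"
  by (induction c rule: poly_mapping_add_induct)
    (auto simp: Xv_mult_single op_single distrib_left mon_X)

lemma op_D: "i < n \<Longrightarrow> op (Xv (n + i) * c) x = op c (Y (n + i) x)"
  by (induction c rule: poly_mapping_add_induct)
    (auto simp: Xv_mult_single op_single distrib_left mon_D)

text \<open>Commuting with a generator differentiates the symbol. A derivative multiplied onto the
  symbol is applied to the vector first (\<open>op_D\<close>), so the induction hypothesis is used
  at \<open>Y (n + k) x\<close> and the vector has to be arbitrary.\<close>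

lemma commutator_D:
  assumes "inA (2 * n) c" "i < n"
  shows "Y (n + i) (op c x) = op c (Y (n + i) x) + op (pd i c) x"
  using assms(1)
proof (induction arbitrary: x rule: inA_induct)
  case (Xv j f)
  show ?case
  proof (cases "j < n")
    case True
    then show ?thesis using assms(2) Xv(3)[of x]
      by (simp add: op_X DX pd_mult pd_Xv)
  next
    case False
    define k where "k = j - n"
    have k: "j = n + k" "k < n" using Xv(1) False by (auto simp: k_def)
    show ?thesis using assms(2) k(2) Xv(3)[of "Y (n + k) x"]
      by (simp add: k(1) op_D pd_mult pd_Xv DD)
  qed
qed (simp_all add: algebra_simps)

lemma commutator_X:
  assumes "inA (2 * n) c" "i < n"
  shows "op c (Y i x) = Y i (op c x) + op (pd (n + i) c) x"
  using assms(1)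
proof (induction arbitrary: x rule: inA_induct)
  case (Xv j f)
  show ?case
  proof (cases "j < n")
    case True
    then show ?thesis using assms(2) Xv(3)[of x]
      by (simp add: op_X XX pd_mult pd_Xv)
  next
    case False
    define k where "k = j - n"
    have k: "j = n + k" "k < n" using Xv(1) False by (auto simp: k_def)
    show ?thesis using assms(2) k(2) Xv(3)[of "Y (n + k) x"]
      by (auto simp: k(1) op_D pd_mult pd_Xv DX)
  qed
qed (simp_all add: algebra_simps)

end

section \<open>Composition of normal-ordered operators\<close>

definition Ly :: "nat \<Rightarrow> nat \<Rightarrow> 'k::comm_ring_1 mpol \<Rightarrow> 'k mpol" where
  "Ly n j c = (if j < n then Xv j * c else Xv j * c + pd (j - n) c)"

text \<open>The symbol of a composite. \<open>Ly n j\<close> is left multiplication by generator j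
  followed by normal ordering, and the symbol c is applied to d with these maps in place of the
  generators.\<close>

definition star :: "nat \<Rightarrow> 'k::comm_ring_1 mpol \<Rightarrow> 'k mpol \<Rightarrow> 'k mpol" where
  "star n c d = wop (\<lambda>a f. cst a * f) n (Ly n) c d"

lemma inA_Ly: "j < 2 * n \<Longrightarrow> inA (2 * n) c \<Longrightarrow> inA (2 * n) (Ly n j c)"
  by (simp add: Ly_def)

lemma inA_star: "inA (2 * n) d \<Longrightarrow> inA (2 * n) (star n c d)"
proof -
  assume d: "inA (2 * n) d"
  have pw: "inA (2 * n) f \<Longrightarrow> j < 2 * n \<Longrightarrow> inA (2 * n) ((Ly n j ^^ k) f)" for f :: "'a mpol" and j k
    by (induction k) (auto simp: inA_Ly)
  have pr: "set l \<subseteq> {..<2*n} \<Longrightarrow> inA (2 * n) f \<Longrightarrow> inA (2 * n) (prodY (Ly n) l s f)" for l s and f :: "'a mpol"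
    by (induction l) (auto simp: pw)
  have "set [0..<n] \<subseteq> {..<2*n}" "set [n..<2*n] \<subseteq> {..<2*n}" by auto
  note pr = pr[OF this(1)] pr[OF this(2)]
  then show ?thesis using d
    by (auto simp: star_def wop_def wmon_def simp del: set_upt intro!: inA_sum inA_mult pr)
qed

context weyl_rep begin

lemma op_Ly: "j < 2 * n \<Longrightarrow> inA (2 * n) c \<Longrightarrow> op (Ly n j c) x = Y j (op c x)"
  using commutator_D[of c "j - n" x] op_D[of "j - n" c x] by (auto simp: Ly_def op_X)

lemma op_star:
  assumes d: "inA (2 * n) d"
  shows "op (star n c d) x = op c (op d x)"
proof -
  have pw: "inA (2 * n) f \<and> op f x = y \<Longrightarrow> j < 2 * n \<Longrightarrow> 
      inA (2 * n) ((Ly n j ^^ k) f) \<and> op ((Ly n j ^^ k) f) x = (Y j ^^ k) y" for f j k y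
    by (induction k) (auto simp: inA_Ly op_Ly)
  have *: "set l \<subseteq> {..<2*n} \<Longrightarrow> inA (2 * n) f \<and> op f x = y \<Longrightarrow>
      inA (2 * n) (prodY (Ly n) l s f) \<and> op (prodY (Ly n) l s f) x = prodY Y l s y" for l s f y
  proof (induction l)
    case (Cons j l)
    then have "inA (2 * n) (prodY (Ly n) l s f) \<and> op (prodY (Ly n) l s f) x = prodY Y l s y" by simp
    from pw[OF this, of j] show ?case using Cons(2) by simp
  qed simp
  have "op (wmon n (Ly n) s d) x = mon s (op d x)" for s
    unfolding wmon_def comp_def
    using *[of "[0..<n]"] *[of "[n..<2*n]" d] d by fastforce
  then show ?thesis by (simp add: star_def wop_def[of _ n "Ly n"] op_sum) (simp add: wop_def)
qed

section \<open>Submodules, filtrations and faithfulness\<close>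

lemma subspace_Collect_linear_mem:
  assumes "subspace N" "\<And>x y. f (x + y) = f x + f y" "\<And>c x. f (sc c x) = sc c (f x)"
  shows "subspace {x. f x \<in> N}"
  using assms(2)[of 0 0] assms by (auto simp: subspace_def)

lemma op_mem_subspace:
  assumes "subspace N" "\<And>s. s \<in> keys c \<Longrightarrow> mon s x \<in> N"
  shows "op c x \<in> N"
  unfolding wop_def using assms by (auto intro!: subspace_sum subspace_scale)

definition Y_stable :: "'m set \<Rightarrow> bool" where
  "Y_stable N \<longleftrightarrow> subspace N \<and> (\<forall>j<2*n. \<forall>x\<in>N. Y j x \<in> N)"

text \<open>The filtration may start anywhere and need not be exhaustive; \<open>op_faithful\<close>
  takes the constant one, all others come from a generating vector.\<close>

definition Y_filtration :: "(nat \<Rightarrow> 'm set) \<Rightarrow> bool" where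
  "Y_filtration G \<longleftrightarrow> (\<forall>m. subspace (G m)) \<and> (\<forall>m. G m \<subseteq> G (Suc m)) \<and> (\<forall>m. \<forall>j<2*n. \<forall>x\<in>G m. Y j x \<in> G (Suc m))"

lemma Y_filtration_mono: "Y_filtration G \<Longrightarrow> m \<le> m' \<Longrightarrow> G m \<subseteq> G m'"
  using lift_Suc_mono_le[of G m m'] by (auto simp: Y_filtration_def)

lemma mon_filtration:
  assumes G: "Y_filtration G" and x: "x \<in> G a" and s: "s \<in> exps (2 * n) m"
  shows "mon s x \<in> G (a + m)"
proof -
  have pw: "y \<in> G b \<Longrightarrow> j < 2*n \<Longrightarrow> (Y j ^^ k) y \<in> G (b + k)" for y j b k
    using G by (induction k) (auto simp: Y_filtration_def)
  have *: "set l \<subseteq> {..<2*n} \<Longrightarrow> y \<in> G b \<Longrightarrow> prodY Y l s y \<in> G (b + (\<Sum>j\<leftarrow>l. lookup s j))" for l y b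
  proof (induction l)
    case (Cons j l)
    then have "prodY Y l s y \<in> G (b + (\<Sum>j\<leftarrow>l. lookup s j))" by simp
    from pw[OF this, of j "lookup s j"] Cons(2) show ?case by (simp add: algebra_simps)
  qed simp
  have 2: "prodY Y [n..<2*n] s x \<in> G (a + (\<Sum>j\<leftarrow>[n..<2*n]. lookup s j))"
    by (rule *) (use x in auto)
  have "mon s x \<in> G (a + (\<Sum>j\<leftarrow>[n..<2*n]. lookup s j) + (\<Sum>j\<leftarrow>[0..<n]. lookup s j))"
    unfolding wmon_def comp_def by (rule *) (use 2 in auto)
  moreover have "(\<Sum>j\<leftarrow>[n..<2*n]. lookup s j) + (\<Sum>j\<leftarrow>[0..<n]. lookup s j) = mdeg (2*n) s"
    unfolding mdeg_def interv_sum_list_conv_sum_set_nat lessThan_atLeast0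
    using sum.atLeastLessThan_concat[of 0 n "2*n" "lookup s"] by simp
  ultimately show ?thesis
    using Y_filtration_mono[OF G, of "a + mdeg (2*n) s" "a + m"] s by (auto simp: exps_def add.assoc)
qed

lemma op_filtration:
  assumes G: "Y_filtration G" and x: "x \<in> G a" and c: "keys c \<subseteq> exps (2 * n) m"
  shows "op c x \<in> G (a + m)"
  using mon_filtration[OF G x] c G by (intro op_mem_subspace) (auto simp: Y_filtration_def)

lemma op_stable:
  assumes "Y_stable N" "x \<in> N"
  shows "op c x \<in> N"
proof -
  have pw: "y \<in> N \<Longrightarrow> j < 2*n \<Longrightarrow> (Y j ^^ k) y \<in> N" for y j k
    using assms by (induction k) (auto simp: Y_stable_def)
  have *: "set l \<subseteq> {..<2*n} \<Longrightarrow> y \<in> N \<Longrightarrow> prodY Y l s y \<in> N" for l y s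
    by (induction l) (auto intro: pw)
  have "set [0..<n] \<subseteq> {..<2*n}" "set [n..<2*n] \<subseteq> {..<2*n}" by auto
  note pr = *[OF this(1)] *[OF this(2)]
  have "mon s x \<in> N" for s
    unfolding wmon_def comp_def by (intro pr assms)
  then show ?thesis using assms by (intro op_mem_subspace) (auto simp: Y_stable_def)
qed

text \<open>Joseph's argument for the Bernstein inequality: commuting a differential operator with
  a suitable x_i or derivative lowers its degree without annihilating it, down to a constant.\<close>

lemma op_not_into_submodule:
  assumes N: "Y_stable N" and N': "Y_stable N'" and G: "Y_filtration G"
    and x0: "x0 \<in> N" "x0 \<in> G m0" "x0 \<notin> N'"
  shows "b \<noteq> 0 \<Longrightarrow> keys b \<subseteq> exps (2 * n) m \<Longrightarrow> \<exists>x \<in> N \<inter> G (m0 + m). op b x \<notin> N'"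
proof (induction m arbitrary: b)
  case 0
  have "keys b \<subseteq> {0}"
  proof
    fix s assume "s \<in> keys b"
    then have s: "keys s \<subseteq> {..<2*n}" "(\<Sum>j<2*n. lookup s j) = 0"
      using 0(2) by (auto simp: exps_def mdeg_def)
    have "lookup s j = 0" for j
      using s by (cases "j < 2*n") (auto simp: keys_subset_lessThan_iff)
    then show "s \<in> {0}" by (auto intro: poly_mapping_eqI)
  qed
  then have b: "b = cst (lookup b 0)"
    unfolding cst_def by (intro poly_mapping_eqI) (auto simp: lookup_single when_def in_keys_iff)
  then have "lookup b 0 \<noteq> 0" using 0(1) by auto
  moreover have "sc (lookup b 0) x0 \<in> N' \<Longrightarrow> lookup b 0 \<noteq> 0 \<Longrightarrow> x0 \<in> N'"
    using N' subspace_scale[of N' "sc (lookup b 0) x0" "inverse (lookup b 0)"]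
    by (auto simp: Y_stable_def)
  ultimately have "op b x0 \<notin> N'" using x0(3) by (subst b) auto
  then show ?case using x0 by auto
next
  case (Suc m)
  have bA: "inA (2*n) b" using Suc(3) by (auto simp: inA_def exps_def)
  show ?case
  proof (cases "\<exists>j<2*n. pd j b \<noteq> 0")
    case True
    then obtain j where j: "j < 2*n" "pd j b \<noteq> 0" by blast
    have "keys (pd j b) \<subseteq> exps (2 * n) m"
    proof
      fix s assume "s \<in> keys (pd j b)"
      then have "ex j + s \<in> exps (2*n) (Suc m)" using keys_pd Suc(3) by blast
      then show "s \<in> exps (2*n) m" using j(1)
        by (simp add: exps_def mdeg_add mdeg_ex keys_subset_lessThan_iff lookup_add)
    qed
    from Suc(1)[OF j(2) this] obtain x where x: "x \<in> N" "x \<in> G (m0 + m)" "op (pd j b) x \<notin> N'" by auto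
    have sub: "y - z \<in> N'" if "y \<in> N'" "z \<in> N'" for y z
      using that N' by (auto simp: Y_stable_def subspace_diff)
    have G1: "x \<in> G (m0 + Suc m)" using x(2) G by (auto simp: Y_filtration_def)
    \<comment> \<open>Y k is the generator conjugate to variable j: its commutator with
      \<open>op b\<close> is \<open>op (pd j b)\<close> up to sign. If \<open>op b\<close> sent both
      x and Y k x into N', then so would \<open>op (pd j b)\<close> send x.\<close>
    define k where "k = (if j < n then n + j else j - n)"
    have k: "k < 2*n" using j by (auto simp: k_def)
    have Yx: "Y k x \<in> N" "Y k x \<in> G (m0 + Suc m)"
      using x k N G by (auto simp: Y_stable_def Y_filtration_def)
    have "op b x \<notin> N' \<or> op b (Y k x) \<notin> N'"
    proof (rule ccontr)
      assume "\<not> ?thesis"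
      then have a: "op b x \<in> N'" "op b (Y k x) \<in> N'" by auto
      then have b: "Y k (op b x) \<in> N'" using N' k by (auto simp: Y_stable_def)
      show False
      proof (cases "j < n")
        case True
        then show ?thesis using commutator_D[OF bA True, of x] sub[OF b a(2)] x(3)
          by (simp add: k_def)
      next
        case False
        then show ?thesis using commutator_X[OF bA, of "j - n" x] j sub[OF a(2) b] x(3)
          by (simp add: k_def)
      qed
    qed
    then show ?thesis using Yx x(1) G1 by blast
  next
    case False
    have "keys b \<subseteq> {0}"
    proof
      fix s assume s: "s \<in> keys b"
      have "s = 0"
      proof (rule ccontr)
        assume "s \<noteq> 0"
        then obtain j where j: "lookup s j \<noteq> 0" by (metis lookup_zero poly_mapping_eqI)
        then have "j < 2*n" using bA s unfolding inA_def keys_subset_lessThan_iff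
          by (metis not_le)
        then have "pd j b = 0" using False by blast
        then have "lookup (pd j b) (s - ex j) = 0" by simp
        moreover have "ex j + (s - ex j) = s"
          using j by (intro poly_mapping_eqI) (auto simp: lookup_add lookup_minus lookup_single when_def)
        ultimately show False using s unfolding lookup_pd by (simp add: in_keys_iff del: of_nat_Suc)
      qed
      then show "s \<in> {0}" by simp
    qed
    then have "keys b \<subseteq> exps (2*n) m" by auto
    from Suc(1)[OF Suc(2) this] show ?thesis
      using Y_filtration_mono[OF G, of "m0 + m" "m0 + Suc m"] by auto
  qed
qed

text \<open>Joseph's argument with N' = 0 and no degree bookkeeping. It makes the symbol of a
  differential operator unique.\<close>

lemma op_faithful:
  assumes "Y_stable N" "x0 \<in> N" "x0 \<noteq> 0" "inA (2*n) c" "\<And>x. x \<in> N \<Longrightarrow> op c x = 0"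
  shows "c = 0"
proof (rule ccontr)
  assume "c \<noteq> 0"
  define m where "m = Max (mdeg (2*n) ` keys c)"
  have "keys c \<subseteq> exps (2*n) m"
    using assms(4) by (auto simp: exps_def inA_def m_def)
  then have "\<exists>x \<in> N \<inter> UNIV. op c x \<notin> {0}"
    using assms \<open>c \<noteq> 0\<close> op_not_into_submodule[of N "{0}" "\<lambda>_. UNIV" x0 0 c m]
    by (auto simp: Y_stable_def Y_filtration_def subspace_def)
  then show False using assms(5) by auto
qed

end

section \<open>Dimension counts\<close>

lemma homogeneous_system_nontrivial:
  fixes \<kappa> :: "'e \<Rightarrow> 'i \<Rightarrow> 'k::field"
  assumes "finite I" "finite E" "card I < card E"
  shows "\<exists>c. (\<exists>s\<in>E. c s \<noteq> 0) \<and> (\<forall>i\<in>I. (\<Sum>s\<in>E. c s * \<kappa> s i) = 0)"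
  using assms
proof (induction I arbitrary: E \<kappa> rule: finite_induct)
  case empty
  then have "E \<noteq> {}" by auto
  then show ?case by (intro exI[of _ "\<lambda>_. 1"]) auto
next
  case (insert i I)
  show ?case
  proof (cases "\<forall>s\<in>E. \<kappa> s i = 0")
    case True
    have "card I < card E" using insert by simp
    from insert.IH[OF insert.prems(1) this, of \<kappa>] True show ?thesis by auto
  next
    case False
    then obtain s0 where s0: "s0 \<in> E" "\<kappa> s0 i \<noteq> 0" by blast
    let ?E = "E - {s0}"
    \<comment> \<open>Gaussian elimination: equation i is solved for the unknown at the pivot s0 and
      substituted into the other equations.\<close>
    let ?k = "\<lambda>s j. \<kappa> s j - \<kappa> s i / \<kappa> s0 i * \<kappa> s0 j"
    have "finite ?E" "card I < card ?E" using insert s0 by auto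
    from insert.IH[OF this, of ?k] obtain c where c: "\<exists>s\<in>?E. c s \<noteq> 0"
      "\<And>j. j \<in> I \<Longrightarrow> (\<Sum>s\<in>?E. c s * ?k s j) = 0" by blast
    \<comment> \<open>Equation i forces the value -a on the pivot unknown.\<close>
    define a where "a = (\<Sum>s\<in>?E. c s * (\<kappa> s i / \<kappa> s0 i))"
    define d where "d = c(s0 := - a)"
    have S: "(\<Sum>s\<in>E. d s * \<kappa> s j) = (\<Sum>s\<in>?E. c s * \<kappa> s j) - a * \<kappa> s0 j" for j
      using insert.prems(1) s0(1) by (subst sum.remove[of E s0]) (auto simp: d_def intro!: sum.cong)
    have "(\<Sum>s\<in>E. d s * \<kappa> s j) = 0" if "j \<in> I" for j
      using c(2)[OF that] unfolding S a_def
      by (simp add: algebra_simps sum_subtractf sum_distrib_left)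
    moreover have "(\<Sum>s\<in>E. d s * \<kappa> s i) = 0"
      unfolding S a_def using s0(2) by (simp add: sum_distrib_right)
    moreover have "\<exists>s\<in>E. d s \<noteq> 0" using c(1) by (auto simp: d_def)
    ultimately show ?thesis by blast
  qed
qed

context vector_space begin

lemma independent_card_le_dim_span:
  assumes "independent B" "B \<subseteq> span G" "finite G"
  shows "finite B \<and> card B \<le> dim G"
proof -
  obtain B' where B': "B' \<subseteq> G" "independent B'" "G \<subseteq> span B'" "card B' = dim G"
    using basis_exists by blast
  have fB': "finite B'" using B'(1) assms(3) finite_subset by blast
  moreover have "B \<subseteq> span B'" using assms(2) B'(3) span_minimal subspace_span by blast
  ultimately show ?thesis using independent_span_bound[OF fB' assms(1)] B'(4) by simp
qed

lemma finite_basis_exists: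
  assumes "V \<subseteq> span F" "finite F"
  obtains B where "B \<subseteq> V" "independent B" "V \<subseteq> span B" "card B = dim V" "finite B"
  using basis_exists[of V] independent_span_bound[OF assms(2)] assms(1)
  by (metis order.trans)

lemma dim_mono_finite:
  assumes "V \<subseteq> span W" "W \<subseteq> span F" "finite F"
  shows "dim V \<le> dim W"
proof -
  obtain B where B: "B \<subseteq> W" "independent B" "W \<subseteq> span B" "card B = dim W" "finite B"
    using finite_basis_exists[OF assms(2,3)] .
  have "V \<subseteq> span B" using assms(1) B(3) span_minimal subspace_span by blast
  then show ?thesis using dim_le_card[of V B] B by simp
qed

text \<open>The span of W is a complement of S' in S and stands in for the quotient S/S', so
  dimensions of quotients can be counted with vectors of S itself.\<close>

lemma complement_basis_exists:
  assumes "subspace S'" "S' \<subseteq> S" "S \<subseteq> span F" "finite F"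
  shows "\<exists>W. finite W \<and> W \<subseteq> S \<and> card W = dim S - dim S' \<and>
    (\<forall>x\<in>S. \<exists>w\<in>span W. \<exists>z\<in>S'. x = w + z)"
proof -
  obtain B' where B': "B' \<subseteq> S'" "independent B'" "S' \<subseteq> span B'" "card B' = dim S'"
    using basis_exists by blast
  have "B' \<subseteq> S" using B' assms by blast
  from maximal_independent_subset_extend[OF this B'(2)] obtain B where
    B: "B' \<subseteq> B" "B \<subseteq> S" "independent B" "S \<subseteq> span B" by blast
  have fB: "finite B" using independent_span_bound[OF assms(4) B(3)] B(2) assms(3) by blast
  have cB: "card B = dim S" using B by (intro basis_card_eq_dim)
  have "finite (B - B')" "B - B' \<subseteq> S" using fB B by auto
  moreover have "card (B - B') = dim S - dim S'"
    using B(1) fB cB B'(4) by (simp add: card_Diff_subset finite_subset)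
  moreover have "\<exists>w\<in>span (B - B'). \<exists>z\<in>S'. x = w + z" if "x \<in> S" for x
  proof -
    have "x \<in> span ((B - B') \<union> B')" using B that by (auto simp: Un_absorb2)
    then obtain w z where "x = w + z" "w \<in> span (B - B')" "z \<in> span B'"
      unfolding span_Un by blast
    moreover have "span B' \<subseteq> S'" using B'(1) assms(1) span_minimal by blast
    ultimately show ?thesis by blast
  qed
  ultimately show ?thesis by blast
qed

text \<open>Each w imposes one linear condition per element of B on the coefficients, so there are
  fewer conditions than unknowns. With a one-element W this is ordinary linear dependence; with
  larger W it produces one operator killing all of W.\<close>

lemma common_linear_relation:
  assumes E: "finite E" and W: "finite W" and B: "finite B"
    and card: "card W * card B < card E"
    and mem: "\<And>s w. s \<in> E \<Longrightarrow> w \<in> W \<Longrightarrow> f s w \<in> span B"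
  shows "\<exists>c. (\<exists>s\<in>E. c s \<noteq> 0) \<and> (\<forall>w\<in>W. (\<Sum>s\<in>E. c s *s f s w) = 0)"
proof -
  have "\<forall>s w. \<exists>k. s \<in> E \<longrightarrow> w \<in> W \<longrightarrow> f s w = (\<Sum>v\<in>B. k v *s v)"
    using mem unfolding span_finite[OF B] by blast
  then obtain k where k: "\<And>s w. s \<in> E \<Longrightarrow> w \<in> W \<Longrightarrow> f s w = (\<Sum>v\<in>B. k s w v *s v)" by metis
  obtain c where c: "\<exists>s\<in>E. c s \<noteq> 0"
    "\<And>w v. w \<in> W \<Longrightarrow> v \<in> B \<Longrightarrow> (\<Sum>s\<in>E. c s * k s w v) = 0"
    using homogeneous_system_nontrivial[of "W \<times> B" E "\<lambda>s i. k s (fst i) (snd i)"] E W B card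
    by (auto simp: card_cartesian_product)
  have "(\<Sum>s\<in>E. c s *s f s w) = 0" if w: "w \<in> W" for w
  proof -
    have "(\<Sum>s\<in>E. c s *s f s w) = (\<Sum>s\<in>E. \<Sum>v\<in>B. (c s * k s w v) *s v)"
      using k w by (auto intro!: sum.cong simp: scale_sum_right)
    also have "\<dots> = (\<Sum>v\<in>B. (\<Sum>s\<in>E. c s * k s w v) *s v)"
      by (subst sum.swap) (simp add: scale_sum_left)
    also have "\<dots> = 0" using c(2)[OF w] by simp
    finally show ?thesis .
  qed
  then show ?thesis using c(1) by blast
qed

end

text \<open>The box with side \<open>m div card J\<close> in the coordinates of J fits into the
  simplex of total degree m.\<close>

lemma card_exps_in_ge:
  assumes "J \<subseteq> {..<N}" "finite J"
  shows "(m div card J + 1) ^ card J \<le> card {s \<in> exps N m. keys s \<subseteq> J}"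
proof -
  let ?\<phi> = "\<lambda>g. \<Sum>j\<in>J. single j (g j)"
  let ?A = "J \<rightarrow>\<^sub>E {..m div card J}"
  have lk: "lookup (?\<phi> g) j = (if j \<in> J then g j else 0)" for g :: "nat \<Rightarrow> nat" and j
    using assms(2) by (auto simp: lookup_sum lookup_single when_def)
  have inj: "inj_on ?\<phi> ?A"
  proof (rule inj_onI)
    fix g h assume gh: "g \<in> ?A" "h \<in> ?A" "?\<phi> g = ?\<phi> h"
    show "g = h"
    proof (rule PiE_ext[OF gh(1,2)])
      fix j assume "j \<in> J"
      then show "g j = h j" using lk[of g j] lk[of h j] gh(3) by simp
    qed
  qed
  have "?\<phi> ` ?A \<subseteq> {s \<in> exps N m. keys s \<subseteq> J}"
  proof clarify
    fix g assume g: "g \<in> ?A"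
    have k: "keys (?\<phi> g) \<subseteq> J" using lk by (auto simp: in_keys_iff split: if_splits)
    have "mdeg N (?\<phi> g) = (\<Sum>j\<in>J. g j)"
      unfolding mdeg_def lk using assms by (simp add: sum.If_cases Int_absorb1)
    also have "\<dots> \<le> (\<Sum>j\<in>J. m div card J)" using g by (intro sum_mono) auto
    also have "\<dots> \<le> m" by (simp add: div_times_less_eq_dividend mult.commute)
    finally show "?\<phi> g \<in> exps N m \<and> keys (?\<phi> g) \<subseteq> J"
      using k assms by (auto simp: exps_def)
  qed
  then have "card (?\<phi> ` ?A) \<le> card {s \<in> exps N m. keys s \<subseteq> J}"
    by (intro card_mono) auto
  then show ?thesis using inj assms(2) by (simp add: card_image card_PiE)
qed

lemma card_exps_ge: "(m + 1) ^ N \<le> N ^ N * card (exps N m)"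
proof (cases "N = 0")
  case False
  have "(m div N + 1) ^ N \<le> card (exps N m)"
    using card_exps_in_ge[of "{..<N}" N m] by (simp add: exps_def cong: conj_cong)
  moreover have "m + 1 \<le> N * (m div N + 1)"
    using False by (metis Suc_eq_plus1 Suc_leI add.commute dividend_less_times_div mult_Suc_right neq0_conv)
  then have "(m + 1) ^ N \<le> (N * (m div N + 1)) ^ N" by (intro power_mono) auto
  ultimately show ?thesis
    by (metis (no_types, lifting) le_trans mult_le_mono2 power_mult_distrib)
next
  case True
  have "0 \<in> exps N m" by simp
  then have "0 < card (exps N m)" using finite_exps[of N m] card_gt_0_iff by blast
  then show ?thesis using True by simp
qed

text \<open>An exponent is determined by the set K of its large coordinates, at most 2^N choices, by
  values up to m on K and by values up to B elsewhere.\<close>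

lemma card_exps_few_large:
  fixes p B :: nat
  shows "card {s \<in> exps N m. card {j. j < N \<and> B \<le> lookup s j} \<le> p} \<le> (2 ^ N * (B + 1) ^ N) * (m + 1) ^ p"
proof -
  let ?S = "{s \<in> exps N m. card {j. j < N \<and> B \<le> lookup s j} \<le> p}"
  let ?K = "{K. K \<subseteq> {..<N} \<and> card K \<le> p}"
  let ?P = "\<lambda>K. PiE {..<N} (\<lambda>j. if j \<in> K then {..m} else {..B})"
  let ?r = "\<lambda>s. \<lambda>j\<in>{..<N}. lookup s j"
  have inj: "inj_on ?r ?S"
  proof (rule inj_onI)
    fix s t assume st: "s \<in> ?S" "t \<in> ?S" "?r s = ?r t"
    show "s = t"
    proof (rule poly_mapping_eqI)
      fix k show "lookup s k = lookup t k"
        using st(1,2) fun_cong[OF st(3), of k]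
        by (cases "k < N") (auto simp: exps_def keys_subset_lessThan_iff)
    qed
  qed
  have sub: "?r ` ?S \<subseteq> (\<Union>K\<in>?K. ?P K)"
  proof clarify
    fix s assume s: "s \<in> exps N m" "card {j. j < N \<and> B \<le> lookup s j} \<le> p"
    have "lookup s j \<le> m" if "j < N" for j
      using s(1) member_le_sum[of j "{..<N}" "lookup s"] that
      by (auto simp: exps_def mdeg_def)
    then have "?r s \<in> ?P {j. j < N \<and> B \<le> lookup s j}" by auto
    moreover have "{j. j < N \<and> B \<le> lookup s j} \<in> ?K" using s(2) by auto
    ultimately show "?r s \<in> (\<Union>K\<in>?K. ?P K)" by (rule UN_I[rotated])
  qed
  have fK: "finite ?K" by (rule finite_subset[of _ "Pow {..<N}"]) auto
  have "card ?K \<le> card (Pow {..<N})" by (intro card_mono) auto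
  then have cK: "card ?K \<le> 2 ^ N" by (simp add: card_Pow)
  have cP: "card (?P K) \<le> (m + 1) ^ p * (B + 1) ^ N" if "K \<in> ?K" for K
  proof -
    have "card (?P K) = (\<Prod>j<N. if j \<in> K then m + 1 else B + 1)"
      by (simp add: card_PiE) (auto intro!: prod.cong)
    also have "\<dots> = (\<Prod>j\<in>K. m + 1) * (\<Prod>j\<in>{..<N} - K. B + 1)"
      using that by (subst prod.If_cases) (auto simp: Int_absorb1 Diff_eq)
    also have "\<dots> = (m + 1) ^ card K * (B + 1) ^ card ({..<N} - K)" by simp
    also have "\<dots> \<le> (m + 1) ^ p * (B + 1) ^ N"
      using that card_mono[of "{..<N}" "{..<N} - K"] by (intro mult_mono power_increasing) auto
    finally show ?thesis .
  qed
  have "card ?S = card (?r ` ?S)" using inj by (simp add: card_image)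
  also have "\<dots> \<le> card (\<Union>K\<in>?K. ?P K)"
    using fK by (intro card_mono sub finite_UN_I finite_PiE) auto
  also have "\<dots> \<le> (\<Sum>K\<in>?K. card (?P K))" by (rule card_UN_le[OF fK])
  also have "\<dots> \<le> (\<Sum>K\<in>?K. (m + 1) ^ p * (B + 1) ^ N)" by (intro sum_mono cP)
  also have "\<dots> \<le> 2 ^ N * ((m + 1) ^ p * (B + 1) ^ N)" using cK by (simp add: mult_right_mono)
  finally show ?thesis by (simp add: ac_simps)
qed

section \<open>Growth and standard monomials\<close>

context weyl_rep begin

definition Gam :: "'m \<Rightarrow> nat \<Rightarrow> 'm set" where
  "Gam u m = span ((\<lambda>s. mon s u) ` exps (2 * n) m)"

text \<open>Growth of order n + 1/2, squared to stay within the natural numbers. The exponent leaves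
  room above the limit value n and stays below n + 1, the order that is to be excluded.\<close>

definition slow :: "'m \<Rightarrow> bool" where
  "slow u \<longleftrightarrow> (\<exists>C. \<forall>m. (dim (Gam u m))\<^sup>2 \<le> C * (m + 1) ^ (2 * n + 1))"

definition low :: "'m \<Rightarrow> nat \<Rightarrow> 'm set" where
  "low u d = span ((\<lambda>s. mon s u) ` {s. keys s \<subseteq> {..<2*n} \<and> mdeg (2*n) s < d})"

text \<open>A monomial order, compared by degree first: then the sets are finite, and all
  lower-order terms created by commuting generators lie below. Ties are broken by the order on
  \<open>poly_mapping\<close>, which is compatible with addition.\<close>

definition below :: "(nat \<Rightarrow>\<^sub>0 nat) \<Rightarrow> (nat \<Rightarrow>\<^sub>0 nat) set" where
  "below t = {s. keys s \<subseteq> {..<2*n} \<and>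
     (mdeg (2*n) s < mdeg (2*n) t \<or> mdeg (2*n) s = mdeg (2*n) t \<and> s < t)}"

lemma mon_0 [simp]: "mon 0 x = x"
  by (simp add: wmon_def)

lemma subspace_low: "subspace (low u d)" and subspace_Gam: "subspace (Gam u m)"
  by (simp_all add: low_def Gam_def)

lemma low_mono: "d \<le> d' \<Longrightarrow> low u d \<subseteq> low u d'"
  unfolding low_def by (intro span_mono) auto

lemma mon_low: "keys s \<subseteq> {..<2*n} \<Longrightarrow> mdeg (2*n) s < d \<Longrightarrow> mon s u \<in> low u d"
  unfolding low_def by (intro span_base) auto

lemma linear_span_image:
  assumes "\<And>x y. f (x + y) = f x + f y" "\<And>c x. f (sc c x) = sc c (f x)"
    "x \<in> span S" "\<And>s. s \<in> S \<Longrightarrow> f s \<in> N" "subspace N"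
  shows "f x \<in> N"
proof -
  have "S \<subseteq> {x. f x \<in> N}" using assms by auto
  moreover have "subspace {x. f x \<in> N}" by (rule subspace_Collect_linear_mem) (use assms in auto)
  ultimately show ?thesis using span_minimal assms(3) by blast
qed

lemma Y_D_mon:
  assumes "i < n" "keys s \<subseteq> {..<2*n}"
  shows "Y (n + i) (mon s x) = mon (ex (n + i) + s) x + sc (of_nat (lookup s i)) (mon (s - ex i) x)"
proof -
  have "op (single s 1) x = mon s x" by (simp add: op_single)
  then show ?thesis
    using commutator_D[of "single s 1" i x] assms
    by (simp add: inA_single op_single pd_single mon_D)
qed

lemma keys_ex_add: "i < N \<Longrightarrow> keys s \<subseteq> {..<N} \<Longrightarrow> keys (ex i + s) \<subseteq> {..<N}"
  by (simp add: keys_subset_lessThan_iff lookup_add lookup_single)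

lemma keys_minus_subset: "keys s \<subseteq> {..<N} \<Longrightarrow> keys (s - t) \<subseteq> {..<N}" for t :: "nat \<Rightarrow>\<^sub>0 nat"
  by (simp add: keys_subset_lessThan_iff lookup_minus)

lemma mdeg_minus_ex: "i < N \<Longrightarrow> lookup s i \<noteq> 0 \<Longrightarrow> mdeg N s = Suc (mdeg N (s - ex i))"
proof -
  assume i: "i < N" "lookup s i \<noteq> 0"
  then have "s = ex i + (s - ex i)"
    by (intro poly_mapping_eqI) (auto simp: lookup_add lookup_minus lookup_single when_def)
  then have "mdeg N s = mdeg N (ex i + (s - ex i))" by simp
  then show ?thesis using i by (simp add: mdeg_add mdeg_ex)
qed

lemma Y_low:
  assumes j: "j < 2*n" and x: "x \<in> low u d"
  shows "Y j x \<in> low u (Suc d)"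
proof (rule linear_span_image[of "Y j" x, OF Y_add Y_scale x[unfolded low_def] _ subspace_low])
  fix y assume "y \<in> (\<lambda>s. mon s u) ` {s. keys s \<subseteq> {..<2*n} \<and> mdeg (2*n) s < d}"
  then obtain s where s: "y = mon s u" "keys s \<subseteq> {..<2*n}" "mdeg (2*n) s < d" by blast
  have 1: "mon (ex j + s) u \<in> low u (Suc d)"
    using s j by (intro mon_low keys_ex_add) (auto simp: mdeg_add mdeg_ex)
  have 2: "mon (s - ex i) u \<in> low u (Suc d)" if "lookup s i \<noteq> 0" "i < 2*n" for i
    using s mdeg_minus_ex[OF that(2,1)] by (intro mon_low keys_minus_subset) auto
  show "Y j y \<in> low u (Suc d)"
  proof (cases "j < n")
    case True
    then show ?thesis using 1 s by (simp add: mon_X)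
  next
    case False
    define i where "i = j - n"
    then have i: "j = n + i" "i < n" using False j by auto
    have "sc (of_nat (lookup s i)) (mon (s - ex i) u) \<in> low u (Suc d)"
      using 2[of i] i subspace_low by (cases "lookup s i = 0") (auto simp: subspace_0 subspace_scale)
    then show ?thesis using 1 i s Y_D_mon subspace_low by (auto simp: subspace_add)
  qed
qed

lemma Gam_eq_low: "Gam u m = low u (Suc m)"
proof -
  have "exps (2*n) m = {s. keys s \<subseteq> {..<2*n} \<and> mdeg (2*n) s < Suc m}"
    by (auto simp: exps_def)
  then show ?thesis by (simp add: low_def Gam_def)
qed

lemma Gam_filtration: "Y_filtration (Gam u)"
proof -
  have "low u (Suc m) \<subseteq> low u (Suc (Suc m))" for m by (rule low_mono) simp
  then show ?thesis
    unfolding Y_filtration_def Gam_eq_low using subspace_low Y_low by blast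
qed

lemma u_in_Gam: "u \<in> Gam u m"
proof -
  have "(\<lambda>s. mon s u) 0 \<in> Gam u m" unfolding Gam_def by (intro span_base imageI zero_in_exps)
  then show ?thesis by simp
qed

lemma op_in_Gam: "keys c \<subseteq> exps (2*n) m \<Longrightarrow> op c u \<in> Gam u m"
  unfolding Gam_def by (intro op_mem_subspace subspace_span span_base) auto

text \<open>Commuting a derivative past a power of x costs terms of smaller degree, so monomials
  multiply by adding exponents up to lower degree; this is the commutativity of the associated
  graded algebra.\<close>

lemma mon_mon_low:
  assumes t: "keys t \<subseteq> {..<2*n}"
  shows "keys s \<subseteq> {..<2*n} \<Longrightarrow> mon t (mon s u) - mon (t + s) u \<in> low u (mdeg (2*n) t + mdeg (2*n) s)"
  using t
proof (induction arbitrary: s rule: exponent_induct)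
  case zero
  then show ?case using subspace_low by (simp add: subspace_0)
next
  case (step j t)
  have sub: "subspace (low u d)" for d by (rule subspace_low)
  show ?case
  proof (cases "j < n")
    case True
    let ?x = "mon t (mon s u)" and ?y = "mon (t + s) u"
    have "Y j (?x - ?y) \<in> low u (Suc (mdeg (2*n) t + mdeg (2*n) s))"
      using step by (intro Y_low) auto
    moreover have "Y j (?x - ?y) = Y j ?x - Y j ?y"
      using Y_add[of j "?x - ?y" ?y] by (simp add: algebra_simps)
    ultimately show ?thesis using step True
      by (simp add: mon_X add.assoc mdeg_add mdeg_ex)
  next
    case False
    define i where "i = j - n"
    have i: "j = n + i" "i < n" using False step(1) by (auto simp: i_def)
    let ?d = "mdeg (2*n) (ex j + t) + mdeg (2*n) s"
    have d: "?d = Suc (mdeg (2*n) t + mdeg (2*n) s)" using step(1) by (simp add: mdeg_add mdeg_ex)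
    have A: "mon t (mon (ex j + s) u) - mon (ex j + t + s) u \<in> low u ?d"
      using step(3)[of "ex j + s"] step(1,4) keys_ex_add[OF step(1) step(4)] d
      by (simp add: mdeg_add mdeg_ex ac_simps)
    have B: "sc (of_nat (lookup s i)) (mon t (mon (s - ex i) u)) \<in> low u ?d"
    proof (cases "lookup s i = 0")
      case True
      then show ?thesis using sub by (simp add: subspace_0)
    next
      case F: False
      have i2: "i < 2*n" using i by simp
      note m = mdeg_minus_ex[OF i2 F]
      have k: "keys (s - ex i) \<subseteq> {..<2*n}" by (rule keys_minus_subset[OF step(4)])
      have "mon t (mon (s - ex i) u) - mon (t + (s - ex i)) u \<in> low u ?d"
        using step(3)[OF k] low_mono[of "mdeg (2*n) t + mdeg (2*n) (s - ex i)" ?d u] m d by auto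
      moreover have "mon (t + (s - ex i)) u \<in> low u ?d"
        using k step(2) m d by (intro mon_low) (auto simp: keys_subset_lessThan_iff lookup_add mdeg_add)
      ultimately have "mon t (mon (s - ex i) u) \<in> low u ?d"
        using subspace_add[OF sub] by (metis diff_add_cancel)
      then show ?thesis using sub subspace_scale by blast
    qed
    have "mon (ex j + t) (mon s u) = mon t (Y j (mon s u))" using i by (simp add: mon_D)
    also have "\<dots> = mon t (mon (ex j + s) u) + sc (of_nat (lookup s i)) (mon t (mon (s - ex i) u))"
      using linear_mon[of t] Y_D_mon[OF i(2) step(4)] i by (simp add: Vector_Spaces.linear_iff)
    finally show ?thesis using subspace_add[OF sub A B] by (simp add: algebra_simps)
  qed
qed

text \<open>As for Groebner bases: multiplying a relation by the monomial t shifts its leading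
  exponent to t + b, while all other terms, including the commutator corrections, stay below.
  Solving for the leading term reduces every multiple of b.\<close>

lemma leading_exponent_reduction:
  assumes c: "op c u = 0" "inA (2*n) c" and b: "b \<in> keys c"
    and max: "\<And>s. s \<in> keys c \<Longrightarrow> s \<noteq> b \<Longrightarrow> s \<in> below b"
    and t: "keys t \<subseteq> {..<2*n}"
  shows "mon (t + b) u \<in> span ((\<lambda>s. mon s u) ` below (t + b))"
proof -
  let ?S = "span ((\<lambda>s. mon s u) ` below (t + b))"
  let ?K = "keys c - {b}"
  have sub: "subspace ?S" by simp
  have lk: "lookup c b \<noteq> 0" using b by (simp add: in_keys_iff)
  have low: "low u (mdeg (2*n) (t + b)) \<subseteq> ?S"
    unfolding low_def below_def by (intro span_mono) auto
  have kb: "keys b \<subseteq> {..<2*n}" using b c(2) by (auto simp: inA_def)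
  have "op c u = sc (lookup c b) (mon b u) + (\<Sum>s\<in>?K. sc (lookup c s) (mon s u))"
    using b unfolding wop_def by (subst sum.remove[of _ b]) auto
  then have "mon t (sc (lookup c b) (mon b u) + (\<Sum>s\<in>?K. sc (lookup c s) (mon s u))) = 0"
    using c(1) module_hom.zero[OF linear_mon[of t, folded module_hom_iff_linear]] by simp
  then have "sc (lookup c b) (mon t (mon b u)) = - (\<Sum>s\<in>?K. sc (lookup c s) (mon t (mon s u)))"
    unfolding eq_neg_iff_add_eq_0 using linear_mon[of t]
    by (simp add: module_hom.sum[OF linear_mon[folded module_hom_iff_linear]] Vector_Spaces.linear_iff)
  moreover have "(\<Sum>s\<in>?K. sc (lookup c s) (mon t (mon s u))) \<in> ?S"
  proof (intro subspace_sum[OF sub] subspace_scale[OF sub])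
    fix s assume s: "s \<in> ?K"
    then have sb: "s \<in> below b" using max by blast
    then have ks: "keys s \<subseteq> {..<2*n}" by (simp add: below_def)
    have "mon (t + s) u \<in> ?S"
    proof (intro span_base imageI)
      show "t + s \<in> below (t + b)" using sb t
        by (auto simp: below_def mdeg_add keys_subset_lessThan_iff lookup_add add_strict_left_mono)
    qed
    moreover have "mdeg (2*n) t + mdeg (2*n) s \<le> mdeg (2*n) (t + b)"
      using sb by (auto simp: below_def mdeg_add)
    then have "mon t (mon s u) - mon (t + s) u \<in> ?S"
      using mon_mon_low[OF t ks, of u] low low_mono by blast
    ultimately show "mon t (mon s u) \<in> ?S" using subspace_add[OF sub] by (metis diff_add_cancel)
  qed
  ultimately have "sc (lookup c b) (mon t (mon b u)) \<in> ?S"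
    using subspace_neg[OF sub] by simp
  then have "mon t (mon b u) \<in> ?S"
    using lk subspace_scale[OF sub, of "sc (lookup c b) (mon t (mon b u))" "inverse (lookup c b)"]
    by simp
  moreover have "mon t (mon b u) - mon (t + b) u \<in> ?S"
    using mon_mon_low[OF t kb, of u] low by (auto simp: mdeg_add)
  ultimately have "mon t (mon b u) - (mon t (mon b u) - mon (t + b) u) \<in> ?S" by (rule subspace_diff[OF sub])
  then show ?thesis by simp
qed

lemma exists_leading_exponent:
  assumes "c \<noteq> 0" "inA (2*n) c"
  shows "\<exists>b\<in>keys c. \<forall>s\<in>keys c. s \<noteq> b \<longrightarrow> s \<in> below b"
proof -
  let ?K = "keys c"
  have ne: "?K \<noteq> {}" using assms(1) by simp
  define d where "d = Max (mdeg (2*n) ` ?K)"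
  let ?L = "{s\<in>?K. mdeg (2*n) s = d}"
  have "d \<in> mdeg (2*n) ` ?K" unfolding d_def using ne by (intro Max_in) auto
  then have neL: "?L \<noteq> {}" by auto
  define b where "b = Max ?L"
  have fL: "finite ?L" by simp
  have b: "b \<in> ?L" unfolding b_def using neL fL Max_in by blast
  have "s \<in> below b" if "s \<in> ?K" "s \<noteq> b" for s
  proof -
    have "mdeg (2*n) s \<le> d" unfolding d_def using that by (intro Max_ge) auto
    moreover have "s \<le> b" if "mdeg (2*n) s = d"
      unfolding b_def using that \<open>s \<in> ?K\<close> by (intro Max_ge) auto
    ultimately show ?thesis using that assms(2) b by (auto simp: below_def inA_def)
  qed
  then show ?thesis using b by blast
qed

lemma Gam_relation:
  assumes E: "E \<subseteq> exps (2*n) m" "dim (Gam u m) < card E"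
  obtains c where "c \<noteq> 0" "inA (2*n) c" "op c u = 0" "keys c \<subseteq> E"
proof -
  have fin: "finite E" using E finite_exps finite_subset by blast
  obtain B where B: "B \<subseteq> Gam u m" "independent B" "Gam u m \<subseteq> span B" "card B = dim (Gam u m)" "finite B"
    using finite_basis_exists[of "Gam u m" "(\<lambda>s. mon s u) ` exps (2 * n) m"] by (auto simp: Gam_def)
  have "mon s u \<in> Gam u m" if "s \<in> E" for s
    unfolding Gam_def using that E(1) by (intro span_base) auto
  then have "mon s u \<in> span B" if "s \<in> E" for s using that B(3) by blast
  then obtain k where k: "\<exists>s\<in>E. k s \<noteq> 0" "(\<Sum>s\<in>E. sc (k s) (mon s u)) = 0"
    using common_linear_relation[of E "{u}" B "\<lambda>s w. mon s w"] fin B(5) E(2) B(4) by auto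
  define c where "c = (\<Sum>s\<in>E. single s (k s))"
  have lk: "lookup c s = (if s \<in> E then k s else 0)" for s
    unfolding c_def using fin by (auto simp: lookup_sum lookup_single when_def)
  have "c \<noteq> 0" using k(1) lk by (metis lookup_zero)
  moreover have "keys c \<subseteq> E" using lk by (auto simp: in_keys_iff split: if_splits)
  moreover have "op c u = 0" unfolding c_def op_sum op_single by (rule k(2))
  ultimately show ?thesis using that[of c] E(1) by (auto simp: inA_def exps_def)
qed

text \<open>Reduction terminates because \<open>below r\<close> is a proper subset of the finite set
  \<open>below s\<close> whenever r lies in \<open>below s\<close>; its cardinality serves as the
  induction measure.\<close>

lemma exps_span_standard:
  assumes red: "\<And>s. s \<in> exps (2*n) m \<Longrightarrow> \<not> good s \<Longrightarrow> mon s u \<in> span ((\<lambda>s. mon s u) ` below s)"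
    and s: "s \<in> exps (2*n) m"
  shows "mon s u \<in> span ((\<lambda>s. mon s u) ` {s \<in> exps (2*n) m. good s})" (is "_ \<in> ?T")
  using s
proof (induction "card (below s)" arbitrary: s rule: less_induct)
  case less
  have sub: "below t \<subseteq> exps (2*n) (mdeg (2*n) t)" for t by (auto simp: below_def exps_def)
  then have fin: "finite (below t)" for t using finite_exps finite_subset by blast
  show ?case
  proof (cases "good s")
    case True
    then show ?thesis using less by (intro span_base) auto
  next
    case False
    have "mon r u \<in> ?T" if r: "r \<in> below s" for r
    proof (rule less(1))
      have "below r \<subset> below s" using r by (auto simp: below_def)
      then show "card (below r) < card (below s)" using fin psubset_card_mono by blast
      show "r \<in> exps (2*n) m" using r less(2) by (auto simp: below_def exps_def)
    qed
    then have "span ((\<lambda>s. mon s u) ` below s) \<subseteq> ?T" by (intro span_minimal) auto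
    then show ?thesis using red[OF less(2) False] by blast
  qed
qed

text \<open>Growth of order less than n + 1 already forces growth of order at most n: any n + 1 of the
  generators satisfy a relation, so in a standard monomial at most n exponents are large.\<close>

lemma slow_imp_dim_Gam_le:
  assumes "slow u"
  shows "\<exists>C. \<forall>m. dim (Gam u m) \<le> C * (m + 1) ^ n"
proof -
  obtain C where C: "\<And>m. (dim (Gam u m))\<^sup>2 \<le> C * (m + 1) ^ (2 * n + 1)"
    using assms by (auto simp: slow_def)
  let ?Js = "{J. J \<subseteq> {..<2*n} \<and> card J = n + 1}"
  let ?P = "\<lambda>J b. keys b \<subseteq> J \<and> (\<forall>t. keys t \<subseteq> {..<2*n} \<longrightarrow>
      mon (t + b) u \<in> span ((\<lambda>s. mon s u) ` below (t + b)))"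
  have "\<exists>b. ?P J b" if J: "J \<in> ?Js" for J
  proof -
    define k where "k = n + 1"
    \<comment> \<open>The choice makes \<open>C * (k * (t + 1)) ^ (2 * n + 1)\<close> equal to
      \<open>t * (t + 1) ^ (2 * n + 1)\<close>, which is smaller than the square of
      \<open>(t + 1) ^ (n + 1)\<close>. With m = k t the box of side t in the n + 1 coordinates of J
      therefore has more points than \<open>Gam u m\<close> has dimensions.\<close>
    define t where "t = C * k ^ (2 * n + 1)"
    define m where "m = k * t"
    have k: "k > 0" by (simp add: k_def)
    have fJ: "finite J" using J finite_subset by blast
    have "(dim (Gam u m))\<^sup>2 \<le> C * (m + 1) ^ (2 * n + 1)" by (rule C)
    also have "\<dots> \<le> C * (k * (t + 1)) ^ (2 * n + 1)"
      using k by (intro mult_le_mono2 power_mono) (auto simp: m_def)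
    also have "\<dots> = t * (t + 1) ^ (2 * n + 1)"
      unfolding power_mult_distrib t_def by (simp only: ac_simps)
    also have "\<dots> < (t + 1) * (t + 1) ^ (2 * n + 1)" by (intro mult_strict_right_mono) auto
    also have "\<dots> = ((t + 1) ^ (n + 1))\<^sup>2"
      by (simp add: mult.commute flip: power_Suc power_mult)
    finally have "dim (Gam u m) < (t + 1) ^ (n + 1)" using power2_less_imp_less by blast
    also have "\<dots> = (m div card J + 1) ^ card J"
    proof -
      have "card J = k" "n + 1 = k" using J by (auto simp: k_def)
      moreover have "m div k = t" using k by (simp add: m_def)
      ultimately show ?thesis by (simp only:)
    qed
    also have "\<dots> \<le> card {s \<in> exps (2*n) m. keys s \<subseteq> J}"
      using J fJ by (intro card_exps_in_ge) auto
    finally have "dim (Gam u m) < card {s \<in> exps (2*n) m. keys s \<subseteq> J}" .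
    from Gam_relation[OF _ this] obtain c where c: "c \<noteq> 0" "inA (2*n) c" "op c u = 0"
      "keys c \<subseteq> {s \<in> exps (2*n) m. keys s \<subseteq> J}"
      by (metis (no_types, lifting) mem_Collect_eq subsetI)
    obtain b where b: "b \<in> keys c" "\<And>s. s \<in> keys c \<Longrightarrow> s \<noteq> b \<Longrightarrow> s \<in> below b"
      using exists_leading_exponent[OF c(1,2)] by blast
    have "keys b \<subseteq> J" using b(1) c(4) by auto
    then show ?thesis using leading_exponent_reduction[OF c(3,2) b] by auto
  qed
  then have "\<forall>J\<in>?Js. \<exists>b. ?P J b" by blast
  from bchoice[OF this] obtain b where "\<forall>J\<in>?Js. ?P J (b J)" ..
  then have b: "keys (b J) \<subseteq> J"
    "keys t \<subseteq> {..<2*n} \<Longrightarrow> mon (t + b J) u \<in> span ((\<lambda>s. mon s u) ` below (t + b J))"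
    if "J \<in> ?Js" for J t using that by blast+
  have fJs: "finite ?Js" by (rule finite_subset[of _ "Pow {..<2*n}"]) auto
  \<comment> \<open>A common bound for all entries of the finitely many leading exponents
    \<open>b J\<close>.\<close>
  define B where "B = (\<Sum>J\<in>?Js. \<Sum>j<2*n. lookup (b J) j)"
  have B: "lookup (b J) j \<le> B" if "J \<in> ?Js" "j < 2*n" for J j
  proof -
    have "lookup (b J) j \<le> (\<Sum>j<2*n. lookup (b J) j)"
      using that by (intro member_le_sum) auto
    also have "\<dots> \<le> B" unfolding B_def using that fJs
      by (intro member_le_sum[of J ?Js "\<lambda>J. \<Sum>j<2*n. lookup (b J) j"]) auto
    finally show ?thesis .
  qed
  define good where "good s \<longleftrightarrow> card {j. j < 2*n \<and> B \<le> lookup s j} \<le> n" for s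
  have red: "mon s u \<in> span ((\<lambda>s. mon s u) ` below s)" if s: "keys s \<subseteq> {..<2*n}" "\<not> good s" for s
  proof -
    have "n + 1 \<le> card {j. j < 2*n \<and> B \<le> lookup s j}" using s(2) by (simp add: good_def)
    then obtain J where J: "J \<subseteq> {j. j < 2*n \<and> B \<le> lookup s j}" "card J = n + 1"
      by (rule obtain_subset_with_card_n)
    then have J': "J \<in> ?Js" by auto
    \<comment> \<open>Truncated subtraction loses nothing: on J the entries of s are at least B, and
      \<open>b J\<close> vanishes outside J.\<close>
    have "s = (s - b J) + b J"
    proof (rule poly_mapping_eqI)
      fix j show "lookup s j = lookup (s - b J + b J) j"
      proof (cases "j \<in> J")
        case True
        then have "lookup (b J) j \<le> lookup s j" using B[OF J', of j] J(1) by force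
        then show ?thesis by (simp add: lookup_add lookup_minus)
      next
        case False
        then have "lookup (b J) j = 0" using b(1)[OF J'] by (auto simp: in_keys_iff)
        then show ?thesis by (simp add: lookup_add lookup_minus)
      qed
    qed
    then show ?thesis using b(2)[OF J' keys_minus_subset[OF s(1), of "b J"]] by simp
  qed
  have "dim (Gam u m) \<le> (2 ^ (2*n) * (B + 1) ^ (2*n)) * (m + 1) ^ n" for m
  proof -
    let ?T = "(\<lambda>s. mon s u) ` {s \<in> exps (2*n) m. good s}"
    have "mon s u \<in> span ?T" if "s \<in> exps (2*n) m" for s
      using that red by (intro exps_span_standard) (auto simp: exps_def)
    then have "Gam u m \<subseteq> span ?T" unfolding Gam_def by (intro span_minimal) auto
    then have "dim (Gam u m) \<le> card ?T" by (rule dim_le_card) simp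
    also have "\<dots> \<le> card {s \<in> exps (2*n) m. good s}" by (intro card_image_le) simp
    also have "\<dots> \<le> (2 ^ (2*n) * (B + 1) ^ (2*n)) * (m + 1) ^ n"
      unfolding good_def by (rule card_exps_few_large)
    finally show ?thesis .
  qed
  then show ?thesis by blast
qed

end

section \<open>Bernstein's inequality and simple submodules\<close>

context weyl_rep begin

lemma Gam_finite_dim: "Gam u m \<subseteq> span ((\<lambda>s. mon s u) ` exps (2 * n) m)"
  by (simp add: Gam_def)

text \<open>Were the product smaller, some nonzero operator of degree at most m would kill a
  complement of N' in N at level m0 + m, hence send that level of N into N'. Joseph's argument
  forbids this. The shift m0 is the level of a vector witnessing that N' is proper.\<close>

lemma bernstein_inequality:
  assumes N: "Y_stable N" and N': "Y_stable N'" and sub: "N' \<subseteq> N"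
    and x0: "x0 \<in> N" "x0 \<in> Gam u m0" "x0 \<notin> N'"
  shows "card (exps (2*n) m) \<le> (dim (N \<inter> Gam u (m0 + m)) - dim (N' \<inter> Gam u (m0 + m))) * dim (Gam u (m0 + m + m))"
proof (rule ccontr)
  let ?G1 = "Gam u (m0 + m)" and ?G2 = "Gam u (m0 + m + m)"
  assume "\<not> ?thesis"
  then have less: "(dim (N \<inter> ?G1) - dim (N' \<inter> ?G1)) * dim ?G2 < card (exps (2*n) m)" by simp
  have sN': "subspace N'" "subspace N" using N N' by (auto simp: Y_stable_def)
  have c1: "subspace (N' \<inter> ?G1)" using sN' subspace_Gam by (intro subspace_inter) auto
  have c2: "N' \<inter> ?G1 \<subseteq> N \<inter> ?G1" using sub by blast
  have c3: "N \<inter> ?G1 \<subseteq> span ((\<lambda>s. mon s u) ` exps (2 * n) (m0 + m))" using Gam_finite_dim by blast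
  have c4: "finite ((\<lambda>s. mon s u) ` exps (2 * n) (m0 + m))" by simp
  obtain W where W: "finite W" "W \<subseteq> N \<inter> ?G1" "card W = dim (N \<inter> ?G1) - dim (N' \<inter> ?G1)"
    "\<forall>x\<in>N \<inter> ?G1. \<exists>w\<in>span W. \<exists>z\<in>N' \<inter> ?G1. x = w + z"
    using complement_basis_exists[OF c1 c2 c3 c4] by blast
  obtain B where B: "B \<subseteq> ?G2" "independent B" "?G2 \<subseteq> span B" "card B = dim ?G2" "finite B"
    by (rule finite_basis_exists[OF Gam_finite_dim]) simp
  have "mon s w \<in> span B" if "s \<in> exps (2*n) m" "w \<in> W" for s w
    using mon_filtration[OF Gam_filtration _ that(1), of w u "m0 + m"] that(2) W(2) B(3) by blast
  then obtain k where k: "\<exists>s\<in>exps (2*n) m. k s \<noteq> 0"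
    "\<And>w. w \<in> W \<Longrightarrow> (\<Sum>s\<in>exps (2*n) m. sc (k s) (mon s w)) = 0"
    using common_linear_relation[of "exps (2*n) m" W B "\<lambda>s w. mon s w"] W(1,3) B(4,5) less by auto
  define b where "b = (\<Sum>s\<in>exps (2*n) m. single s (k s))"
  have lk: "lookup b s = (if s \<in> exps (2*n) m then k s else 0)" for s
    unfolding b_def by (auto simp: lookup_sum lookup_single when_def)
  have "b \<noteq> 0" using k(1) lk by (metis lookup_zero)
  moreover have "keys b \<subseteq> exps (2*n) m" using lk by (auto simp: in_keys_iff split: if_splits)
  ultimately obtain x where x: "x \<in> N \<inter> ?G1" "op b x \<notin> N'"
    using op_not_into_submodule[OF N N' Gam_filtration x0(1,2,3)] by blast
  obtain w z where wz: "w \<in> span W" "z \<in> N'" "x = w + z" using W(4) x(1) by blast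
  have "op b w \<in> {0}"
  proof (rule linear_span_image[of "op b" w, OF op_add_right op_scale_right wz(1)])
    fix s assume "s \<in> W"
    then show "op b s \<in> {0}" unfolding b_def op_sum op_single using k(2) by simp
  qed (rule subspace_single_0)
  then have "op b x = op b z" using wz(3) by simp
  then show False using x(2) op_stable[OF N' wz(2)] by simp
qed

lemma Y_stable_0: "Y_stable {0}" and Y_stable_UNIV: "Y_stable UNIV"
  by (auto simp: Y_stable_def)

text \<open>For the pair 0 and the whole space, Bernstein's inequality bounds m^(2 n) by the product
  of the dimensions at levels m and 2 m, up to a constant. The upper bound on the second factor
  turns this into a lower bound on the first; 2^n comes from 2 m + 1 \<le> 2 (m + 1).\<close>

lemma dim_Gam_ge:
  assumes "u \<noteq> 0" and C: "\<And>m. dim (Gam u m) \<le> C * (m + 1) ^ n"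
  shows "(m + 1) ^ n \<le> (2*n) ^ (2*n) * C * 2 ^ n * dim (Gam u m)"
proof -
  have "card (exps (2*n) m) \<le> (dim (UNIV \<inter> Gam u (0 + m)) - dim ({0} \<inter> Gam u (0 + m))) * dim (Gam u (0 + m + m))"
    by (rule bernstein_inequality[of UNIV "{0}" u]) (use Y_stable_0 Y_stable_UNIV u_in_Gam assms in auto)
  also have "\<dots> \<le> dim (Gam u m) * dim (Gam u (m + m))" by (intro mult_mono) auto
  also have "\<dots> \<le> dim (Gam u m) * (C * (m + m + 1) ^ n)" using C by (intro mult_mono) auto
  also have "\<dots> \<le> dim (Gam u m) * (C * (2 * (m + 1)) ^ n)" by (intro mult_mono power_mono) auto
  also have "\<dots> = (C * 2 ^ n * dim (Gam u m)) * (m + 1) ^ n" by (simp only: power_mult_distrib ac_simps)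
  finally have c: "card (exps (2*n) m) \<le> (C * 2 ^ n * dim (Gam u m)) * (m + 1) ^ n" .
  have "(m + 1) ^ n * (m + 1) ^ n = (m + 1) ^ (2*n)" by (simp add: mult_2 power_add)
  also have "\<dots> \<le> (2*n) ^ (2*n) * card (exps (2*n) m)" by (rule card_exps_ge)
  also have "\<dots> \<le> (2*n) ^ (2*n) * ((C * 2 ^ n * dim (Gam u m)) * (m + 1) ^ n)" using c by (intro mult_le_mono2)
  also have "\<dots> = ((2*n) ^ (2*n) * C * 2 ^ n * dim (Gam u m)) * (m + 1) ^ n" by (simp only: ac_simps)
  finally show ?thesis by (simp only: mult_le_cancel2) simp
qed

text \<open>By Bernstein's inequality every proper inclusion raises the dimension at level 2 m by at
  least a constant times m^n, while the total is at most a constant times m^n. The factor 9^n comes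
  from bounding 2 m + 1 and 3 m + 1 by 3 (m + 1).\<close>

lemma chain_length_bounded:
  assumes C: "\<And>m. dim (Gam u m) \<le> C * (m + 1) ^ n"
    and f: "\<And>i. i \<le> r \<Longrightarrow> Y_stable (f i)" "\<And>i. i < r \<Longrightarrow> f i \<subset> f (Suc i)"
    and fu: "\<And>i. i \<le> r \<Longrightarrow> f i \<subseteq> (\<Union>m. Gam u m)"
  shows "r \<le> (2*n) ^ (2*n) * C\<^sup>2 * 9 ^ n"
proof -
  have "\<exists>m x. x \<in> f (Suc i) \<and> x \<notin> f i \<and> x \<in> Gam u m" if "i < r" for i
    using f(2)[OF that] fu[of "Suc i"] that by fastforce
  then have "\<forall>i\<in>{..<r}. \<exists>m. \<exists>x. x \<in> f (Suc i) \<and> x \<notin> f i \<and> x \<in> Gam u m" by blast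
  from bchoice[OF this] obtain mm where mm: "\<forall>i\<in>{..<r}. \<exists>x. x \<in> f (Suc i) \<and> x \<notin> f i \<and> x \<in> Gam u (mm i)" ..
  \<comment> \<open>One level that contains the witnesses of all r proper inclusions.\<close>
  define m where "m = (\<Sum>i<r. mm i)"
  have Gm: "Gam u (mm i) \<subseteq> Gam u m" if "i < r" for i
    unfolding m_def using that
    by (intro Y_filtration_mono[OF Gam_filtration] member_le_sum) auto
  define d where "d i = dim (f i \<inter> Gam u (m + m))" for i
  define K where "K = (2*n) ^ (2*n)"
  define D where "D = dim (Gam u (m + m + m))"
  have step: "(m + 1) ^ (2*n) \<le> K * ((d (Suc i) - d i) * D)" if i: "i < r" for i
  proof -
    obtain x where x: "x \<in> f (Suc i)" "x \<notin> f i" "x \<in> Gam u (mm i)" using mm i by auto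
    have "card (exps (2*n) m) \<le> (d (Suc i) - d i) * D"
      unfolding d_def D_def using i x Gm[OF i] f by (intro bernstein_inequality) auto
    then have "K * card (exps (2*n) m) \<le> K * ((d (Suc i) - d i) * D)" by (rule mult_le_mono2)
    then show ?thesis using card_exps_ge[of m "2*n"] unfolding K_def by linarith
  qed
  have mono: "d i \<le> d (Suc i)" if "i < r" for i
  proof -
    have "f i \<inter> Gam u (m + m) \<subseteq> span (f (Suc i) \<inter> Gam u (m + m))"
      using f(2)[OF that] span_superset by blast
    moreover have "f (Suc i) \<inter> Gam u (m + m) \<subseteq> span ((\<lambda>s. mon s u) ` exps (2 * n) (m + m))"
      using Gam_finite_dim by blast
    ultimately show ?thesis unfolding d_def by (rule dim_mono_finite) simp
  qed
  have "r' * (m + 1) ^ (2*n) \<le> K * D * d r'" if "r' \<le> r" for r'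
    using that
  proof (induction r')
    case (Suc r')
    then have "Suc r' * (m + 1) ^ (2*n) \<le> K * D * d r' + K * ((d (Suc r') - d r') * D)"
      using step[of r'] by simp
    also have "\<dots> = K * D * (d r' + (d (Suc r') - d r'))" by (simp add: algebra_simps)
    also have "\<dots> = K * D * d (Suc r')" using mono[of r'] Suc by simp
    finally show ?case .
  qed simp
  then have "r * (m + 1) ^ (2*n) \<le> K * D * d r" by simp
  also have "d r \<le> dim (Gam u (m + m))"
  proof -
    have "f r \<inter> Gam u (m + m) \<subseteq> span (Gam u (m + m))" using span_superset by blast
    then show ?thesis unfolding d_def by (rule dim_mono_finite[OF _ Gam_finite_dim]) simp
  qed
  then have "K * D * d r \<le> K * D * (C * (m + m + 1) ^ n)" using C[of "m + m"] by (intro mult_le_mono2) linarith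
  also have "\<dots> \<le> K * (C * (m + m + m + 1) ^ n) * (C * (m + m + 1) ^ n)"
    using C[of "m + m + m"] by (intro mult_le_mono1 mult_le_mono2) (simp add: D_def)
  also have "\<dots> \<le> K * (C * (3 * (m + 1)) ^ n) * (C * (3 * (m + 1)) ^ n)"
    by (intro mult_mono power_mono) auto
  also have "\<dots> = K * C\<^sup>2 * (3 * 3) ^ n * ((m + 1) ^ n * (m + 1) ^ n)"
    by (simp only: power_mult_distrib power2_eq_square ac_simps)
  also have "\<dots> = (K * C\<^sup>2 * 9 ^ n) * (m + 1) ^ (2*n)" by (simp add: mult_2 power_add)
  finally have "r * (m + 1) ^ (2*n) \<le> (K * C\<^sup>2 * 9 ^ n) * (m + 1) ^ (2*n)" by simp
  then show ?thesis unfolding K_def by (simp only: mult_le_cancel2) simp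
qed

section \<open>Cyclic modules and the existence of simple submodules\<close>

definition cyc :: "'m \<Rightarrow> 'm set" where
  "cyc u = {op c u | c. inA (2*n) c}"

lemma cycE: "x \<in> cyc u \<Longrightarrow> (\<And>c. inA (2*n) c \<Longrightarrow> x = op c u \<Longrightarrow> thesis) \<Longrightarrow> thesis"
  by (auto simp: cyc_def)

lemma op_in_cyc: "inA (2*n) c \<Longrightarrow> op c u \<in> cyc u"
  by (auto simp: cyc_def)

lemma u_in_cyc: "u \<in> cyc u"
  using op_in_cyc[of 1 u] by simp

lemma Y_stable_cyc: "Y_stable (cyc u)"
  unfolding Y_stable_def subspace_def
proof (intro conjI ballI allI impI)
  show "0 \<in> cyc u" using op_in_cyc[of 0 u] by simp
  fix x y c assume x: "x \<in> cyc u"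
  then obtain a where a: "inA (2*n) a" "x = op a u" by (rule cycE)
  show "sc c x \<in> cyc u" using op_in_cyc[of "cst c * a" u] a by simp
  show "Y j x \<in> cyc u" if "j < 2*n" for j
    using op_in_cyc[OF inA_Ly[OF that a(1)], of u] op_Ly[OF that a(1)] a(2) by simp
  assume "y \<in> cyc u"
  then obtain b where b: "inA (2*n) b" "y = op b u" by (rule cycE)
  show "x + y \<in> cyc u" using op_in_cyc[of "a + b" u] a b by simp
qed

lemma op_cyc: "inA (2*n) c \<Longrightarrow> x \<in> cyc u \<Longrightarrow> op c x \<in> cyc u"
  using op_stable[OF Y_stable_cyc] .

lemma inA_keys_exps:
  assumes "inA (2*n) c"
  obtains m where "keys c \<subseteq> exps (2*n) m"
proof
  show "keys c \<subseteq> exps (2*n) (Max (mdeg (2*n) ` keys c))"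
    using assms by (auto simp: exps_def inA_def)
qed

lemma cyc_eq_UN_Gam: "cyc u = (\<Union>m. Gam u m)"
proof
  show "cyc u \<subseteq> (\<Union>m. Gam u m)"
  proof
    fix x assume "x \<in> cyc u"
    then obtain c where c: "inA (2*n) c" "x = op c u" by (rule cycE)
    obtain m where "keys c \<subseteq> exps (2*n) m" by (rule inA_keys_exps[OF c(1)])
    then have "x \<in> Gam u m" unfolding c(2) by (rule op_in_Gam)
    then show "x \<in> (\<Union>m. Gam u m)" by blast
  qed
  have "mon s u \<in> cyc u" if "s \<in> exps (2*n) m" for s m
    using that op_in_cyc[of "single s 1" u] by (simp add: op_single inA_single exps_def)
  then have "Gam u m \<subseteq> cyc u" for m
    unfolding Gam_def using Y_stable_cyc[of u] by (intro span_minimal) (auto simp: Y_stable_def)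
  then show "(\<Union>m. Gam u m) \<subseteq> cyc u" by blast
qed

text \<open>Without a simple submodule every nonzero submodule of \<open>cyc u\<close> has a smaller
  nonzero one, which gives strict chains of every length and contradicts the bound.\<close>

lemma simple_submodule_exists:
  assumes "slow u" "u \<noteq> 0"
  shows "\<exists>P. Y_stable P \<and> P \<noteq> {0} \<and> P \<subseteq> cyc u \<and> (\<forall>N. Y_stable N \<longrightarrow> N \<subseteq> P \<longrightarrow> N = {0} \<or> N = P)"
proof (rule ccontr)
  assume neg: "\<not> ?thesis"
  have no: "\<exists>N. Y_stable N \<and> N \<noteq> {0} \<and> N \<subset> P" if "Y_stable P" "P \<noteq> {0}" "P \<subseteq> cyc u" for P
  proof (rule ccontr)
    assume "\<nexists>N. Y_stable N \<and> N \<noteq> {0} \<and> N \<subset> P"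
    then have "\<forall>N. Y_stable N \<longrightarrow> N \<subseteq> P \<longrightarrow> N = {0} \<or> N = P" by blast
    then have "\<exists>P. Y_stable P \<and> P \<noteq> {0} \<and> P \<subseteq> cyc u \<and> (\<forall>N. Y_stable N \<longrightarrow> N \<subseteq> P \<longrightarrow> N = {0} \<or> N = P)"
      by (intro exI[of _ P] conjI that)
    then show False using neg by contradiction
  qed
  obtain C where C: "\<And>m. dim (Gam u m) \<le> C * (m + 1) ^ n"
    using slow_imp_dim_Gam_le[OF assms(1)] by blast
  have "\<exists>f. f 0 \<noteq> {0} \<and> (\<forall>i\<le>r. Y_stable (f i) \<and> f i \<subseteq> cyc u) \<and> (\<forall>i<r. f i \<subset> f (Suc i))" for r
  proof (induction r)
    case 0
    then show ?case using assms(2) u_in_cyc Y_stable_cyc by (intro exI[of _ "\<lambda>_. cyc u"]) auto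
  next
    case (Suc r)
    then obtain f where f: "f 0 \<noteq> {0}" "\<forall>i\<le>r. Y_stable (f i) \<and> f i \<subseteq> cyc u" "\<forall>i<r. f i \<subset> f (Suc i)" by blast
    from no[of "f 0"] f obtain N where N: "Y_stable N" "N \<noteq> {0}" "N \<subset> f 0" by auto
    have "N \<subseteq> cyc u" using N(3) f(2) by blast
    \<comment> \<open>Chains are indexed upwards, so the new smaller submodule is put in
      front.\<close>
    then have "(case_nat N f) 0 \<noteq> {0} \<and> (\<forall>i\<le>Suc r. Y_stable (case_nat N f i) \<and> case_nat N f i \<subseteq> cyc u) \<and>
        (\<forall>i<Suc r. case_nat N f i \<subset> case_nat N f (Suc i))"
      using N f(2,3) by (auto split: nat.splits)
    then show ?case by blast
  qed
  from this[of "Suc ((2*n) ^ (2*n) * C\<^sup>2 * 9 ^ n)"] obtain f where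
    f: "\<forall>i\<le>Suc ((2*n) ^ (2*n) * C\<^sup>2 * 9 ^ n). Y_stable (f i) \<and> f i \<subseteq> cyc u"
    "\<forall>i<Suc ((2*n) ^ (2*n) * C\<^sup>2 * 9 ^ n). f i \<subset> f (Suc i)" by blast
  have "Suc ((2*n) ^ (2*n) * C\<^sup>2 * 9 ^ n) \<le> (2*n) ^ (2*n) * C\<^sup>2 * 9 ^ n"
    by (rule chain_length_bounded[of u C _ f]) (use f C in \<open>auto simp: cyc_eq_UN_Gam[symmetric]\<close>)
  then show False by simp
qed

end

section \<open>Endomorphisms and density\<close>

text \<open>Linearity is asked for on P only: the endomorphism in \<open>dixmier\<close> is made by
  a choice that is meaningful on \<open>cyc u\<close> alone.\<close>

locale operator_on = vector_space sc
  for sc :: "'k::field \<Rightarrow> 'm::ab_group_add \<Rightarrow> 'm" +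
  fixes P :: "'m set" and \<phi> :: "'m \<Rightarrow> 'm"
  assumes sub_P: "subspace P"
    and phi_mem: "x \<in> P \<Longrightarrow> \<phi> x \<in> P"
    and phi_add: "x \<in> P \<Longrightarrow> y \<in> P \<Longrightarrow> \<phi> (x + y) = \<phi> x + \<phi> y"
    and phi_scale: "x \<in> P \<Longrightarrow> \<phi> (sc c x) = sc c (\<phi> x)"
begin

text \<open>The value of p(\<phi>) at x, by Horner's scheme.\<close>

definition pact :: "'k poly \<Rightarrow> 'm \<Rightarrow> 'm" where
  "pact p x = fold_coeffs (\<lambda>a y. sc a x + \<phi> y) p 0"

lemmas phi_simps = phi_mem phi_add phi_scale

lemma phi_0: "\<phi> 0 = 0"
  using phi_scale[OF subspace_0[OF sub_P], of 0] by simp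

lemma pact_0 [simp]: "pact 0 x = 0"
  by (simp add: pact_def)

lemma pact_pCons: "pact (pCons a p) x = sc a x + \<phi> (pact p x)"
  using phi_0 by (cases "p = 0 \<and> a = 0") (auto simp: pact_def)

lemma pact_mem: "x \<in> P \<Longrightarrow> pact p x \<in> P"
  by (induction p) (auto simp: pact_pCons sub_P subspace_0 intro!: subspace_add subspace_scale phi_simps)

lemma pact_add: "x \<in> P \<Longrightarrow> pact (p + q) x = pact p x + pact q x"
proof (induction p arbitrary: q)
  case (pCons a p)
  obtain b q' where q: "q = pCons b q'" by (cases q)
  show ?case using pCons(2)[of q'] pCons(3)
    by (simp add: q pact_pCons phi_simps pact_mem scale_left_distrib algebra_simps)
qed simp

lemma pact_smult: "x \<in> P \<Longrightarrow> pact (smult c p) x = sc c (pact p x)"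
  by (induction p) (auto simp: pact_pCons phi_simps pact_mem scale_right_distrib)

lemma pact_add_right: "x \<in> P \<Longrightarrow> y \<in> P \<Longrightarrow> pact p (x + y) = pact p x + pact p y"
  by (induction p) (auto simp: pact_pCons phi_simps pact_mem algebra_simps)

lemma pact_scale_right: "x \<in> P \<Longrightarrow> pact p (sc c x) = sc c (pact p x)"
  by (induction p) (auto simp: pact_pCons phi_simps pact_mem algebra_simps)

lemma pact_mult: "x \<in> P \<Longrightarrow> pact (p * q) x = pact p (pact q x)"
  by (induction p) (auto simp: pact_pCons pact_add pact_smult pact_mem)

lemma pact_sum: "x \<in> P \<Longrightarrow> pact (sum f S) x = (\<Sum>i\<in>S. pact (f i) x)"
  by (induction S rule: infinite_finite_induct) (auto simp: pact_add)

lemma pact_sum_right: "(\<And>i. i \<in> S \<Longrightarrow> f i \<in> P) \<Longrightarrow> pact p (sum f S) = (\<Sum>i\<in>S. pact p (f i))"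
proof (induction S rule: infinite_finite_induct)
  case (insert i S)
  then show ?case using subspace_sum[OF sub_P, of S f] by (simp add: pact_add_right)
next
  case empty
  show ?case using pact_scale_right[OF subspace_0[OF sub_P], of p 0] by simp
next
  case (infinite S)
  show ?case using infinite pact_scale_right[OF subspace_0[OF sub_P], of p 0] by simp
qed

lemma pact_linear_factor: "x \<in> P \<Longrightarrow> pact [:- l , 1:] x = \<phi> x - sc l x"
  using phi_0 by (simp add: pact_pCons)

lemma pact_eigenvector: "x \<in> P \<Longrightarrow> \<phi> x = sc l x \<Longrightarrow> pact p x = sc (poly p l ) x"
  by (induction p) (auto simp: pact_pCons phi_simps pact_mem scale_left_distrib mult.commute)

text \<open>Split a linear factor off p. Either the cofactor q already kills w, and the degree
  drops, or q(\<phi>) w is an eigenvector for the root.\<close>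

lemma eigenvector_exists:
  assumes "alg_closed TYPE('k)"
  shows "w \<in> P \<Longrightarrow> w \<noteq> 0 \<Longrightarrow> p \<noteq> 0 \<Longrightarrow> pact p w = 0 \<Longrightarrow> \<exists>l . \<exists>z\<in>P. z \<noteq> 0 \<and> \<phi> z = sc l z"
proof (induction "degree p" arbitrary: p)
  case 0
  then obtain c where "p = [:c:]" by (metis degree_eq_zeroE)
  then show ?case using 0 phi_0 by (auto simp: pact_pCons)
next
  case (Suc d)
  then obtain l where "poly p l = 0" using assms unfolding alg_closed_def by (metis zero_less_Suc)
  then obtain q where q: "p = [:- l , 1:] * q" using poly_eq_0_iff_dvd by (metis dvdE)
  have q0: "q \<noteq> 0" using q Suc by auto
  then have dq: "degree q = d" using Suc(2) unfolding q by (subst (asm) degree_mult_eq) auto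
  have m: "pact q w \<in> P" using Suc pact_mem by blast
  show ?case
  proof (cases "pact q w = 0")
    case True
    then show ?thesis using Suc(1)[of q] dq Suc q0 by blast
  next
    case False
    have "\<phi> (pact q w) - sc l (pact q w) = 0"
      using Suc(6) Suc(3) m pact_linear_factor[OF m] unfolding q by (simp only: pact_mult)
    then show ?thesis using False m by (intro exI[of _ l] bexI[of _ "pact q w"]) auto
  qed
qed

lemma eigenvalues_card_le:
  assumes "finite \<Lambda>" "\<And>l . l \<in> \<Lambda> \<Longrightarrow> \<exists>z\<in>P. z \<noteq> 0 \<and> \<phi> z = sc l z" "P \<subseteq> span F" "finite F"
  shows "card \<Lambda> \<le> card F"
proof (rule ccontr)
  assume c: "\<not> card \<Lambda> \<le> card F"
  obtain z where z: "\<forall>l \<in>\<Lambda>. z l \<in> P \<and> z l \<noteq> 0 \<and> \<phi> (z l ) = sc l (z l )"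
    using assms(2) bchoice[of \<Lambda> "\<lambda>l z. z \<in> P \<and> z \<noteq> 0 \<and> \<phi> z = sc l z"] by blast
  obtain k where k: "\<exists>s\<in>\<Lambda>. k s \<noteq> 0" "(\<Sum>s\<in>\<Lambda>. sc (k s) (z s)) = 0"
  proof -
    have "z s \<in> span F" if "s \<in> \<Lambda>" for s using z assms(3) that by blast
    then show thesis
      using that common_linear_relation[of \<Lambda> "{()}" F "\<lambda>s w. z s"] assms c by auto
  qed
  obtain \<mu> where \<mu>: "\<mu> \<in> \<Lambda>" "k \<mu> \<noteq> 0" using k by blast
  \<comment> \<open>The product vanishes at every eigenvalue of \<Lambda> except \<mu>, so it
    isolates the \<mu>-term of the relation.\<close>
  define q where "q = (\<Prod>l \<in>\<Lambda> - {\<mu>}. [:- l , 1:])"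
  have pq: "poly q l = (\<Prod>\<nu>\<in>\<Lambda> - {\<mu>}. l - \<nu>)" for l by (simp add: q_def poly_prod)
  have q1: "poly q \<mu> \<noteq> 0" unfolding pq using assms(1) by auto
  have q0: "poly q l = 0" if "l \<in> \<Lambda>" "l \<noteq> \<mu>" for l 
    unfolding pq using assms(1) that by auto
  have "0 = pact q (\<Sum>s\<in>\<Lambda>. sc (k s) (z s))"
    using k(2) pact_scale_right[OF subspace_0[OF sub_P], of q 0] by simp
  also have "\<dots> = (\<Sum>s\<in>\<Lambda>. sc (k s) (sc (poly q s) (z s)))"
    using z sub_P by (subst pact_sum_right) (auto simp: subspace_scale pact_scale_right pact_eigenvector intro!: sum.cong)
  also have "\<dots> = sc (k \<mu>) (sc (poly q \<mu>) (z \<mu>))"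
    using assms(1) \<mu>(1) q0 by (subst sum.remove[of _ \<mu>]) (auto intro!: sum.neutral)
  finally show False using \<mu> z q1 by auto
qed

text \<open>Dixmier's argument: over an uncountable field the resolvents of an operator without
  eigenvalues would be uncountably many independent vectors.\<close>

lemma no_resolvent_family:
  assumes ac: "alg_closed TYPE('k)" and unc: "uncountable (UNIV :: 'k set)"
    and u: "u \<in> P" "u \<noteq> 0"
    and r: "\<And>l . r l \<in> P" "\<And>l . \<phi> (r l ) - sc l (r l ) = u"
    and noeig: "\<And>l z. z \<in> P \<Longrightarrow> z \<noteq> 0 \<Longrightarrow> \<phi> z \<noteq> sc l z"
    and cover: "P \<subseteq> (\<Union>m::nat. span (F m))" "\<And>m. finite (F m)"
  shows False
proof -
  \<comment> \<open>An uncountable set of parameters is covered by countably many finite-dimensional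
    spans, so a single span contains infinitely many of the resolvent vectors.\<close>
  have "UNIV = (\<Union>m. {l. r l \<in> span (F m)})" using r(1) cover(1) by blast
  then have "\<exists>m. uncountable {l. r l \<in> span (F m)}" using unc countable_UN[of UNIV "\<lambda>m. {l. r l \<in> span (F m)}"] by auto
  then obtain m where "uncountable {l. r l \<in> span (F m)}" ..
  then have "infinite {l. r l \<in> span (F m)}" using countable_finite by blast
  then obtain \<Lambda> where \<Lambda>: "\<Lambda> \<subseteq> {l. r l \<in> span (F m)}" "finite \<Lambda>" "card \<Lambda> = Suc (card (F m))"
    using infinite_arbitrarily_large by blast
  obtain k where k: "\<exists>s\<in>\<Lambda>. k s \<noteq> 0" "(\<Sum>s\<in>\<Lambda>. sc (k s) (r s)) = 0"
    using common_linear_relation[of \<Lambda> "{()}" "F m" "\<lambda>s w. r s"] \<Lambda> cover(2) by auto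
  \<comment> \<open>The relation reads as the sum of k_l / (\<phi> - l) applied to u; q is its
    numerator over the common denominator Q. It is nonzero because at \<mu> only the \<mu>-term
    survives, and so it yields an eigenvector.\<close>
  define q where "q = (\<Sum>l\<in>\<Lambda>. smult (k l ) (\<Prod>\<mu>\<in>\<Lambda> - {l}. [:- \<mu>, 1:]))"
  define Q where "Q = (\<Prod>\<mu>\<in>\<Lambda>. [:- \<mu>, 1:])"
  have "pact q u = (\<Sum>l\<in>\<Lambda>. sc (k l ) (pact (\<Prod>\<mu>\<in>\<Lambda> - {l}. [:- \<mu>, 1:]) u))"
    unfolding q_def using u(1) by (simp add: pact_sum pact_smult)
  also have "\<dots> = (\<Sum>l\<in>\<Lambda>. sc (k l ) (pact Q (r l )))"
  proof (rule sum.cong[OF refl])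
    fix l assume "l \<in> \<Lambda>"
    then have "Q = (\<Prod>\<mu>\<in>\<Lambda> - {l}. [:- \<mu>, 1:]) * [:- l , 1:]"
      unfolding Q_def using \<Lambda>(2) by (subst prod.remove[of _ l]) (auto simp: mult.commute)
    then have "pact Q (r l ) = pact (\<Prod>\<mu>\<in>\<Lambda> - {l}. [:- \<mu>, 1:]) (pact [:- l , 1:] (r l ))"
      using pact_mult[OF r(1)] by (simp only:)
    then show "sc (k l ) (pact (\<Prod>\<mu>\<in>\<Lambda> - {l}. [:- \<mu>, 1:]) u) = sc (k l ) (pact Q (r l ))"
      using pact_linear_factor[OF r(1)] r(2) by simp
  qed
  also have "\<dots> = pact Q (\<Sum>l\<in>\<Lambda>. sc (k l ) (r l ))"
    using r(1) sub_P by (subst pact_sum_right) (auto simp: subspace_scale pact_scale_right)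
  also have "\<dots> = 0" using k(2) pact_scale_right[OF subspace_0[OF sub_P], of Q 0] by simp
  finally have qu: "pact q u = 0" .
  obtain \<mu> where \<mu>: "\<mu> \<in> \<Lambda>" "k \<mu> \<noteq> 0" using k by blast
  have "poly q \<mu> = (\<Sum>l\<in>\<Lambda>. k l * (\<Prod>\<nu>\<in>\<Lambda> - {l}. \<mu> - \<nu>))" by (simp add: q_def poly_sum poly_prod)
  also have "\<dots> = k \<mu> * (\<Prod>\<nu>\<in>\<Lambda> - {\<mu>}. \<mu> - \<nu>)"
    using \<Lambda>(2) \<mu>(1) by (subst sum.remove[of _ \<mu>]) (auto intro!: sum.neutral)
  also have "\<dots> \<noteq> 0" using \<mu>(2) \<Lambda>(2) by simp
  finally have "q \<noteq> 0" by auto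
  from eigenvector_exists[OF ac u this qu] show False using noeig by blast
qed

end

context weyl_rep begin

definition simple_gen :: "'m \<Rightarrow> bool" where
  "simple_gen u \<longleftrightarrow> u \<noteq> 0 \<and> (\<forall>x\<in>cyc u. x \<noteq> 0 \<longrightarrow> (\<exists>c. inA (2*n) c \<and> op c x = u))"

lemma simple_gen_exists:
  assumes "slow w" "w \<noteq> 0"
  shows "\<exists>u. simple_gen u \<and> u \<in> cyc w"
proof -
  obtain P where P: "Y_stable P" "P \<noteq> {0}" "P \<subseteq> cyc w" "\<forall>N. Y_stable N \<longrightarrow> N \<subseteq> P \<longrightarrow> N = {0} \<or> N = P"
    using simple_submodule_exists[OF assms] by blast
  have "0 \<in> P" using P(1) by (auto simp: Y_stable_def subspace_0)
  then obtain u where u: "u \<in> P" "u \<noteq> 0" using P(2) by blast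
  have c: "cyc x \<subseteq> P" if "x \<in> P" for x
    using op_stable[OF P(1) that] by (auto simp: cyc_def)
  have "\<exists>c. inA (2*n) c \<and> op c x = u" if x: "x \<in> cyc u" "x \<noteq> 0" for x
  proof -
    have "x \<in> P" using x c u by blast
    then have "cyc x = P" using P(4) Y_stable_cyc[of x] c[of x] u_in_cyc[of x] x(2) by blast
    then have "u \<in> cyc x" using u by blast
    then show ?thesis by (metis cycE)
  qed
  then show ?thesis using u P(3) unfolding simple_gen_def by blast
qed

definition Ann :: "'m \<Rightarrow> 'k mpol set" where
  "Ann u = {c. inA (2*n) c \<and> op c u = 0}"

text \<open>The condition on annihilators makes u \<mapsto> z extend to an endomorphism \<phi> of
  the simple module. If \<phi> were not a scalar, it would have no eigenvalue, and simplicity would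
  provide a resolvent vector for every scalar.\<close>

lemma dixmier:
  assumes ac: "alg_closed TYPE('k)" and unc: "uncountable (UNIV :: 'k set)"
    and u: "simple_gen u" and z: "z \<in> cyc u" "Ann u \<subseteq> Ann z"
  shows "\<exists>l. z = sc l u"
proof (rule ccontr)
  assume no: "\<nexists>l. z = sc l u"
  have u0: "u \<noteq> 0" using u by (simp add: simple_gen_def)
  have sub: "subspace (cyc u)" using Y_stable_cyc by (auto simp: Y_stable_def)
  \<comment> \<open>Any representation of x as \<open>op c u\<close> may be chosen; two of them
    differ by an element of \<open>Ann u\<close>, which also kills z.\<close>
  define \<phi> where "\<phi> x = op (SOME c. inA (2*n) c \<and> op c u = x) z" for x
  have \<phi>: "\<phi> (op c u) = op c z" if "inA (2*n) c" for c
  proof -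
    let ?d = "SOME d. inA (2*n) d \<and> op d u = op c u"
    have "inA (2*n) ?d \<and> op ?d u = op c u" by (rule someI_ex) (use that in blast)
    then have "?d - c \<in> Ann u" using that by (simp add: Ann_def)
    then have "op (?d - c) z = 0" using z(2) by (auto simp: Ann_def)
    then show ?thesis by (simp add: \<phi>_def)
  qed
  have \<phi>op: "\<phi> (op d x) = op d (\<phi> x)" if "inA (2*n) d" "x \<in> cyc u" for d x
  proof -
    from that(2) obtain c where c: "inA (2*n) c" "x = op c u" by (rule cycE)
    then have "op d x = op (star n d c) u" by (simp add: op_star)
    then show ?thesis using \<phi>[OF inA_star[OF c(1), of d]] \<phi>[OF c(1)] c by (simp add: op_star)
  qed
  interpret \<phi>: operator_on sc "cyc u" \<phi>
  proof (unfold_locales, fact sub)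
    fix x assume "x \<in> cyc u"
    then obtain a where a: "inA (2*n) a" "x = op a u" by (rule cycE)
    show "\<phi> x \<in> cyc u" using \<phi>[OF a(1)] a op_cyc[OF a(1) z(1)] by simp
    show "\<phi> (sc c x) = sc c (\<phi> x)" for c
      using \<phi>[of "cst c * a"] \<phi>[OF a(1)] a by simp
    fix y assume "y \<in> cyc u"
    then obtain b where b: "inA (2*n) b" "y = op b u" by (rule cycE)
    show "\<phi> (x + y) = \<phi> x + \<phi> y"
      using \<phi>[of "a + b"] \<phi>[OF a(1)] \<phi>[OF b(1)] a b by simp
  qed
  have \<phi>u: "\<phi> u = z" using \<phi>[of 1] by simp
  \<comment> \<open>Since z - l u is the image of u under \<phi> - l, this c makes
    \<open>op c u\<close> the resolvent of \<phi> at l applied to u.\<close>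
  have "\<exists>c. inA (2*n) c \<and> op c (z - sc l u) = u" for l
  proof -
    have "z - sc l u \<in> cyc u" using z(1) u_in_cyc sub by (simp add: subspace_diff subspace_scale)
    moreover have "z - sc l u \<noteq> 0" using no by auto
    ultimately show ?thesis using u unfolding simple_gen_def by blast
  qed
  then obtain c where c: "\<And>l. inA (2*n) (c l)" "\<And>l. op (c l) (z - sc l u) = u" by metis
  show False
  proof (rule \<phi>.no_resolvent_family[OF ac unc u_in_cyc u0])
    show "op (c l) u \<in> cyc u" for l using c by (intro op_in_cyc)
    show "\<phi> (op (c l) u) - sc l (op (c l) u) = u" for l
      using c(2)[of l] \<phi>[OF c(1)] by simp
    show "\<phi> x \<noteq> sc l x" if x: "x \<in> cyc u" "x \<noteq> 0" for l x
    proof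
      assume e: "\<phi> x = sc l x"
      obtain d where d: "inA (2*n) d" "op d x = u" using u x unfolding simple_gen_def by blast
      then have "\<phi> u = sc l u" using \<phi>op[OF d(1) x(1)] e by simp
      then show False using \<phi>u no by blast
    qed
    show "cyc u \<subseteq> (\<Union>m. span ((\<lambda>s. mon s u) ` exps (2*n) m))"
      unfolding cyc_eq_UN_Gam Gam_def by blast
  qed simp
qed

text \<open>Jacobson's density argument: a shortest relation would yield endomorphisms of the simple module
  generated by u, and these are scalars by Dixmier's lemma.\<close>

lemma density:
  assumes ac: "alg_closed TYPE('k)" and unc: "uncountable (UNIV :: 'k set)"
    and u: "simple_gen u"
  shows "finite S \<Longrightarrow> independent S \<Longrightarrow> (\<And>w. w \<in> S \<Longrightarrow> Ann u \<subseteq> Ann w) \<Longrightarrow>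
    (\<And>w. w \<in> S \<Longrightarrow> inA (2*n) (c w)) \<Longrightarrow> (\<Sum>w\<in>S. op (c w) w) = 0 \<Longrightarrow> \<forall>w\<in>S. op (c w) u = 0"
proof (induction S arbitrary: c rule: finite_induct)
  case (insert r S)
  have indS: "independent S" using insert.prems(1) independent_mono by blast
  have rS: "r \<notin> span S" using insert.prems(1) insert.hyps(2) by (simp add: independent_insert)
  have kill: "op d w = 0" if "w \<in> insert r S" "inA (2*n) d" "op d u = 0" for d w
    using insert.prems(2)[OF that(1)] that by (auto simp: Ann_def)
  have cA: "inA (2*n) (c r)" "w \<in> S \<Longrightarrow> inA (2*n) (c w)" for w using insert.prems(3) by auto
  have sum: "op (c r) r + (\<Sum>w\<in>S. op (c w) w) = 0" using insert.prems(4) insert.hyps by simp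
  have IH: "(\<And>w. w \<in> S \<Longrightarrow> inA (2*n) (d w)) \<Longrightarrow> (\<Sum>w\<in>S. op (d w) w) = 0 \<Longrightarrow> \<forall>w\<in>S. op (d w) u = 0" for d
    using insert.IH[OF indS, of d] insert.prems(2) by blast
  show ?case
  proof (cases "op (c r) u = 0")
    case True
    then have "(\<Sum>w\<in>S. op (c w) w) = 0" using sum kill[of r "c r"] cA by simp
    then show ?thesis using IH[of c] cA True by blast
  next
    case False
    \<comment> \<open>Normalization: composed with c', the coefficient of r fixes u, and therefore
      also r, because \<open>Ann u\<close> is contained in \<open>Ann r\<close>.\<close>
    obtain c' where c': "inA (2*n) c'" "op c' (op (c r) u) = u"
      using u False op_in_cyc[OF cA(1)] unfolding simple_gen_def by blast
    have "op (star n c' (c r) - 1) r = 0"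
      by (rule kill) (use c' cA(1) in \<open>auto simp: inA_star op_star\<close>)
    then have r1: "op c' (op (c r) r) = r" using cA(1) by (simp add: op_star)
    define e where "e w = star n c' (c w)" for w
    have eA: "inA (2*n) (e w)" if "w \<in> S" for w using that cA(2) by (simp add: e_def inA_star)
    have "op c' (op (c r) r + (\<Sum>w\<in>S. op (c w) w)) = r + (\<Sum>w\<in>S. op (e w) w)"
      using cA by (simp add: r1 op_sum_right e_def op_star)
    then have re: "r = - (\<Sum>w\<in>S. op (e w) w)" using sum by (simp add: eq_neg_iff_add_eq_0)
    have "\<exists>l. op (e w) u = sc l u" if w: "w \<in> S" for w
    proof (rule dixmier[OF ac unc u op_in_cyc[OF eA[OF w]]])
      \<comment> \<open>An operator killing u kills r, hence turns the expression of r into a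
        relation on S alone, to which the induction hypothesis applies.\<close>
      show "Ann u \<subseteq> Ann (op (e w) u)"
      proof
        fix b assume "b \<in> Ann u"
        then have b: "inA (2*n) b" "op b u = 0" by (auto simp: Ann_def)
        have "op b r = 0" by (rule kill) (use b in auto)
        then have "op b (\<Sum>w\<in>S. op (e w) w) = 0" by (subst (asm) re) simp
        then have "(\<Sum>w\<in>S. op (star n b (e w)) w) = 0" using eA by (simp add: op_sum_right op_star)
        then have "op (star n b (e w)) u = 0" using IH[of "\<lambda>w. star n b (e w)"] eA w by (simp add: inA_star)
        then show "b \<in> Ann (op (e w) u)" using b eA[OF w] by (simp add: Ann_def op_star)
      qed
    qed
    then have "\<forall>w\<in>S. \<exists>l. op (e w) u = sc l u" by blast
    from bchoice[OF this] obtain l where l: "\<forall>w\<in>S. op (e w) u = sc (l w) u" ..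
    \<comment> \<open>The operator e w - l w kills u, and hence w. So r becomes a scalar combination
      of S, contrary to independence.\<close>
    have "op (e w) w = sc (l w) w" if w: "w \<in> S" for w
    proof -
      have "op (e w - cst (l w)) w = 0" by (rule kill) (use w l eA in auto)
      then show ?thesis by simp
    qed
    then have "r = - (\<Sum>w\<in>S. sc (l w) w)" using re by simp
    moreover have "(\<Sum>w\<in>S. sc (l w) w) \<in> span S" by (intro span_sum span_scale span_base)
    ultimately have "r \<in> span S" using span_neg by metis
    then show ?thesis using rS by contradiction
  qed
qed simp

end

section \<open>Gelfand--Kirillov dimension\<close>

definition logdim :: "(nat \<Rightarrow> nat) \<Rightarrow> nat \<Rightarrow> ereal" where
  "logdim g m = (if g m = 0 then 0 else ereal (log (real m) (real (g m))))"

lemma GKdim_altdef: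
  "GKdim sc Ops X = (SUP FM \<in> {(F, M0). finite F \<and> F \<subseteq> Ops \<and> finite M0 \<and> M0 \<subseteq> X}.
     limsup (logdim (growth sc (fst FM) (snd FM))))"
  unfolding GKdim_def logdim_def Let_def by (rule refl)

lemma polynomial_growth_logdim_le:
  assumes "\<And>m. g m \<le> C * (m + 1) ^ n"
  shows "limsup (logdim g) \<le> ereal (real n)"
proof -
  let ?h = "\<lambda>m::nat. (ln (real (C + 1)) + real n * ln (real m + 1)) / ln (real m)"
  have "?h \<longlonglongrightarrow> real n" by real_asymp
  then have lim: "limsup (\<lambda>m. ereal (?h m)) = ereal (real n)" by (intro lim_imp_Limsup) auto
  have "eventually (\<lambda>m. logdim g m \<le> ereal (?h m)) sequentially"
    using eventually_ge_at_top[of 2]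
  proof eventually_elim
    case (elim m)
    show ?case
    proof (cases "g m = 0")
      case True
      then show ?thesis using elim by (auto simp: logdim_def zero_ereal_def)
    next
      case False
      have "g m \<le> (C + 1) * (m + 1) ^ n" using assms[of m] by (simp add: trans_le_add2 add.commute)
      then have "real (g m) \<le> real ((C + 1) * (m + 1) ^ n)" by (simp only: of_nat_le_iff)
      then have "ln (real (g m)) \<le> ln (real ((C + 1) * (m + 1) ^ n))" using False by simp
      also have "\<dots> = ln (real (C + 1)) + real n * ln (real m + 1)"
      proof -
        have "real ((C + 1) * (m + 1) ^ n) = real (C + 1) * (real m + 1) ^ n"
          by (simp only: of_nat_mult of_nat_power of_nat_add of_nat_1)
        then show ?thesis by (simp only:) (simp add: ln_mult ln_realpow del: of_nat_Suc)
      qed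
      finally show ?thesis using False elim by (simp add: logdim_def log_def divide_right_mono)
    qed
  qed
  then have "limsup (logdim g) \<le> limsup (\<lambda>m. ereal (?h m))" by (rule Limsup_mono)
  then show ?thesis using lim by simp
qed

lemma polynomial_growth_logdim_ge:
  assumes "\<And>m. (m + 1) ^ n \<le> K * g m"
  shows "ereal (real n) \<le> limsup (logdim g)"
proof -
  let ?h = "\<lambda>m::nat. (real n * ln (real m + 1) - ln (real K)) / ln (real m)"
  have K: "K > 0" and g: "g m > 0" for m using assms[of 0] assms[of m] by (auto intro: Nat.gr0I)
  have "?h \<longlonglongrightarrow> real n" by real_asymp
  then have lim: "limsup (\<lambda>m. ereal (?h m)) = ereal (real n)" by (intro lim_imp_Limsup) auto
  have "eventually (\<lambda>m. ereal (?h m) \<le> logdim g m) sequentially"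
    using eventually_ge_at_top[of 2]
  proof eventually_elim
    case (elim m)
    have "real ((m + 1) ^ n) \<le> real (K * g m)" using assms[of m] by (simp only: of_nat_le_iff)
    then have "ln (real ((m + 1) ^ n)) \<le> ln (real (K * g m))" by (intro ln_mono) auto
    then have "real n * ln (real m + 1) - ln (real K) \<le> ln (real (g m))"
      using K g[of m] by (simp add: ln_mult ln_realpow add.commute)
    then show ?case using g[of m] elim by (simp add: logdim_def log_def divide_right_mono)
  qed
  then have "limsup (\<lambda>m. ereal (?h m)) \<le> limsup (logdim g)" by (rule Limsup_mono)
  then show ?thesis using lim by simp
qed

text \<open>A limsup of at most n tolerates, for instance, logarithmic factors, so no bound C m^n
  can be read off. It does stay below n + 1/2, which holds termwise from some index on.\<close>

lemma logdim_bounded_imp_slow: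
  assumes "limsup (logdim g) \<le> ereal (real n)"
  shows "\<exists>C. \<forall>m. (g m)\<^sup>2 \<le> C * (m + 1) ^ (2 * n + 1)"
proof -
  have "limsup (logdim g) < ereal (real n + 1/2)" using assms by (rule le_less_trans) simp
  then have "eventually (\<lambda>m. logdim g m < ereal (real n + 1/2)) sequentially" by (rule Limsup_lessD)
  then obtain M where M: "\<And>m. m \<ge> M \<Longrightarrow> logdim g m < ereal (real n + 1/2)"
    unfolding eventually_sequentially by blast
  have big: "(g m)\<^sup>2 \<le> (m + 1) ^ (2 * n + 1)" if m: "m \<ge> M" "m \<ge> 2" for m
  proof (cases "g m = 0")
    case False
    then have "log (real m) (real (g m)) < real n + 1/2" using M[OF m(1)] by (simp add: logdim_def)
    then have "real (g m) < real m powr (real n + 1/2)"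
      using m(2) False by (subst (asm) log_less_iff) auto
    then have "real (g m) ^ 2 \<le> (real m powr (real n + 1/2)) ^ 2" by (intro power_mono) auto
    also have "\<dots> = real m powr (real (2 * n + 1))"
    proof -
      have "(real n + 1/2) + (real n + 1/2) = real (2 * n + 1)" by simp
      then show ?thesis unfolding power2_eq_square by (simp only: flip: powr_add)
    qed
    also have "\<dots> = real m ^ (2 * n + 1)" using m(2) by (subst powr_realpow) auto
    finally have "real ((g m)\<^sup>2) \<le> real (m ^ (2 * n + 1))" by simp
    then have "(g m)\<^sup>2 \<le> m ^ (2 * n + 1)" by (simp only: of_nat_le_iff)
    also have "\<dots> \<le> (m + 1) ^ (2 * n + 1)" by (intro power_mono) auto
    finally show ?thesis .
  qed simp
  \<comment> \<open>The sum absorbs the finitely many initial values, including m < 2, where the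
    logarithm to base m is of no use.\<close>
  define C where "C = 1 + (\<Sum>m<M + 2. (g m)\<^sup>2)"
  have "(g m)\<^sup>2 \<le> C * (m + 1) ^ (2 * n + 1)" for m
  proof (cases "m < M + 2")
    case True
    then have "(g m)\<^sup>2 \<le> (\<Sum>m<M + 2. (g m)\<^sup>2)" by (intro member_le_sum) auto
    then have "(g m)\<^sup>2 \<le> C * 1" by (simp add: C_def)
    also have "\<dots> \<le> C * (m + 1) ^ (2 * n + 1)" by (intro mult_le_mono2 one_le_power) simp
    finally show ?thesis .
  next
    case False
    then have "(g m)\<^sup>2 \<le> 1 * (m + 1) ^ (2 * n + 1)" using big[of m] by simp
    also have "\<dots> \<le> C * (m + 1) ^ (2 * n + 1)" unfolding C_def by (intro mult_le_mono1) simp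
    finally show ?thesis .
  qed
  then show ?thesis by blast
qed

section \<open>Words in operators and the algebra they generate\<close>

lemma id_in_words: "id \<in> words F m"
  unfolding words_def by (auto intro!: exI[of _ "[]"])

lemma mem_words: "T \<in> F \<Longrightarrow> T \<in> words F 1"
  unfolding words_def by (auto intro!: exI[of _ "[T]"])

lemma words_mono: "F \<subseteq> F' \<Longrightarrow> m \<le> m' \<Longrightarrow> words F m \<subseteq> words F' m'"
  unfolding words_def by force

lemma words_comp: "v \<in> words F a \<Longrightarrow> w \<in> words F b \<Longrightarrow> v \<circ> w \<in> words F (a + b)"
proof -
  have "foldr (\<circ>) (vs @ ws) id = foldr (\<circ>) vs id \<circ> foldr (\<circ>) ws id" for vs ws :: "('m \<Rightarrow> 'm) list"
    by (induction vs) (auto simp: comp_assoc)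
  then show "v \<in> words F a \<Longrightarrow> w \<in> words F b \<Longrightarrow> v \<circ> w \<in> words F (a + b)"
    unfolding words_def mem_Collect_eq
    by (metis (no_types, lifting) add_mono length_append set_append Un_least)
qed

lemma finite_words: "finite F \<Longrightarrow> finite (words F m)"
proof -
  assume "finite F"
  then have "finite ((\<lambda>ws. foldr (\<circ>) ws id) ` {ws. set ws \<subseteq> F \<and> length ws \<le> m})"
    by (intro finite_imageI finite_lists_length_le)
  moreover have "words F m = (\<lambda>ws. foldr (\<circ>) ws id) ` {ws. set ws \<subseteq> F \<and> length ws \<le> m}"
    unfolding words_def by auto
  ultimately show ?thesis by simp
qed

lemma words_induct [consumes 1, case_names id comp]:
  assumes "w \<in> words F m" "P 0 id" "\<And>k T w. T \<in> F \<Longrightarrow> P k w \<Longrightarrow> P (Suc k) (T \<circ> w)"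
  shows "\<exists>k\<le>m. P k w"
proof -
  obtain ws where ws: "w = foldr (\<circ>) ws id" "set ws \<subseteq> F" "length ws \<le> m" using assms(1) by (auto simp: words_def)
  have "P (length ws) (foldr (\<circ>) ws id)" using ws(2) by (induction ws) (auto intro: assms)
  then show ?thesis using ws by blast
qed

text \<open>\<open>GKdim\<close> quantifies over finite subsets of the given operators only, while
  the growth argument uses sums and products of them.\<close>

inductive_set opalg :: "('k \<Rightarrow> 'm::ab_group_add \<Rightarrow> 'm) \<Rightarrow> ('m \<Rightarrow> 'm) set \<Rightarrow> ('m \<Rightarrow> 'm) set" for sc Ops where
  base: "T \<in> Ops \<Longrightarrow> T \<in> opalg sc Ops"
| id: "id \<in> opalg sc Ops"
| add: "S \<in> opalg sc Ops \<Longrightarrow> T \<in> opalg sc Ops \<Longrightarrow> (\<lambda>x. S x + T x) \<in> opalg sc Ops"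
| scale: "S \<in> opalg sc Ops \<Longrightarrow> (\<lambda>x. sc c (S x)) \<in> opalg sc Ops"
| comp: "S \<in> opalg sc Ops \<Longrightarrow> T \<in> opalg sc Ops \<Longrightarrow> S \<circ> T \<in> opalg sc Ops"

locale operator_set = vector_space sc
  for sc :: "'k::field \<Rightarrow> 'm::ab_group_add \<Rightarrow> 'm" +
  fixes Ops :: "('m \<Rightarrow> 'm) set"
  assumes Ops_linear: "T \<in> Ops \<Longrightarrow> Vector_Spaces.linear sc sc T"
begin

text \<open>The coefficients of the linear combination may depend on x. This pointwise form is
  closed under composition with linear words and suffices for counting dimensions.\<close>

definition gen :: "('m \<Rightarrow> 'm) set \<Rightarrow> nat \<Rightarrow> ('m \<Rightarrow> 'm) set" where
  "gen F k = {T. \<forall>x. T x \<in> span ((\<lambda>w. w x) ` words F k)}"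

lemma gen_mono: "F \<subseteq> F' \<Longrightarrow> k \<le> k' \<Longrightarrow> gen F k \<subseteq> gen F' k'"
  unfolding gen_def using span_mono[OF image_mono[OF words_mono]] by blast

lemma words_gen: "w \<in> words F k \<Longrightarrow> w \<in> gen F k"
  unfolding gen_def by (auto intro: span_base)

lemma words_linear:
  assumes "w \<in> words F m" "F \<subseteq> Ops"
  shows "Vector_Spaces.linear sc sc w"
proof -
  have "\<exists>k\<le>m. Vector_Spaces.linear sc sc w" using assms(1)
  proof (induction rule: words_induct)
    case id
    then show ?case by (simp add: Vector_Spaces.linear_iff vector_space_axioms)
  next
    case (comp k T w)
    then show ?case using Ops_linear[of T] assms(2) by (auto simp: Vector_Spaces.linear_iff)
  qed
  then show ?thesis by blast
qed

lemma linear_maps_span: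
  assumes "Vector_Spaces.linear sc sc w" "x \<in> span S" "w ` S \<subseteq> N" "subspace N"
  shows "w x \<in> N"
proof -
  have "subspace {x. w x \<in> N}"
    using assms(1,4) module_hom.zero[OF assms(1)[folded module_hom_iff_linear]]
    unfolding subspace_def Vector_Spaces.linear_iff by auto
  then have "span S \<subseteq> {x. w x \<in> N}" using assms(3) by (intro span_minimal) auto
  then show ?thesis using assms(2) by blast
qed

lemma gen_comp:
  assumes "S \<in> gen F a" "T \<in> gen F b" "F \<subseteq> Ops"
  shows "S \<circ> T \<in> gen F (a + b)"
  unfolding gen_def
proof (intro CollectI allI)
  fix x
  let ?N = "span ((\<lambda>w. w x) ` words F (a + b))"
  have "w (T x) \<in> ?N" if w: "w \<in> words F a" for w
  proof (rule linear_maps_span[OF words_linear[OF w assms(3)]])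
    show "T x \<in> span ((\<lambda>w. w x) ` words F b)" using assms(2) by (simp add: gen_def)
    show "w ` (\<lambda>w. w x) ` words F b \<subseteq> ?N"
    proof clarify
      fix v assume "v \<in> words F b"
      then have "(w \<circ> v) x \<in> (\<lambda>w. w x) ` words F (a + b)" using words_comp[OF w] by blast
      then show "w (v x) \<in> ?N" by (simp add: span_base)
    qed
  qed simp
  then have "span ((\<lambda>w. w (T x)) ` words F a) \<subseteq> ?N" by (intro span_minimal) auto
  then show "(S \<circ> T) x \<in> ?N" using assms(1) by (auto simp: gen_def)
qed

lemma words_of_gen:
  assumes "F' \<subseteq> gen F K" "F \<subseteq> Ops" "w \<in> words F' m"
  shows "w \<in> gen F (K * m)"
proof -
  have "\<exists>k\<le>m. w \<in> gen F (K * k)" using assms(3)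
  proof (induction rule: words_induct)
    case id
    show ?case by (rule words_gen[OF id_in_words])
  next
    case (comp k T w)
    then show ?case using gen_comp[of T F K w "K * k"] assms by (auto simp del: o_apply)
  qed
  then show ?thesis using gen_mono[of F F "K * _" "K * m"] by auto
qed

lemma opalg_gen: "T \<in> opalg sc Ops \<Longrightarrow> \<exists>F k. finite F \<and> F \<subseteq> Ops \<and> T \<in> gen F k"
proof (induction rule: opalg.induct)
  case (base T)
  then show ?case using words_gen[OF mem_words, of T "{T}"] by blast
next
  case id
  show ?case using words_gen[OF id_in_words, of "{}" 0] by blast
next
  case (add S T)
  then obtain F k F' k' where F: "finite F" "F \<subseteq> Ops" "S \<in> gen F k" "finite F'" "F' \<subseteq> Ops" "T \<in> gen F' k'" by blast
  then have "S \<in> gen (F \<union> F') (max k k')" "T \<in> gen (F \<union> F') (max k k')"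
    using gen_mono[of F "F \<union> F'" k "max k k'"] gen_mono[of F' "F \<union> F'" k' "max k k'"] by auto
  then have "(\<lambda>x. S x + T x) \<in> gen (F \<union> F') (max k k')" by (simp add: gen_def span_add)
  then show ?case using F by (meson finite_UnI le_sup_iff)
next
  case (scale S c)
  then obtain F k where "finite F" "F \<subseteq> Ops" "S \<in> gen F k" by blast
  moreover from this have "(\<lambda>x. sc c (S x)) \<in> gen F k" by (simp add: gen_def span_scale)
  ultimately show ?case by blast
next
  case (comp S T)
  then obtain F k F' k' where F: "finite F" "F \<subseteq> Ops" "S \<in> gen F k" "finite F'" "F' \<subseteq> Ops" "T \<in> gen F' k'" by blast
  then have "S \<in> gen (F \<union> F') k" "T \<in> gen (F \<union> F') k'"
    using gen_mono[of F "F \<union> F'" k k] gen_mono[of F' "F \<union> F'" k' k'] by auto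
  then have "S \<circ> T \<in> gen (F \<union> F') (k + k')" using F by (intro gen_comp) auto
  then show ?case using F by (meson finite_UnI le_sup_iff)
qed

lemma opalg_gen_finite:
  assumes "finite F'" "F' \<subseteq> opalg sc Ops"
  shows "\<exists>F k. finite F \<and> F \<subseteq> Ops \<and> F' \<subseteq> gen F k"
  using assms
proof (induction F' rule: finite_induct)
  case (insert T F')
  then obtain F k where F: "finite F" "F \<subseteq> Ops" "F' \<subseteq> gen F k" by auto
  obtain G l where G: "finite G" "G \<subseteq> Ops" "T \<in> gen G l" using opalg_gen[of T] insert by auto
  have "insert T F' \<subseteq> gen (F \<union> G) (max k l)"
    using F G gen_mono[of F "F \<union> G" k "max k l"] gen_mono[of G "F \<union> G" l "max k l"] by auto
  then show ?case using F G by (meson finite_UnI le_sup_iff)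
qed auto

text \<open>Each of the new operators is a combination of words of length at most k, so m of them
  reach no further than k m of the original ones. The order of growth is unchanged and only the
  constant acquires a power of k + 1.\<close>

lemma growth_slow:
  assumes GK: "GKdim sc Ops X \<le> ereal (real n)"
    and F': "finite F'" "F' \<subseteq> opalg sc Ops" and M0: "finite M0" "M0 \<subseteq> X"
  shows "\<exists>C. \<forall>m. (growth sc F' M0 m)\<^sup>2 \<le> C * (m + 1) ^ (2 * n + 1)"
proof -
  obtain F k where F: "finite F" "F \<subseteq> Ops" "F' \<subseteq> gen F k" using opalg_gen_finite[OF F'] by blast
  have "limsup (logdim (growth sc F M0)) \<le> GKdim sc Ops X"
    unfolding GKdim_altdef by (rule SUP_upper2[of "(F, M0)"]) (use F M0 in auto)
  then have "limsup (logdim (growth sc F M0)) \<le> ereal (real n)" using GK by simp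
  from logdim_bounded_imp_slow[OF this] obtain C where C: "\<And>m. (growth sc F M0 m)\<^sup>2 \<le> C * (m + 1) ^ (2 * n + 1)" by blast
  have "(growth sc F' M0 m)\<^sup>2 \<le> (C * (k + 1) ^ (2 * n + 1)) * (m + 1) ^ (2 * n + 1)" for m
  proof -
    let ?S = "{w x | w x. w \<in> words F (k * m) \<and> x \<in> M0}"
    have "{w x | w x. w \<in> words F' m \<and> x \<in> M0} \<subseteq> span ?S"
    proof clarify
      fix w x assume wx: "w \<in> words F' m" "x \<in> M0"
      have "w x \<in> span ((\<lambda>w. w x) ` words F (k * m))"
        using words_of_gen[OF F(3,2) wx(1)] by (simp add: gen_def)
      also have "\<dots> \<subseteq> span ?S" using wx(2) by (intro span_mono) auto
      finally show "w x \<in> span ?S" .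
    qed
    moreover have "?S = (\<lambda>(w, x). w x) ` (words F (k * m) \<times> M0)" by auto
    then have "finite ?S" using finite_words[OF F(1)] M0(1) by simp
    ultimately have "growth sc F' M0 m \<le> growth sc F M0 (k * m)"
      unfolding growth_def using dim_mono_finite[of _ ?S ?S] span_superset[of ?S] by blast
    then have "(growth sc F' M0 m)\<^sup>2 \<le> (growth sc F M0 (k * m))\<^sup>2" by (rule power_mono) simp
    also have "\<dots> \<le> C * (k * m + 1) ^ (2 * n + 1)" by (rule C)
    also have "\<dots> \<le> C * ((k + 1) * (m + 1)) ^ (2 * n + 1)" by (intro mult_le_mono2 power_mono) auto
    finally show ?thesis by (simp only: power_mult_distrib ac_simps)
  qed
  then show ?thesis by blast
qed

end

context weyl_rep begin

lemma funpow_in_words: "T \<in> F \<Longrightarrow> T ^^ k \<in> words F k"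
proof (induction k)
  case (Suc k)
  then show ?case using words_comp[OF mem_words[of T F] Suc(1)] by (simp del: o_apply)
qed (simp add: id_in_words)

lemma mon_in_words:
  assumes F: "\<And>j. j < 2*n \<Longrightarrow> Y j \<in> F" and s: "s \<in> exps (2*n) m"
  shows "mon s \<in> words F m"
proof -
  have *: "set l \<subseteq> {..<2*n} \<Longrightarrow> prodY Y l s \<in> words F (\<Sum>j\<leftarrow>l. lookup s j)" for l
  proof (induction l)
    case (Cons j l)
    then show ?case using words_comp[OF funpow_in_words[OF F, of j "lookup s j"]] by (auto simp del: o_apply)
  qed (simp add: id_in_words)
  have "mon s \<in> words F ((\<Sum>j\<leftarrow>[0..<n]. lookup s j) + (\<Sum>j\<leftarrow>[n..<2*n]. lookup s j))"
    unfolding wmon_def by (intro words_comp *) auto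
  moreover have "(\<Sum>j\<leftarrow>[0..<n]. lookup s j) + (\<Sum>j\<leftarrow>[n..<2*n]. lookup s j) = mdeg (2*n) s"
    unfolding mdeg_def interv_sum_list_conv_sum_set_nat lessThan_atLeast0
    using sum.atLeastLessThan_concat[of 0 n "2*n" "lookup s"] by simp
  ultimately show ?thesis using words_mono[of F F "mdeg (2*n) s" m] s by (auto simp: exps_def)
qed

lemma dim_Gam_le_growth:
  assumes F: "finite F" "\<And>j. j < 2*n \<Longrightarrow> Y j \<in> F" and M0: "u \<in> M0" "finite M0"
  shows "dim (Gam u m) \<le> growth sc F M0 m"
proof -
  let ?S = "{w x | w x. w \<in> words F m \<and> x \<in> M0}"
  have "?S = (\<lambda>(w, x). w x) ` (words F m \<times> M0)" by auto
  then have "finite ?S" using finite_words[OF F(1)] M0 by simp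
  moreover have "(\<lambda>s. mon s u) ` exps (2*n) m \<subseteq> ?S" using mon_in_words[OF F(2)] M0 by blast
  then have "Gam u m \<subseteq> span ?S" unfolding Gam_def by (rule span_mono)
  ultimately show ?thesis unfolding growth_def using dim_mono_finite[of "Gam u m" ?S ?S] span_superset[of ?S] by blast
qed

text \<open>The generators themselves attain the lower bound coming from Bernstein's inequality. Any
  other finite set of operators moves the filtration \<open>Gam u\<close> by a bounded number of
  levels and so cannot grow faster.\<close>

lemma GKdim_cyc:
  assumes u: "u \<noteq> 0" "slow u"
    and Ops: "Ops \<subseteq> {op c | c. inA (2*n) c}" and YO: "\<And>j. j < 2*n \<Longrightarrow> Y j \<in> Ops"
  shows "GKdim sc Ops (cyc u) = ereal (real n)"
proof (rule antisym)
  obtain C where C: "\<And>m. dim (Gam u m) \<le> C * (m + 1) ^ n" using slow_imp_dim_Gam_le[OF u(2)] by blast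
  show "ereal (real n) \<le> GKdim sc Ops (cyc u)"
    unfolding GKdim_altdef
  proof (rule SUP_upper2[of "(Y ` {..<2*n}, {u})"])
    have "(m + 1) ^ n \<le> ((2*n) ^ (2*n) * C * 2 ^ n) * growth sc (Y ` {..<2*n}) {u} m" for m
    proof -
      have "(m + 1) ^ n \<le> (2*n) ^ (2*n) * C * 2 ^ n * dim (Gam u m)" by (rule dim_Gam_ge[OF u(1) C])
      also have "\<dots> \<le> (2*n) ^ (2*n) * C * 2 ^ n * growth sc (Y ` {..<2*n}) {u} m"
        by (intro mult_le_mono2 dim_Gam_le_growth) auto
      finally show ?thesis .
    qed
    then show "ereal (real n) \<le> limsup (logdim (growth sc (fst (Y ` {..<2*n}, {u})) (snd (Y ` {..<2*n}, {u}))))"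
      unfolding fst_conv snd_conv by (rule polynomial_growth_logdim_ge)
  qed (use YO u_in_cyc in auto)
  show "GKdim sc Ops (cyc u) \<le> ereal (real n)"
    unfolding GKdim_altdef
  proof (rule SUP_least, clarsimp)
    fix F M0 assume F: "finite F" "F \<subseteq> Ops" and M0: "finite M0" "M0 \<subseteq> cyc u"
    have "\<forall>T\<in>F. \<exists>k. \<forall>a. \<forall>x\<in>Gam u a. T x \<in> Gam u (a + k)"
    proof
      fix T assume "T \<in> F"
      then obtain c where c: "T = op c" "inA (2*n) c" using F Ops by blast
      obtain k where "keys c \<subseteq> exps (2*n) k" by (rule inA_keys_exps[OF c(2)])
      then show "\<exists>k. \<forall>a. \<forall>x\<in>Gam u a. T x \<in> Gam u (a + k)"
        using op_filtration[OF Gam_filtration] c(1) by blast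
    qed
    from bchoice[OF this] obtain k where k: "\<And>T a x. T \<in> F \<Longrightarrow> x \<in> Gam u a \<Longrightarrow> T x \<in> Gam u (a + k T)" by blast
    have "\<forall>x\<in>M0. \<exists>a. x \<in> Gam u a" using M0(2) cyc_eq_UN_Gam by blast
    from bchoice[OF this] obtain b where b: "\<And>x. x \<in> M0 \<Longrightarrow> x \<in> Gam u (b x)" by blast
    \<comment> \<open>One number bounding both the degrees of the operators in F and the levels of
      the vectors in M0.\<close>
    define K where "K = (\<Sum>T\<in>F. k T) + (\<Sum>x\<in>M0. b x)"
    have kK: "k T \<le> K" if "T \<in> F" for T
      using member_le_sum[OF that, of k] F(1) by (auto simp: K_def)
    have bK: "b x \<le> K" if "x \<in> M0" for x
      using member_le_sum[OF that, of b] M0(1) by (auto simp: K_def)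
    note mono = Y_filtration_mono[OF Gam_filtration]
    have "growth sc F M0 m \<le> (C * (K + 1) ^ n) * (m + 1) ^ n" for m
    proof -
      have "w x \<in> Gam u (K + K * m)" if w: "w \<in> words F m" and x: "x \<in> M0" for w x
      proof -
        have "\<exists>j\<le>m. w x \<in> Gam u (K + K * j)" using w
        proof (induction rule: words_induct)
          case id
          then show ?case using mono[OF bK[OF x]] b[OF x] by auto
        next
          case (comp j T w)
          have "T (w x) \<in> Gam u (K + K * j + k T)" by (rule k) (use comp in auto)
          then show ?case using mono[of "K + K * j + k T" "K + K * Suc j"] kK[OF comp(1)] by auto
        qed
        then show ?thesis using mono[of "K + K * _" "K + K * m"] by (meson add_left_mono mult_le_mono2 subsetD)
      qed
      then have "{w x | w x. w \<in> words F m \<and> x \<in> M0} \<subseteq> span (Gam u (K + K * m))"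
        by (auto intro: span_base)
      then have "growth sc F M0 m \<le> dim (Gam u (K + K * m))"
        unfolding growth_def by (rule dim_mono_finite[OF _ Gam_finite_dim]) simp
      also have "\<dots> \<le> C * (K + K * m + 1) ^ n" by (rule C)
      also have "\<dots> \<le> C * ((K + 1) * (m + 1)) ^ n" by (intro mult_le_mono2 power_mono) auto
      finally show ?thesis by (simp only: power_mult_distrib ac_simps)
    qed
    then show "limsup (logdim (growth sc F M0)) \<le> ereal (real n)" by (rule polynomial_growth_logdim_le)
  qed
qed

end

section \<open>Modules over the smash product\<close>

lemmas grp_simps = add.assoc add.commute add.left_commute diff_diff_eq add_diff_eq diff_diff_eq2
  diff_add_eq diff_eq_eq eq_diff_eq

text \<open>The derivation f d/dx_p, set to 0 outside A because elements of \<open>Der n\<close> are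
  normalized in this way.\<close>

definition fd :: "nat \<Rightarrow> 'k::comm_ring_1 mpol \<Rightarrow> nat \<Rightarrow> 'k mpol \<Rightarrow> 'k mpol" where
  "fd n f p = (\<lambda>g. if inA n g then f * pd p g else 0)"

lemma inA_cst_mult [simp]: "inA n f \<Longrightarrow> inA n (cst c * f)"
  by simp

lemma fd_Der: "inA n f \<Longrightarrow> fd n f p \<in> Der n"
  by (auto simp: Der_def fd_def pd_mult algebra_simps)

lemma fd_add: "inA n f \<Longrightarrow> inA n g \<Longrightarrow> der_add (fd n f p) (fd n g p) = fd n (f + g) p"
  by (auto simp: der_add_def fd_def fun_eq_iff algebra_simps)

lemma fd_smult: "der_smult c (fd n f p) = fd n (cst c * f) p"
  by (auto simp: der_smult_def fd_def fun_eq_iff algebra_simps)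

lemma fd_br:
  assumes "inA n f" "inA n g"
  shows "der_br (fd n f p) (fd n g q) = der_add (fd n (f * pd p g) q) (der_smult (-1) (fd n (g * pd q f) p))"
  using assms by (auto simp: der_br_def der_add_def der_smult_def fd_def fun_eq_iff pd_mult cst_uminus
      algebra_simps pd_commute[of q p])

locale av =
  fixes n :: nat and sc :: "'k::field_char_0 \<Rightarrow> 'm::ab_group_add \<Rightarrow> 'm"
    and a :: "'k mpol \<Rightarrow> 'm \<Rightarrow> 'm" and v :: "('k mpol \<Rightarrow> 'k mpol) \<Rightarrow> 'm \<Rightarrow> 'm"
  assumes AV: "AV_module n sc a v"
begin

definition V :: "'k mpol \<Rightarrow> nat \<Rightarrow> 'm \<Rightarrow> 'm" where
  "V f p = v (fd n f p)"

text \<open>Indices from 2 n on get the zero map, since \<open>weyl_rep\<close> asks for linearity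
  at every index.\<close>

definition YY :: "nat \<Rightarrow> 'm \<Rightarrow> 'm" where
  "YY j = (if j < n then a (Xv j) else if j < 2 * n then V 1 (j - n) else (\<lambda>_. 0))"

lemma vs: "vector_space sc"
  using AV by (simp add: AV_module_def)

lemma linear_a: "inA n f \<Longrightarrow> Vector_Spaces.linear sc sc (a f)"
  using AV by (simp add: AV_module_def)

lemma a_add: "inA n f \<Longrightarrow> inA n g \<Longrightarrow> a (f + g) x = a f x + a g x"
  using AV by (simp add: AV_module_def)

lemma a_cst_mult: "inA n f \<Longrightarrow> a (cst c * f) x = sc c (a f x)"
  using AV unfolding AV_module_def by blast

lemma a_mult: "inA n f \<Longrightarrow> inA n g \<Longrightarrow> a (f * g) x = a f (a g x)"
  using AV unfolding AV_module_def by blast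

lemma a_1: "a 1 x = x"
  using AV unfolding AV_module_def by blast

lemma linear_v: "\<delta> \<in> Der n \<Longrightarrow> Vector_Spaces.linear sc sc (v \<delta>)"
  using AV by (simp add: AV_module_def)

lemma v_add: "\<delta> \<in> Der n \<Longrightarrow> \<epsilon> \<in> Der n \<Longrightarrow> v (der_add \<delta> \<epsilon>) x = v \<delta> x + v \<epsilon> x"
  using AV unfolding AV_module_def by blast

lemma v_smult: "\<delta> \<in> Der n \<Longrightarrow> v (der_smult c \<delta>) x = sc c (v \<delta> x)"
  using AV unfolding AV_module_def by blast

lemma v_br: "\<delta> \<in> Der n \<Longrightarrow> \<epsilon> \<in> Der n \<Longrightarrow> v (der_br \<delta> \<epsilon>) x = v \<delta> (v \<epsilon> x) - v \<epsilon> (v \<delta> x)"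
  using AV unfolding AV_module_def by blast

lemma v_a: "\<delta> \<in> Der n \<Longrightarrow> inA n f \<Longrightarrow> v \<delta> (a f x) = a (\<delta> f) x + a f (v \<delta> x)"
  using AV unfolding AV_module_def by blast

lemma linear_V: "inA n f \<Longrightarrow> Vector_Spaces.linear sc sc (V f p)"
  unfolding V_def by (intro linear_v fd_Der)

lemma V_add: "inA n f \<Longrightarrow> inA n g \<Longrightarrow> V (f + g) p x = V f p x + V g p x"
  by (simp add: V_def fd_add[symmetric] v_add fd_Der)

lemma V_cst_mult: "inA n f \<Longrightarrow> V (cst c * f) p x = sc c (V f p x)"
  by (simp add: V_def fd_smult[symmetric] v_smult fd_Der)

lemma V_br: "inA n f \<Longrightarrow> inA n g \<Longrightarrow> V f p (V g q x) = V g q (V f p x) + V (f * pd p g) q x - V (g * pd q f) p x"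
proof -
  interpret vector_space sc by (rule vs)
  assume fg: "inA n f" "inA n g"
  have d: "der_smult (- 1) (fd n (g * pd q f) p) \<in> Der n"
    unfolding fd_smult by (rule fd_Der) (use fg in simp)
  have "V f p (V g q x) - V g q (V f p x) = v (der_br (fd n f p) (fd n g q)) x"
    unfolding V_def using fg by (simp add: v_br fd_Der)
  also have "\<dots> = V (f * pd p g) q x - V (g * pd q f) p x"
    using fg d by (simp add: fd_br v_add fd_Der v_smult V_def)
  finally show ?thesis by (simp add: grp_simps)
qed

lemma V_a: "inA n f \<Longrightarrow> inA n g \<Longrightarrow> V f p (a g x) = a (f * pd p g) x + a g (V f p x)"
  using v_a[OF fd_Der, of f g p x] by (simp add: V_def fd_def)

sublocale weyl_rep sc n YY
proof -
  interpret vector_space sc by (rule vs)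
  show "weyl_rep sc n YY"
  proof (intro weyl_rep.intro weyl_rep_axioms.intro vs)
    show "Vector_Spaces.linear sc sc (YY j)" for j
      by (auto simp: YY_def linear_a linear_V Vector_Spaces.linear_iff[of _ _ "\<lambda>_. 0"] vs)
    show "YY i (YY j x) = YY j (YY i x)" if "i < n" "j < n" for i j x
      using that a_mult[of "Xv i" "Xv j" x] a_mult[of "Xv j" "Xv i" x] by (simp add: YY_def mult.commute)
    have V0: "V 0 p x = 0" for p x using V_cst_mult[of 1 0 p x] by simp
    show "YY (n + i) (YY (n + j) x) = YY (n + j) (YY (n + i) x)" if "i < n" "j < n" for i j x
      using that by (simp add: YY_def V_br[of 1 1 i j] V0)
    have a0: "a 0 x = 0" for x using a_cst_mult[of 1 0 x] by simp
    show "YY (n + i) (YY j x) = YY j (YY (n + i) x) + (if i = j then x else 0)" if "i < n" "j < n" for i j x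
      using that by (simp add: YY_def V_a pd_Xv a_1 a0)
  qed
qed

lemma a_right: "inA n f \<Longrightarrow> a f (x + y) = a f x + a f y" "inA n f \<Longrightarrow> a f (sc c x) = sc c (a f x)"
  using linear_a[of f] by (auto simp: Vector_Spaces.linear_iff)

lemma V_right: "inA n f \<Longrightarrow> V f p (x + y) = V f p x + V f p y" "inA n f \<Longrightarrow> V f p (sc c x) = sc c (V f p x)"
  using linear_V[of f p] by (auto simp: Vector_Spaces.linear_iff)

lemma a_diff_right: "inA n f \<Longrightarrow> a f (x - y) = a f x - a f y"
  using a_right(1)[of f "x - y" y] by simp

lemma V_diff_right: "inA n f \<Longrightarrow> V f p (x - y) = V f p x - V f p y"
  using V_right(1)[of f p "x - y" y] by simp

lemma a_0_right: "inA n f \<Longrightarrow> a f 0 = 0" and V_0_right: "inA n f \<Longrightarrow> V f p 0 = 0"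
  using a_right(2)[of f 0 0] V_right(2)[of f p 0 0] by simp_all

lemma a_eq_op: "inA n f \<Longrightarrow> a f x = op f x"
proof (induction arbitrary: x rule: inA_induct)
  case (cst c)
  then show ?case using a_cst_mult[of 1 c x] by (simp add: a_1)
next
  case (add f g)
  then show ?case by (simp add: a_add)
next
  case (Xv i f)
  have "YY i = a (Xv i)" using Xv(1) by (simp add: YY_def)
  then show ?case using Xv by (simp add: op_X a_mult)
qed

lemma V_1_eq_Y: "p < n \<Longrightarrow> V 1 p = YY (n + p)"
  by (simp add: YY_def)

lemma a_commute: "inA n f \<Longrightarrow> inA n g \<Longrightarrow> a f (a g x) = a g (a f x)"
  using a_mult[of f g x] a_mult[of g f x] by (simp add: mult.commute)

lemma V_1_commute: "V 1 p (V 1 q x) = V 1 q (V 1 p x)"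
  using V_br[of 1 1 p q x] V_cst_mult[of 1 0 p x] V_cst_mult[of 1 0 q x] by simp

text \<open>In the tensor product with the enveloping algebra, with coordinates X centred at 0, this
  is the element (f(x + X) - f(x)) d/dX_p; below, X is shifted so that f(X) - f(x) appears
  instead.\<close>

definition tau :: "nat \<Rightarrow> 'k mpol \<Rightarrow> 'm \<Rightarrow> 'm" where
  "tau p f x = V f p x - a f (V 1 p x)"

text \<open>The right-hand side is (f(X) - f(x)) (d_p g)(X) d_q - (g(X) - g(x)) (d_q f)(X) d_p, the
  bracket of (f(X) - f(x)) d_p and (g(X) - g(x)) d_q in which derivatives act on X only.\<close>

lemma tau_bracket:
  assumes f: "inA n f" and g: "inA n g"
  shows "tau p f (tau q g x) - tau q g (tau p f x) = tau q (f * pd p g) x - tau p (g * pd q f) x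
    + a g (tau p (pd q f) x) - a f (tau q (pd p g) x)"
proof -
  have 1: "V h i (V k j y) = V k j (V h i y) + V (h * pd i k) j y - V (k * pd j h) i y"
    if "inA n h" "inA n k" for h k i j y using V_br[OF that] .
  have V0: "V 0 i y = 0" for i y using V_cst_mult[of 1 0 i y] by simp
  have dV: "V 1 i (V k j y) = V k j (V 1 i y) + V (pd i k) j y" if "inA n k" for k i j y
    using V_br[of 1 k i j y] that V0 by simp
  show ?thesis
    unfolding tau_def using f g
    by (simp add: V_diff_right a_diff_right a_right(1) V_a a_mult dV[of g p q] dV[of f q p] V_br[OF f g, of p q]
        a_commute[OF f g] V_1_commute[of p q] grp_simps)
qed

text \<open>An operator-valued function of a polynomial is viewed as a function of polynomials f(X);
  SS is multiplies the argument by the product of the factors X_i - x_i over the list is.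
  In these terms T is p is the operator that the isomorphism onto the tensor product of the Weyl
  algebra and the enveloping algebra assigns to the derivation of L_+ with coefficient the product
  of the X_i.\<close>

primrec SS :: "nat list \<Rightarrow> ('k mpol \<Rightarrow> 'm \<Rightarrow> 'm) \<Rightarrow> 'k mpol \<Rightarrow> 'm \<Rightarrow> 'm" where
  "SS [] \<theta> f x = \<theta> f x"
| "SS (i # is) \<theta> f x = SS is \<theta> (Xv i * f) x - a (Xv i) (SS is \<theta> f x)"

definition T :: "nat list \<Rightarrow> nat \<Rightarrow> 'm \<Rightarrow> 'm" where
  "T is p = SS is (tau p) 1"

definition A_linear :: "('k mpol \<Rightarrow> 'm \<Rightarrow> 'm) \<Rightarrow> bool" where
  "A_linear \<theta> \<longleftrightarrow> (\<forall>f x y. inA n f \<longrightarrow> \<theta> f (x + y) = \<theta> f x + \<theta> f y)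
    \<and> (\<forall>f c x. inA n f \<longrightarrow> \<theta> f (sc c x) = sc c (\<theta> f x))
    \<and> (\<forall>f g x. inA n f \<longrightarrow> inA n g \<longrightarrow> \<theta> (f + g) x = \<theta> f x + \<theta> g x)
    \<and> (\<forall>f c x. inA n f \<longrightarrow> \<theta> (cst c * f) x = sc c (\<theta> f x))
    \<and> (\<forall>f g x. inA n f \<longrightarrow> inA n g \<longrightarrow> \<theta> f (a g x) = a g (\<theta> f x))"

lemma A_linearD:
  assumes "A_linear \<theta>" "inA n f"
  shows "\<theta> f (x + y) = \<theta> f x + \<theta> f y" "\<theta> f (sc c x) = sc c (\<theta> f x)" "\<theta> 0 x = 0"
    "inA n g \<Longrightarrow> \<theta> (f + g) x = \<theta> f x + \<theta> g x" "\<theta> (cst c * f) x = sc c (\<theta> f x)"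
    "inA n g \<Longrightarrow> \<theta> f (a g x) = a g (\<theta> f x)"
proof -
  have "\<theta> (cst 0 * f) x = sc 0 (\<theta> f x)" using assms unfolding A_linear_def by blast
  then show "\<theta> 0 x = 0" by simp
qed (use assms in \<open>auto simp: A_linear_def\<close>)

lemma A_linear_diff: "A_linear \<theta> \<Longrightarrow> inA n f \<Longrightarrow> \<theta> f (x - y) = \<theta> f x - \<theta> f y"
  using A_linearD(1)[of \<theta> f "x - y" y] by simp

lemma A_linear_tau: "A_linear (tau p)"
proof -
  have "tau p f (a g x) = a g (tau p f x)" if "inA n f" "inA n g" for f g x
    unfolding tau_def using that by (simp add: V_a a_right a_mult a_diff_right a_commute grp_simps)
  moreover have "tau p f (x + y) = tau p f x + tau p f y" "tau p f (sc c x) = sc c (tau p f x)"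
    "tau p (cst c * f) x = sc c (tau p f x)" if "inA n f" for f x y c
    using that
    by (simp_all add: tau_def V_right a_right V_cst_mult a_cst_mult scale_right_diff_distrib grp_simps)
  moreover have "tau p (f + g) x = tau p f x + tau p g x" if "inA n f" "inA n g" for f g x
    using that by (simp add: tau_def V_add a_add grp_simps)
  ultimately show ?thesis unfolding A_linear_def by blast
qed

lemma A_linear_step:
  assumes "A_linear \<theta>" "i < n"
  shows "A_linear (\<lambda>f x. \<theta> (Xv i * f) x - a (Xv i) (\<theta> f x))"
proof -
  have "\<theta> (Xv i * (cst c * f)) x = sc c (\<theta> (Xv i * f) x)" if "inA n f" for c f x
    using A_linearD(5)[OF assms(1), of "Xv i * f" c x] that assms(2) by (simp add: mult.left_commute)
  moreover have "\<theta> (Xv i * (f + g)) x = \<theta> (Xv i * f) x + \<theta> (Xv i * g) x" if "inA n f" "inA n g" for f g x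
    using A_linearD(4)[OF assms(1), of "Xv i * f" "Xv i * g" x] that assms(2) by (simp add: distrib_left)
  ultimately show ?thesis using assms(2) A_linearD(1,2,4,5,6)[OF assms(1)]
    unfolding A_linear_def by (auto simp: a_right a_diff_right a_commute grp_simps scale_right_diff_distrib)
qed

lemma A_linear_SS: "A_linear \<theta> \<Longrightarrow> set is \<subseteq> {..<n} \<Longrightarrow> A_linear (SS is \<theta>)"
proof (induction "is")
  case Nil
  then show ?case by (simp add: A_linear_def)
next
  case (Cons i "is")
  then show ?case using A_linear_step[of "SS is \<theta>" i] by (simp add: A_linear_def)
qed

text \<open>The factors X_i - x_i commute, so a list of indices counts only as a multiset, that is,
  as a multi-index.\<close>

lemma SS_swap:
  "i < n \<Longrightarrow> j < n \<Longrightarrow> SS (i # j # is) \<theta> f x = SS (j # i # is) \<theta> f x"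
  using a_commute[of "Xv i" "Xv j"] by (simp add: a_diff_right mult.left_commute grp_simps)

lemma SS_append: "SS (is @ js) \<theta> f x = SS is (SS js \<theta>) f x"
  by (induction "is" arbitrary: f x) auto

lemma SS_Cons_cong: "(\<And>f x. SS is \<theta> f x = SS js \<theta>' f x) \<Longrightarrow> SS (i # is) \<theta> f x = SS (i # js) \<theta>' f x"
  by simp

lemma SS_snoc: "i < n \<Longrightarrow> set is \<subseteq> {..<n} \<Longrightarrow> SS (is @ [i]) \<theta> f x = SS (i # is) \<theta> f x"
proof (induction "is" arbitrary: f x)
  case (Cons j "is")
  have "SS (j # (is @ [i])) \<theta> f x = SS (j # (i # is)) \<theta> f x"
    by (rule SS_Cons_cong) (use Cons in simp)
  then show ?case using SS_swap[of i j "is" \<theta> f x] Cons by simp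
qed simp

lemma SS_remove1: "q \<in> set is \<Longrightarrow> set is \<subseteq> {..<n} \<Longrightarrow> SS (q # remove1 q is) \<theta> f x = SS is \<theta> f x"
proof (induction "is" arbitrary: f x)
  case (Cons j "is")
  show ?case
  proof (cases "q = j")
    case False
    then have "SS (j # is) \<theta> f x = SS (j # q # remove1 q is) \<theta> f x"
      using Cons by (intro SS_Cons_cong) auto
    also have "\<dots> = SS (q # j # remove1 q is) \<theta> f x" using Cons by (intro SS_swap) auto
    finally show ?thesis using False by simp
  qed simp
qed simp

lemma SS_cong: "(\<And>f x. inA n f \<Longrightarrow> \<theta> f x = \<theta>' f x) \<Longrightarrow> set is \<subseteq> {..<n} \<Longrightarrow> inA n f \<Longrightarrow> SS is \<theta> f x = SS is \<theta>' f x"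
  by (induction "is" arbitrary: f x) auto

lemma SS_diff: "set is \<subseteq> {..<n} \<Longrightarrow> SS is (\<lambda>f x. \<theta> f x - \<theta>' f x) f x = SS is \<theta> f x - SS is \<theta>' f x"
proof (induction "is" arbitrary: f x)
  case (Cons i "is")
  then show ?case by (simp add: a_diff_right)
qed simp

lemma SS_scale: "set is \<subseteq> {..<n} \<Longrightarrow> SS is (\<lambda>f x. sc c (\<theta> f x)) f x = sc c (SS is \<theta> f x)"
  by (induction "is" arbitrary: f x) (auto simp: a_right scale_right_diff_distrib)

text \<open>Taking the commutator with an A-linear Z is compatible with multiplying by X_i - x_i;
  brackets with \<open>T js p\<close> thereby reduce to brackets with \<open>tau p\<close>.\<close>

lemma SS_ad:
  assumes "\<And>x y. Z (x + y) = Z x + Z y" "\<And>i x. i < n \<Longrightarrow> Z (a (Xv i) x) = a (Xv i) (Z x)"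
  shows "set is \<subseteq> {..<n} \<Longrightarrow> SS is (\<lambda>f x. Z (\<theta> f x) - \<theta> f (Z x)) f x = Z (SS is \<theta> f x) - SS is \<theta> f (Z x)"
proof (induction "is" arbitrary: f x)
  case (Cons i "is")
  have "Z (x - y) = Z x - Z y" for x y using assms(1)[of "x - y" y] by simp
  then show ?case using Cons assms(2) by (simp add: a_diff_right)
qed simp

text \<open>Leibniz rule: differentiating the product of the X_i - x_i by X_q removes one factor
  with index q, in as many ways as q occurs.\<close>

lemma SS_pd:
  assumes "A_linear \<theta>" "q < n"
  shows "set js \<subseteq> {..<n} \<Longrightarrow> inA n f \<Longrightarrow> SS js (\<lambda>f. \<theta> (pd q f)) f x
    = SS js \<theta> (pd q f) x + sc (of_nat (count_list js q)) (SS (remove1 q js) \<theta> f x)"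
proof (induction js arbitrary: f x)
  case (Cons i js)
  have g: "A_linear (SS js \<theta>)" by (rule A_linear_SS) (use Cons assms in auto)
  note gD = A_linearD[OF g]
  have i: "i < n" using Cons by simp
  have "SS (i # js) (\<lambda>f. \<theta> (pd q f)) f x = SS js \<theta> (pd q (Xv i * f)) x
      + sc (of_nat (count_list js q)) (SS (remove1 q js) \<theta> (Xv i * f) x)
      - (a (Xv i) (SS js \<theta> (pd q f) x) + sc (of_nat (count_list js q)) (a (Xv i) (SS (remove1 q js) \<theta> f x)))"
    using Cons i by (simp add: a_right)
  also have "SS js \<theta> (pd q (Xv i * f)) x = (if i = q then SS js \<theta> f x else 0) + SS js \<theta> (Xv i * pd q f) x"
    using i Cons gD(4)[of f "Xv q * pd q f" x] by (simp add: pd_mult pd_Xv)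
  finally have e: "SS (i # js) (\<lambda>f. \<theta> (pd q f)) f x = (if i = q then SS js \<theta> f x else 0) + SS (i # js) \<theta> (pd q f) x
      + sc (of_nat (count_list js q)) (SS (i # remove1 q js) \<theta> f x)"
    by (simp add: scale_right_diff_distrib grp_simps)
  show ?case
  proof (cases "i = q")
    case True
    have "sc (of_nat (count_list js q)) (SS (q # remove1 q js) \<theta> f x) = sc (of_nat (count_list js q)) (SS js \<theta> f x)"
      using SS_remove1[of q js \<theta> f x] Cons by (cases "q \<in> set js") (auto simp: count_list_0_iff)
    then show ?thesis unfolding e using True by (simp add: scale_left_distrib grp_simps)
  next
    case False
    then show ?thesis unfolding e by simp
  qed
qed simp

text \<open>The derivative in direction i acts on x and on X at once and therefore annihilates X_j -
  x_j. Taken at f = 1, this makes the operators \<open>T js p\<close> commute with the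
  derivatives.\<close>

lemma SS_D:
  assumes g: "A_linear \<theta>" and p: "\<And>f x. inA n f \<Longrightarrow> V 1 i (\<theta> f x) = \<theta> f (V 1 i x) + \<theta> (pd i f) x"
  shows "set js \<subseteq> {..<n} \<Longrightarrow> inA n f \<Longrightarrow> V 1 i (SS js \<theta> f x) = SS js \<theta> f (V 1 i x) + SS js \<theta> (pd i f) x"
proof (induction js arbitrary: f x)
  case (Cons j js)
  have g: "A_linear (SS js \<theta>)" by (rule A_linear_SS) (use Cons g in auto)
  have j: "j < n" using Cons by simp
  have IH: "V 1 i (SS js \<theta> f x) = SS js \<theta> f (V 1 i x) + SS js \<theta> (pd i f) x" if "inA n f" for f x
    using Cons that by simp
  have "SS js \<theta> (pd i (Xv j) * f + Xv j * pd i f) x = SS js \<theta> (pd i (Xv j) * f) x + SS js \<theta> (Xv j * pd i f) x"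
    using A_linearD(4)[OF g, of "pd i (Xv j) * f" "Xv j * pd i f" x] j Cons by simp
  moreover have "SS js \<theta> (pd i (Xv j) * f) x = a (pd i (Xv j)) (SS js \<theta> f x)"
    using A_linearD(3)[OF g Cons(3)] a_cst_mult[of 1 0] by (simp add: pd_Xv a_1)
  ultimately show ?case using j Cons
    by (simp add: V_diff_right IH V_a a_right pd_mult grp_simps)
qed (use p in simp)

lemma tau_D: "inA n f \<Longrightarrow> V 1 i (tau p f x) = tau p f (V 1 i x) + tau p (pd i f) x"
proof -
  assume f: "inA n f"
  have "V 1 i (V f p x) = V f p (V 1 i x) + V (pd i f) p x"
    using V_br[of 1 f i p x] f V_cst_mult[of 1 0 i x] by simp
  then show ?thesis using f
    by (simp add: tau_def V_diff_right V_a V_1_commute[of i p] grp_simps)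
qed

lemma A_linear_SS_tau: "set is \<subseteq> {..<n} \<Longrightarrow> A_linear (SS is (tau p))"
  by (rule A_linear_SS[OF A_linear_tau])

lemma A_linear_T:
  assumes "set is \<subseteq> {..<n}"
  shows "T is p (x + y) = T is p x + T is p y" "T is p (sc c x) = sc c (T is p x)"
    "inA n g \<Longrightarrow> T is p (a g x) = a g (T is p x)"
proof -
  note g = A_linear_SS_tau[OF assms, of p]
  show "T is p (x + y) = T is p x + T is p y" unfolding T_def by (rule A_linearD(1)[OF g inA_1])
  show "T is p (sc c x) = sc c (T is p x)" unfolding T_def by (rule A_linearD(2)[OF g inA_1])
  show "inA n g \<Longrightarrow> T is p (a g x) = a g (T is p x)" unfolding T_def by (rule A_linearD(6)[OF g inA_1])
qed

lemma SS_tau_0: "set is \<subseteq> {..<n} \<Longrightarrow> SS is (tau p) 0 x = 0"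
  by (rule A_linearD(3)[OF A_linear_SS_tau inA_1])

lemma T_V1: "set is \<subseteq> {..<n} \<Longrightarrow> T is p (V 1 i x) = V 1 i (T is p x)"
  using SS_D[OF A_linear_tau tau_D, of "is" 1 i p x] SS_tau_0[of "is" p x]
  by (simp add: T_def)

lemma T_YY: "set is \<subseteq> {..<n} \<Longrightarrow> T is p (YY j x) = YY j (T is p x)"
  using A_linear_T(2)[of "is" p 0 0] by (auto simp: YY_def A_linear_T T_V1)

lemma T_op:
  assumes "set is \<subseteq> {..<n}"
  shows "T is p (op c x) = op c (T is p x)"
proof -
  have pw: "T is p ((YY j ^^ k) y) = (YY j ^^ k) (T is p y)" for j k y
    by (rule funpow_commute) (rule T_YY[OF assms])
  have pr: "T is p (prodY YY l s y) = prodY YY l s (T is p y)" for l s y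
    by (rule prodY_commute) (rule T_YY[OF assms])
  have mo: "T is p (mon s y) = mon s (T is p y)" for s y
    by (simp add: wmon_def pr)
  have "T is p (sum f S) = (\<Sum>i\<in>S. T is p (f i))" for f and S :: "(nat \<Rightarrow>\<^sub>0 nat) set"
    using A_linear_T(2)[OF assms, of p 0 0]
    by (induction S rule: infinite_finite_induct) (auto simp: A_linear_T[OF assms])
  then show ?thesis by (simp add: wop_def A_linear_T[OF assms] mo)
qed

section \<open>Lie brackets of the operators \<open>T js p\<close>\<close>

lemma tau_1 [simp]: "tau p 1 x = 0"
  by (simp add: tau_def a_1)

lemma T_single: "i < n \<Longrightarrow> T [i] q x = tau q (Xv i) x"
  by (simp add: T_def a_0_right)

text \<open>The square of X_i - x_i is expanded; its term x_i^2 meets \<open>tau q 1\<close> =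
  0.\<close>

lemma T_double: "i < n \<Longrightarrow> T [i, i] q x = tau q (Xv i * Xv i) x - sc 2 (a (Xv i) (tau q (Xv i) x))"
  using scale_left_distrib[of 1 1 "a (Xv i) (tau q (Xv i) x)"] by (simp add: T_def a_0_right)

lemma bracket_single_tau:
  assumes "i < n" "inA n g"
  shows "T [i] q (tau p g x) - tau p g (T [i] q x) = SS [i] (tau p) (pd q g) x - (if p = i then tau q g x else 0)"
  using tau_bracket[of "Xv i" g q p x] assms SS_tau_0[of "[]" q x] a_0_right[of "Xv i"]
  by (auto simp: T_single pd_Xv a_0_right)

text \<open>The bracket of X_i d_q with X^js d_p in L_+. If q does not occur in js, the count is 0
  and the value of \<open>remove1\<close> is irrelevant.\<close>

lemma bracket_single:
  assumes "i < n" "q < n" "set js \<subseteq> {..<n}"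
  shows "T [i] q (T js p x) - T js p (T [i] q x) =
    sc (of_nat (count_list js q)) (T (remove1 q js @ [i]) p x) - (if p = i then T js q x else 0)"
proof -
  let ?b = "if p = i then 1 else 0"
  have l: "set [i] \<subseteq> {..<n}" using assms by simp
  have "T [i] q (T js p x) - T js p (T [i] q x) = SS js (\<lambda>g x. T [i] q (tau p g x) - tau p g (T [i] q x)) 1 x"
    unfolding T_def[of js] by (rule SS_ad[symmetric]) (use A_linear_T[OF l] assms in auto)
  also have "\<dots> = SS js (\<lambda>g x. SS [i] (tau p) (pd q g) x - sc ?b (tau q g x)) 1 x"
    by (rule SS_cong) (use assms bracket_single_tau in auto)
  also have "\<dots> = SS js (\<lambda>g. SS [i] (tau p) (pd q g)) 1 x - sc ?b (T js q x)"
    using assms by (simp add: SS_diff SS_scale T_def del: SS.simps)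
  also have "SS js (\<lambda>g. SS [i] (tau p) (pd q g)) 1 x = sc (of_nat (count_list js q)) (T (remove1 q js @ [i]) p x)"
    using SS_pd[OF A_linear_SS[OF A_linear_tau l] assms(2,3), of 1 p x]
      SS_tau_0[of "js @ [i]" p x] assms
    by (simp add: SS_append T_def del: SS.simps)
  finally show ?thesis by simp
qed

lemma bracket_double_tau:
  assumes "q < n" "inA n g"
  shows "T [q, q] q (tau p g x) - tau p g (T [q, q] q x) = SS [q, q] (tau p) (pd q g) x
    - sc (if p = q then 2 else 0) (SS [q] (tau q) g x - a g (T [q] q x))"
proof -
  let ?X = "Xv q :: 'k mpol" and ?h = "pd q g"
  let ?e = "if p = q then 2 else 0"
  have X: "inA n ?X" "inA n (?X * ?X)" using assms by auto
  have d2: "sc 2 y = y + y" for y using scale_left_distrib[of 1 1 y] by simp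
  have t2: "tau q (?X + ?X) x = sc 2 (tau q ?X x)"
    unfolding d2 by (rule A_linearD(4)[OF A_linear_tau]) (use assms in auto)
  have g2: "tau q (g * (?X + ?X)) x = sc 2 (tau q (?X * g) x)"
  proof -
    have e: "g * (?X + ?X) = ?X * g + ?X * g" by (simp only: distrib_left mult.commute)
    show ?thesis unfolding e d2 by (rule A_linearD(4)[OF A_linear_tau]) (use assms in auto)
  qed
  have t0: "tau r 0 y = 0" for r y using SS_tau_0[of "[]" r y] by simp
  have pp: "pd p (?X * ?X) = (if p = q then ?X + ?X else 0)" by (auto simp: pd_mult pd_Xv)
  have B1: "tau q (?X * ?X) (tau p g x) - tau p g (tau q (?X * ?X) x) = tau p (?X * ?X * ?h) x
      - a ?X (a ?X (tau p ?h x)) - sc ?e (tau q (?X * g) x - a g (tau q ?X x))"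
  proof (cases "p = q")
    case True
    then have "pd p (?X * ?X) = ?X + ?X" using pp by simp
    then have "tau q (?X * ?X) (tau p g x) - tau p g (tau q (?X * ?X) x) = tau p (?X * ?X * ?h) x
        - sc 2 (tau q (?X * g) x) + a g (sc 2 (tau q ?X x)) - a ?X (a ?X (tau p ?h x))"
      using tau_bracket[OF X(2) assms(2), of q p x] X by (simp only: t2 g2 a_mult)
    then show ?thesis using True assms by (simp add: a_right scale_right_diff_distrib grp_simps)
  next
    case False
    then have "pd p (?X * ?X) = 0" using pp by simp
    then have "tau q (?X * ?X) (tau p g x) - tau p g (tau q (?X * ?X) x) = tau p (?X * ?X * ?h) x
        - a ?X (a ?X (tau p ?h x))"
      using tau_bracket[OF X(2) assms(2), of q p x] X assms by (simp add: t0 a_mult a_0_right)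
    then show ?thesis using False by simp
  qed
  have B2: "tau q ?X (tau p g x) - tau p g (tau q ?X x) = tau p (?X * ?h) x - a ?X (tau p ?h x)
      - (if p = q then tau q g x else 0)"
    using bracket_single_tau[OF assms, of q p x] assms by (simp add: T_single)
  have L: "T [q, q] q (tau p g x) - tau p g (T [q, q] q x)
      = (tau q (?X * ?X) (tau p g x) - tau p g (tau q (?X * ?X) x))
        - sc 2 (a ?X (tau q ?X (tau p g x) - tau p g (tau q ?X x)))"
    unfolding T_double[OF assms(1)] using assms
    by (simp add: A_linear_diff[OF A_linear_tau] A_linearD(2,6)[OF A_linear_tau] a_diff_right scale_right_diff_distrib)
  show ?thesis
    unfolding L B1 B2 T_single[OF assms(1)] using assms
    by (simp add: d2 a_diff_right a_right a_0_right scale_right_diff_distrib mult.assoc)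
qed

text \<open>The function g \<mapsto> g(x) Z is evaluation at X = x, where every factor X_i - x_i
  vanishes.\<close>

lemma SS_a_const:
  "set is \<subseteq> {..<n} \<Longrightarrow> is \<noteq> [] \<Longrightarrow> inA n f \<Longrightarrow> SS is (\<lambda>g x. a g (Z x)) f x = 0"
proof (induction "is" arbitrary: f x)
  case (Cons i "is")
  then show ?case by (cases "is = []") (auto simp: a_mult a_0_right)
qed simp

text \<open>The bracket of X_q^2 d_q with X^js d_p, the relation that raises degrees in
  \<open>killed_generation\<close>. A nonempty js is required to remove the evaluation term left
  over in \<open>bracket_double_tau\<close>.\<close>

lemma bracket_double:
  assumes "q < n" "set js \<subseteq> {..<n}" "js \<noteq> []"
  shows "T [q, q] q (T js p x) - T js p (T [q, q] q x) =
    sc (of_nat (count_list js q)) (T (remove1 q js @ [q, q]) p x) - sc (if p = q then 2 else 0) (T (js @ [q]) q x)"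
proof -
  let ?b = "if p = q then 2 else 0"
  have l: "set [q, q] \<subseteq> {..<n}" "set [q] \<subseteq> {..<n}" using assms by simp_all
  have "T [q, q] q (T js p x) - T js p (T [q, q] q x) = SS js (\<lambda>g x. T [q, q] q (tau p g x) - tau p g (T [q, q] q x)) 1 x"
    unfolding T_def[of js] by (rule SS_ad[symmetric]) (use A_linear_T[OF l(1)] assms in auto)
  also have "\<dots> = SS js (\<lambda>g x. SS [q, q] (tau p) (pd q g) x - sc ?b (SS [q] (tau q) g x - a g (T [q] q x))) 1 x"
    by (rule SS_cong) (use assms bracket_double_tau in auto)
  also have "\<dots> = SS js (\<lambda>g. SS [q, q] (tau p) (pd q g)) 1 x - sc ?b (T (js @ [q]) q x)"
    using assms by (simp add: SS_diff SS_scale T_def[of "js @ [q]"] SS_append SS_a_const del: SS.simps)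
  also have "SS js (\<lambda>g. SS [q, q] (tau p) (pd q g)) 1 x = sc (of_nat (count_list js q)) (T (remove1 q js @ [q, q]) p x)"
    using SS_pd[OF A_linear_SS[OF A_linear_tau l(1)] assms(1,2), of 1 p x]
      SS_tau_0[of "js @ [q, q]" p x] assms
    by (simp add: SS_append T_def del: SS.simps)
  finally show ?thesis .
qed

end

section \<open>The degree-zero part acts on killed vectors\<close>

context operator_set begin

text \<open>As long as one more letter leads out of the current span, the dimension rises by at
  least 1. Once it does not, the span is invariant.\<close>

lemma orbit_stabilizes_or_grows:
  assumes F: "finite Ops" and q: "q \<noteq> 0"
  shows "(\<exists>m. \<forall>T\<in>Ops. \<forall>x\<in>span ((\<lambda>w. w q) ` words Ops m). T x \<in> span ((\<lambda>w. w q) ` words Ops m))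
    \<or> (\<forall>m. m + 1 \<le> dim ((\<lambda>w. w q) ` words Ops m))"
proof (rule disjCI)
  let ?S = "\<lambda>m. (\<lambda>w. w q) ` words Ops m"
  have fin: "finite (?S m)" for m using finite_words[OF F] by simp
  assume "\<not> (\<forall>m. m + 1 \<le> dim (?S m))"
  then obtain m where m: "dim (?S m) < m + 1" by (meson not_le)
  have "\<exists>m. ?S (Suc m) \<subseteq> span (?S m)"
  proof (rule ccontr)
    assume no: "\<nexists>m. ?S (Suc m) \<subseteq> span (?S m)"
    have "m + 1 \<le> dim (?S m)" for m
    proof (induction m)
      case 0
      have "q \<in> ?S 0" using imageI[OF id_in_words[of Ops 0], of "\<lambda>w. w q"] by simp
      moreover have "independent {q}" using q by simp
      ultimately have "card {q} \<le> dim (?S 0)"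
        using independent_card_le_dim_span[of "{q}" "?S 0"] fin by (auto intro: span_base)
      then show ?case by simp
    next
      case (Suc m)
      obtain x where x: "x \<in> ?S (Suc m)" "x \<notin> span (?S m)" using no by blast
      obtain B where B: "B \<subseteq> ?S m" "independent B" "?S m \<subseteq> span B" "card B = dim (?S m)"
        using basis_exists by blast
      have fB: "finite B" using B(1) fin finite_subset by blast
      have "span B \<subseteq> span (?S m)" using B(1) by (rule span_mono)
      then have xB: "x \<notin> span B" using x(2) by blast
      then have "independent (insert x B)" using B(2) by (intro independent_insertI)
      moreover have "?S m \<subseteq> ?S (Suc m)" using words_mono[of Ops Ops m "Suc m"] by auto
      then have "insert x B \<subseteq> ?S (Suc m)" by (intro insert_subsetI x(1) order_trans[OF B(1)])
      then have "insert x B \<subseteq> span (?S (Suc m))" using span_superset by (rule order_trans)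
      ultimately have "card (insert x B) \<le> dim (?S (Suc m))"
        using independent_card_le_dim_span fin by blast
      moreover have "x \<notin> B" using xB span_base by blast
      ultimately show ?case using Suc B(4) fB by simp
    qed
    then show False using m by (metis not_le)
  qed
  then obtain m where m: "?S (Suc m) \<subseteq> span (?S m)" ..
  have "T x \<in> span (?S m)" if T: "T \<in> Ops" and x: "x \<in> span (?S m)" for T x
  proof (rule linear_maps_span[OF Ops_linear[OF T] x])
    show "T ` ?S m \<subseteq> span (?S m)"
    proof clarify
      fix w assume "w \<in> words Ops m"
      then have "T \<circ> w \<in> words Ops (Suc m)" using words_comp[OF mem_words[OF T]] by (simp del: o_apply)
      then have "(T \<circ> w) q \<in> span (?S m)" using m by blast
      then show "T (w q) \<in> span (?S m)" by simp
    qed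
  qed simp
  then show "\<exists>m. \<forall>T\<in>Ops. \<forall>x\<in>span (?S m). T x \<in> span (?S m)" by blast
qed

end

context operator_on begin

lemma pact_monom: "x \<in> P \<Longrightarrow> pact (monom c k) x = sc c ((\<phi> ^^ k) x)"
proof (induction k)
  case (Suc k)
  have "(\<phi> ^^ k) x \<in> P" using Suc(2) by (induction k) (auto simp: phi_mem)
  then show ?case using Suc by (simp add: monom_Suc pact_pCons phi_scale)
qed (simp add: monom_0 pact_pCons phi_0)

lemma annihilating_polynomial_exists:
  assumes "P \<subseteq> span F" "finite F" "x \<in> P"
  shows "\<exists>p. p \<noteq> 0 \<and> pact p x = 0"
proof -
  have "(\<phi> ^^ k) x \<in> P" for k
    using assms(3) phi_mem by (induction k) auto
  then have "(\<phi> ^^ k) x \<in> span F" for k using assms(1) by blast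
  then obtain c where c: "\<exists>k\<in>{..card F}. c k \<noteq> 0" "(\<Sum>k\<le>card F. sc (c k) ((\<phi> ^^ k) x)) = 0"
    using common_linear_relation[of "{..card F}" "{()}" F "\<lambda>k w. (\<phi> ^^ k) x"] assms by auto
  let ?p = "\<Sum>k\<le>card F. monom (c k) k"
  have "pact ?p x = 0" using c(2) assms(3) by (simp add: pact_sum pact_monom)
  moreover obtain k where k: "k \<le> card F" "c k \<noteq> 0" using c(1) by auto
  then have "coeff ?p k = c k" by (simp add: coeff_sum)
  then have "?p \<noteq> 0" using k(2) by (metis coeff_0)
  ultimately show ?thesis by blast
qed

end

lemma count_list_pigeonhole:
  assumes "set js \<subseteq> {..<n}" "3 * n < length js"
  shows "\<exists>q<n. 4 \<le> count_list js q"
proof (rule ccontr)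
  assume "\<not> ?thesis"
  then have "count_list js q \<le> 3" if "q < n" for q using that by force
  then have "(\<Sum>q<n. count_list js q) \<le> (\<Sum>q<n. 3)" by (intro sum_mono) auto
  moreover have "(\<Sum>q<n. count_list js q) = length js" using assms(1) by (intro sum_count_set) auto
  ultimately show False using assms(2) by simp
qed

lemma Der_0: "\<delta> \<in> Der n \<Longrightarrow> \<delta> (cst c) = 0" for \<delta> :: "'k::field_char_0 mpol \<Rightarrow> 'k mpol"
proof -
  assume d: "\<delta> \<in> Der n"
  have m: "\<delta> (f * g) = \<delta> f * g + f * \<delta> g" if "inA n f" "inA n g" for f g
    using d that unfolding Der_def by blast
  have "\<delta> (1 * 1) = \<delta> 1 * 1 + 1 * \<delta> 1" by (rule m) auto
  then have "\<delta> 1 = 0" by simp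
  moreover have "\<delta> (cst c * f) = cst c * \<delta> f" if "inA n f" for f
    using d that unfolding Der_def by blast
  from this[OF inA_1] have "\<delta> (cst c * 1) = cst c * \<delta> 1" .
  ultimately show "\<delta> (cst c) = 0" by simp
qed

lemma Der_inA: "\<delta> \<in> Der n \<Longrightarrow> inA n f \<Longrightarrow> inA n (\<delta> f)"
  unfolding Der_def by blast

lemma Der_expansion:
  fixes \<delta> :: "'k::field_char_0 mpol \<Rightarrow> 'k mpol"
  assumes d: "\<delta> \<in> Der n"
  shows "inA n g \<Longrightarrow> \<delta> g = (\<Sum>p<n. \<delta> (Xv p) * pd p g)"
proof (induction rule: inA_induct)
  case (cst c)
  then show ?case using Der_0[OF d] by simp
next
  case (add f g)
  moreover have "\<delta> (f + g) = \<delta> f + \<delta> g" using d add(1,2) unfolding Der_def by blast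
  ultimately show ?case by (simp add: algebra_simps sum.distrib)
next
  case (Xv i f)
  have "\<delta> (Xv i * f) = \<delta> (Xv i) * f + Xv i * \<delta> f" using d Xv inA_Xv[OF Xv(1)] unfolding Der_def by blast
  also have "\<dots> = (\<Sum>p<n. (if p = i then \<delta> (Xv i) * f else 0) + Xv i * (\<delta> (Xv p) * pd p f))"
    using Xv by (simp add: sum.distrib sum_distrib_left)
  also have "\<dots> = (\<Sum>p<n. \<delta> (Xv p) * pd p (Xv i * f))"
    by (intro sum.cong) (auto simp: pd_mult pd_Xv algebra_simps)
  finally show ?case .
qed

context av begin

lemma v_sum_fd:
  assumes "finite S" "\<And>p. p \<in> S \<Longrightarrow> inA n (f p)"
  shows "(\<lambda>g. \<Sum>p\<in>S. fd n (f p) p g) \<in> Der n \<and> v (\<lambda>g. \<Sum>p\<in>S. fd n (f p) p g) x = (\<Sum>p\<in>S. V (f p) p x)"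
  using assms
proof (induction S rule: finite_induct)
  case empty
  have z: "(\<lambda>g. 0) = fd n 0 0" by (auto simp: fd_def)
  have "v (\<lambda>g. 0) x = V (cst 0 * 1) 0 x" by (simp only: V_def z cst_0 mult_zero_left)
  moreover have "(\<lambda>g. 0) \<in> Der n" by (subst z) (simp add: fd_Der)
  ultimately show ?case using V_cst_mult[of 1 0 0 x] by simp
next
  case (insert p S)
  let ?d = "\<lambda>g. \<Sum>p\<in>S. fd n (f p) p g"
  have d: "?d \<in> Der n" "fd n (f p) p \<in> Der n" using insert fd_Der by auto
  have e: "(\<lambda>g. \<Sum>p\<in>insert p S. fd n (f p) p g) = der_add (fd n (f p) p) ?d"
    using insert by (simp add: der_add_def)
  have "der_add (fd n (f p) p) ?d \<in> Der n"
    using d unfolding Der_def der_add_def by (auto simp: algebra_simps)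
  then show ?case unfolding e using insert v_add[OF d(2,1)] by (simp add: V_def)
qed

text \<open>Splits the action of a derivation into its differential-operator part and the part
  coming from L_+.\<close>

lemma v_expansion:
  assumes d: "\<delta> \<in> Der n"
  shows "v \<delta> x = (\<Sum>p<n. a (\<delta> (Xv p)) (V 1 p x) + tau p (\<delta> (Xv p)) x)"
proof -
  have "\<delta> = (\<lambda>g. \<Sum>p<n. fd n (\<delta> (Xv p)) p g)"
  proof
    fix g
    show "\<delta> g = (\<Sum>p<n. fd n (\<delta> (Xv p)) p g)"
    proof (cases "inA n g")
      case True
      then show ?thesis using Der_expansion[OF d True] by (simp add: fd_def)
    next
      case False
      then show ?thesis using d by (auto simp: fd_def Der_def)
    qed
  qed
  then have "v \<delta> x = (\<Sum>p<n. V (\<delta> (Xv p)) p x)"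
    using v_sum_fd[of "{..<n}" "\<lambda>p. \<delta> (Xv p)" x] Der_inA[OF d] by auto
  then show ?thesis by (simp add: tau_def)
qed

lemma a_sum_right: "inA n f \<Longrightarrow> a f (sum g S) = (\<Sum>i\<in>S. a f (g i))"
  by (induction S rule: infinite_finite_induct) (auto simp: a_right a_0_right)

text \<open>Lists of length at least 2 are the elements of L_+ of degree at least 1, the kernel of
  the projection to gl_n.\<close>

definition killed :: "'m \<Rightarrow> bool" where
  "killed z \<longleftrightarrow> (\<forall>js p. set js \<subseteq> {..<n} \<longrightarrow> 2 \<le> length js \<longrightarrow> p < n \<longrightarrow> T js p z = 0)"

text \<open>Multiplication of the argument by X_i is that by X_i - x_i, which lengthens the list,
  plus that by x_i; both terms vanish by induction.\<close>

lemma SS_tau_killed: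
  assumes z: "killed z" and p: "p < n"
  shows "inA n f \<Longrightarrow> set js \<subseteq> {..<n} \<Longrightarrow> 2 \<le> length js \<Longrightarrow> SS js (tau p) f z = 0"
proof (induction arbitrary: js rule: inA_induct)
  case (cst c)
  have "SS js (tau p) (cst c * 1) z = sc c (SS js (tau p) 1 z)"
    by (rule A_linearD(5)[OF A_linear_SS_tau inA_1]) (use cst in auto)
  then show ?case using z p cst by (simp add: killed_def T_def)
next
  case (add f g)
  then show ?case using A_linearD(4)[OF A_linear_SS_tau[OF add(5)] add(1,2)] by simp
next
  case (Xv i f)
  have "SS (i # js) (tau p) f z = 0" by (rule Xv(3)) (use Xv in auto)
  moreover have "SS js (tau p) f z = 0" by (rule Xv(3)) (use Xv in auto)
  ultimately show ?case using Xv(1) by (simp add: a_0_right)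
qed

lemma SS_single_tau_killed:
  assumes z: "killed z" and p: "p < n" and j: "j < n"
  shows "inA n f \<Longrightarrow> SS [j] (tau p) f z = a f (T [j] p z)"
proof (induction rule: inA_induct)
  case (cst c)
  have "SS [j] (tau p) (cst c * 1) z = sc c (SS [j] (tau p) 1 z)"
    by (rule A_linearD(5)[OF A_linear_SS_tau inA_1]) (use j in auto)
  then show ?case using a_cst_mult[of 1 c] by (simp add: T_def a_1 del: SS.simps)
next
  case (add f g)
  have "SS [j] (tau p) (f + g) z = SS [j] (tau p) f z + SS [j] (tau p) g z"
    by (rule A_linearD(4)[OF A_linear_SS_tau]) (use add j in auto)
  then show ?case using add by (simp add: a_add del: SS.simps)
next
  case (Xv i f)
  have "SS [i, j] (tau p) f z = 0" by (rule SS_tau_killed[OF z p]) (use Xv j in auto)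
  then have "SS [j] (tau p) (Xv i * f) z = a (Xv i) (SS [j] (tau p) f z)"
    by (simp add: SS.simps(2)[of i "[j]"] del: SS.simps)
  then show ?case using Xv by (simp add: a_mult del: SS.simps)
qed

text \<open>The Taylor expansion of f(X) - f(x) breaks off after first order on killed vectors. This
  is the source of the formula in \<open>tensor_actV\<close>, with \<open>T [j] p\<close> in the
  role of E_jp.\<close>

lemma tau_killed:
  assumes z: "killed z" and p: "p < n"
  shows "inA n f \<Longrightarrow> tau p f z = (\<Sum>j<n. a (pd j f) (T [j] p z))"
proof (induction rule: inA_induct)
  case (cst c)
  have "tau p (cst c * 1) z = sc c (tau p 1 z)" by (rule A_linearD(5)[OF A_linear_tau inA_1])
  moreover have "a 0 y = 0" for y using a_cst_mult[of 1 0 y] by simp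
  ultimately show ?case by simp
next
  case (add f g)
  have "tau p (f + g) z = tau p f z + tau p g z" by (rule A_linearD(4)[OF A_linear_tau]) (use add in auto)
  then show ?case using add by (simp add: a_add sum.distrib)
next
  case (Xv i f)
  have a0: "a 0 y = 0" for y using a_cst_mult[of 1 0 y] by simp
  have "tau p (Xv i * f) z = a f (T [i] p z) + a (Xv i) (tau p f z)"
    using SS_single_tau_killed[OF z p Xv(1,2)] by (simp add: diff_eq_eq)
  also have "a (Xv i) (tau p f z) = (\<Sum>j<n. a (Xv i * pd j f) (T [j] p z))"
    unfolding Xv(3) a_sum_right[OF inA_Xv[OF Xv(1)]]
    using Xv by (intro sum.cong refl) (simp add: a_mult)
  also have "a f (T [i] p z) = (\<Sum>j<n. if j = i then a f (T [j] p z) else 0)" using Xv(1) by simp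
  also have "\<dots> + (\<Sum>j<n. a (Xv i * pd j f) (T [j] p z)) = (\<Sum>j<n. a (pd j (Xv i * f)) (T [j] p z))"
    unfolding sum.distrib[symmetric] using Xv
    by (intro sum.cong refl) (auto simp: pd_mult pd_Xv a_add a0)
  finally show ?case .
qed

lemma T_0 [simp]: "set js \<subseteq> {..<n} \<Longrightarrow> T js p 0 = 0"
  using A_linear_T(2)[of js p 0 0] by simp

lemma T_sum: "set js \<subseteq> {..<n} \<Longrightarrow> T js p (sum f S) = (\<Sum>i\<in>S. T js p (f i))"
  by (induction S rule: infinite_finite_induct) (auto simp: A_linear_T)

lemma linear_T: "set js \<subseteq> {..<n} \<Longrightarrow> Vector_Spaces.linear sc sc (T js p)"
  by (auto simp: Vector_Spaces.linear_iff vs A_linear_T)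

lemma T_snoc_remove1: "q \<in> set js \<Longrightarrow> set js \<subseteq> {..<n} \<Longrightarrow> T (remove1 q js @ [q]) p x = T js p x"
proof -
  assume q: "q \<in> set js" "set js \<subseteq> {..<n}"
  then have "set (remove1 q js) \<subseteq> {..<n}" "q < n" using set_remove1_subset[of q js] by auto
  then show ?thesis unfolding T_def using SS_snoc[of q "remove1 q js"] SS_remove1[OF q] by simp
qed

text \<open>Summing \<open>bracket_single\<close> over the Euler field counts every factor X_i once
  and d_p with -1, so \<open>T js p\<close> has weight \<open>length js - 1\<close>.\<close>

lemma euler_degree:
  assumes "set js \<subseteq> {..<n}" "p < n"
  shows "(\<Sum>i<n. T [i] i (T js p x)) = T js p (\<Sum>i<n. T [i] i x) + sc (of_nat (length js) - 1) (T js p x)"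
proof -
  have "T [i] i (T js p x) - T js p (T [i] i x) = sc (of_nat (count_list js i)) (T js p x) - (if i = p then T js p x else 0)"
    if "i < n" for i
    using bracket_single[OF that that assms(1), of p x] T_snoc_remove1[of i js p x] assms(1)
    by (cases "i \<in> set js") (auto simp: count_list_0_iff)
  then have "(\<Sum>i<n. T [i] i (T js p x) - T js p (T [i] i x)) =
      (\<Sum>i<n. sc (of_nat (count_list js i)) (T js p x) - (if i = p then T js p x else 0))" by simp
  also have "\<dots> = sc (of_nat (\<Sum>i<n. count_list js i)) (T js p x) - T js p x"
    using assms(2) by (simp add: sum_subtractf scale_sum_left)
  also have "(\<Sum>i<n. count_list js i) = length js" using assms(1) by (intro sum_count_set) auto
  finally show ?thesis
    by (simp add: sum_subtractf T_sum[OF assms(1)] scale_left_diff_distrib diff_eq_eq add.commute)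
qed

text \<open>Elements of large degree are brackets of X_q^2 d_q with elements of one degree less, so
  vanishing on z propagates upwards from finitely many operators.\<close>

lemma killed_generation:
  assumes small: "\<And>js p. set js \<subseteq> {..<n} \<Longrightarrow> 2 \<le> length js \<Longrightarrow> length js \<le> 3 * n + 2 \<Longrightarrow> p < n \<Longrightarrow> T js p z = 0"
  shows "killed z"
  unfolding killed_def
proof (intro allI impI)
  fix js p assume "set js \<subseteq> {..<n}" "2 \<le> length js" "p < n"
  then show "T js p z = 0"
  proof (induction "length js" arbitrary: js p rule: less_induct)
    case less
    show ?case
    proof (cases "length js \<le> 3 * n + 2")
      case True
      then show ?thesis using small less by blast
    next
      case False
      \<comment> \<open>Four occurrences leave at least three after one is removed. The bracket then
        has coefficient at least 3 if p differs from q and at least 3 - 2 if p = q, nonzero in both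
        cases.\<close>
      then obtain q where q: "q < n" "4 \<le> count_list js q" using count_list_pigeonhole[of js n] less by auto
      have qj: "q \<in> set js" using q(2) count_list_0_iff[of js q] by auto
      let ?r = "remove1 q js"
      have r: "set ?r \<subseteq> {..<n}" "length ?r = length js - 1" using set_remove1_subset[of q js] less qj
        by (auto simp: length_remove1)
      have cr: "count_list ?r q = count_list js q - 1" using qj by (induction js) auto
      have qr: "q \<in> set ?r" using cr q(2) count_list_0_iff[of ?r q] by auto
      have Tr: "T ?r s z = 0" if "s < n" for s
        using less(1)[of ?r s] r less(3) False that by auto
      have Tq: "T [q, q] q z = 0" using small[of "[q, q]" q] q by simp
      have rr: "set (remove1 q ?r) \<subseteq> {..<n}" using r set_remove1_subset[of q ?r] by blast
      have e: "SS (remove1 q ?r @ [q, q]) \<theta> f x = SS js \<theta> f x" for \<theta> f x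
      proof -
        have "SS ((remove1 q ?r @ [q]) @ [q]) \<theta> f x = SS (q # (remove1 q ?r @ [q])) \<theta> f x"
          using rr q by (intro SS_snoc) auto
        also have "\<dots> = SS (q # ?r) \<theta> f x"
          by (rule SS_Cons_cong) (use SS_snoc[OF q(1) rr] SS_remove1[OF qr r(1)] in simp)
        also have "\<dots> = SS js \<theta> f x" by (rule SS_remove1[OF qj less(2)])
        finally show ?thesis by simp
      qed
      have T1: "T (remove1 q ?r @ [q, q]) p z = T js p z" by (simp add: T_def e)
      have T2: "T (?r @ [q]) q z = T js q z" by (rule T_snoc_remove1[OF qj less(2)])
      have "sc (of_nat (count_list ?r q)) (T js p z) - sc (if p = q then 2 else 0) (T js q z) = 0"
      proof -
        have "set [q, q] \<subseteq> {..<n}" "?r \<noteq> []" using q qr by auto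
        note B = bracket_double[OF q(1) r(1) this(2), of p z, unfolded T1 T2]
        have "T [q, q] q (T ?r p z) - T ?r p (T [q, q] q z) = 0"
          by (simp only: Tr[OF less(4)] Tq T_0 r(1) \<open>set [q, q] \<subseteq> {..<n}\<close> diff_self)
        then show ?thesis using B by (simp only:)
      qed
      then have "sc (of_nat (count_list ?r q) - (if p = q then 2 else 0)) (T js p z) = 0"
        by (auto simp: scale_left_diff_distrib)
      moreover have "(of_nat (count_list ?r q) - (if p = q then 2 else 0) :: 'k) \<noteq> 0"
      proof -
        have "count_list ?r q \<noteq> 2" "count_list ?r q \<noteq> 0" using cr q(2) by auto
        moreover have "of_nat (count_list ?r q) = (2::'k) \<longleftrightarrow> count_list ?r q = 2"
          by (metis of_nat_eq_iff of_nat_numeral)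
        ultimately show ?thesis by auto
      qed
      ultimately show ?thesis by simp
    qed
  qed
qed

text \<open>The part of positive degree is an ideal of L_+: the bracket with a degree-zero element
  consists of lists of the same length.\<close>

lemma T_single_killed:
  assumes w: "killed w" and i: "i < n" "q < n"
  shows "killed (T [i] q w)"
  unfolding killed_def
proof (intro allI impI)
  fix js p assume js: "set js \<subseteq> {..<n}" "2 \<le> length js" "p < n"
  have "sc (of_nat (count_list js q)) (T (remove1 q js @ [i]) p w) = 0"
  proof (cases "q \<in> set js")
    case True
    have "set (remove1 q js @ [i]) \<subseteq> {..<n}" using js(1) i set_remove1_subset[of q js] by auto
    moreover have "2 \<le> length (remove1 q js @ [i])" using js(2) True by (simp add: length_remove1)
    ultimately have "T (remove1 q js @ [i]) p w = 0" using w js(3) unfolding killed_def by blast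
    then show ?thesis by simp
  next
    case False
    then show ?thesis by (simp add: count_list_0_iff)
  qed
  moreover have "T js p w = 0" "T js q w = 0" using w js i unfolding killed_def by auto
  ultimately show "T js p (T [i] q w) = 0"
  proof -
    have "set [i] \<subseteq> {..<n}" using i by simp
    then have "T js p (T [i] q w) = (if p = i then T js q w else 0)"
      using bracket_single[OF i js(1), of p w] \<open>T js p w = 0\<close> \<open>sc _ _ = 0\<close>
      by (simp only: T_0) (simp split: if_splits)
    then show ?thesis using \<open>T js q w = 0\<close> by simp
  qed
qed

lemma killed_op: "killed w \<Longrightarrow> killed (op c w)"
  by (auto simp: killed_def T_op)

end

section \<open>Finite-dimensional multiplicity spaces\<close>

locale av_simple = av +
  assumes ac: "alg_closed TYPE('a)"
    and unc: "uncountable (UNIV :: 'a set)"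
    and simple_AV: "op_simple sc (AV_ops n a v) UNIV"
    and holonomic_AV: "op_holonomic n sc (AV_ops n a v) UNIV"
begin

lemma GKdim_AV: "GKdim sc (AV_ops n a v) UNIV \<le> ereal (real n)"
  using simple_AV holonomic_AV unfolding op_simple_def op_holonomic_def by auto

sublocale os: operator_set sc "AV_ops n a v"
  by (intro operator_set.intro operator_set_axioms.intro vs) (auto simp: AV_ops_def linear_a linear_v)

lemma a_in_opalg: "inA n f \<Longrightarrow> a f \<in> opalg sc (AV_ops n a v)"
  by (rule opalg.base) (auto simp: AV_ops_def)

lemma V_in_opalg: "inA n f \<Longrightarrow> V f p \<in> opalg sc (AV_ops n a v)"
  unfolding V_def by (rule opalg.base) (auto simp: AV_ops_def intro: fd_Der)

lemma YY_in_opalg: "j < 2 * n \<Longrightarrow> YY j \<in> opalg sc (AV_ops n a v)"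
  by (simp add: YY_def a_in_opalg V_in_opalg)

lemma opalg_diff:
  assumes "S \<in> opalg sc Ops" "S' \<in> opalg sc Ops"
  shows "(\<lambda>x. S x - S' x) \<in> opalg sc Ops"
proof -
  have "(\<lambda>x. S x + (\<lambda>x. sc (-1) (S' x)) x) \<in> opalg sc Ops"
    by (rule opalg.add[OF assms(1) opalg.scale[OF assms(2)]])
  then show ?thesis by simp
qed

lemma SS_tau_in_opalg: "set js \<subseteq> {..<n} \<Longrightarrow> inA n f \<Longrightarrow> SS js (tau p) f \<in> opalg sc (AV_ops n a v)"
proof (induction js arbitrary: f)
  case Nil
  have "(\<lambda>x. V f p x - (a f \<circ> V 1 p) x) \<in> opalg sc (AV_ops n a v)"
    using Nil by (intro opalg_diff opalg.comp a_in_opalg V_in_opalg) auto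
  moreover have "SS [] (tau p) f = (\<lambda>x. V f p x - (a f \<circ> V 1 p) x)" by (auto simp: tau_def)
  ultimately show ?case by (simp only:)
next
  case (Cons i js)
  have "(\<lambda>x. SS js (tau p) (Xv i * f) x - (a (Xv i) \<circ> SS js (tau p) f) x) \<in> opalg sc (AV_ops n a v)"
    using Cons by (intro opalg_diff opalg.comp a_in_opalg) auto
  moreover have "SS (i # js) (tau p) f = (\<lambda>x. SS js (tau p) (Xv i * f) x - (a (Xv i) \<circ> SS js (tau p) f) x)" by auto
  ultimately show ?case by (simp only:)
qed

lemma slow_all: "slow w"
proof -
  have "\<exists>C. \<forall>m. (growth sc (YY ` {..<2*n}) {w} m)\<^sup>2 \<le> C * (m + 1) ^ (2 * n + 1)"
    by (rule os.growth_slow[OF GKdim_AV]) (auto simp: YY_in_opalg)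
  then obtain C where C: "\<And>m. (growth sc (YY ` {..<2*n}) {w} m)\<^sup>2 \<le> C * (m + 1) ^ (2 * n + 1)" by blast
  have "(dim (Gam w m))\<^sup>2 \<le> C * (m + 1) ^ (2 * n + 1)" for m
  proof -
    have "dim (Gam w m) \<le> growth sc (YY ` {..<2*n}) {w} m" by (rule dim_Gam_le_growth) auto
    then have "(dim (Gam w m))\<^sup>2 \<le> (growth sc (YY ` {..<2*n}) {w} m)\<^sup>2" by (rule power_mono) simp
    then show ?thesis using C[of m] by linarith
  qed
  then show ?thesis unfolding slow_def by blast
qed

lemma simple_gen_ex: "\<exists>u. simple_gen u"
proof -
  have "\<exists>w::'b. w \<noteq> 0" using simple_AV unfolding op_simple_def by blast
  then show ?thesis using simple_gen_exists slow_all by blast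
qed

text \<open>For \<open>simple_gen u\<close> this is Hom_D(D u, M): a homomorphism is determined by
  the image of u, and the possible images are exactly these vectors.\<close>

definition Qs :: "'b \<Rightarrow> 'b set" where
  "Qs u = {w. Ann u \<subseteq> Ann w}"

lemma Qs_iff: "w \<in> Qs u \<longleftrightarrow> (\<forall>c. inA (2*n) c \<longrightarrow> op c u = 0 \<longrightarrow> op c w = 0)"
  unfolding Qs_def Ann_def by blast

lemma subspace_Qs: "subspace (Qs u)"
  unfolding subspace_def by (auto simp: Qs_iff)

lemma T_Qs: "set js \<subseteq> {..<n} \<Longrightarrow> w \<in> Qs u \<Longrightarrow> T js p w \<in> Qs u"
  by (simp add: Qs_iff T_op[symmetric])

text \<open>Density says that D u tensored with the span of B embeds into M, so independent vectors
  \<open>mon s u\<close> and independent b give independent vectors \<open>mon s b\<close>.\<close>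

lemma growth_product:
  assumes u: "simple_gen u" and B: "finite B" "independent B" "B \<subseteq> Qs u"
    and G: "finite G" "\<And>s b. s \<in> exps (2*n) m \<Longrightarrow> b \<in> B \<Longrightarrow> mon s b \<in> span G"
  shows "dim (Gam u m) * card B \<le> dim G"
proof (rule ccontr)
  assume neg: "\<not> ?thesis"
  let ?f = "\<lambda>s. mon s u"
  obtain B0 where B0: "B0 \<subseteq> ?f ` exps (2*n) m" "independent B0" "?f ` exps (2*n) m \<subseteq> span B0" "card B0 = dim (?f ` exps (2*n) m)"
    using basis_exists by blast
  \<comment> \<open>S picks exponents whose monomials give a basis of
    \<open>Gam u m\<close>.\<close>
  obtain S where S: "S \<subseteq> exps (2*n) m" "inj_on ?f S" "B0 = ?f ` S" using B0(1) by (auto simp: subset_image_inj)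
  have fS: "finite S" using S(1) finite_exps finite_subset by blast
  have cS: "card S = dim (Gam u m)" using B0(4) S(2,3) unfolding Gam_def by (simp add: card_image)
  obtain BG where BG: "BG \<subseteq> G" "independent BG" "G \<subseteq> span BG" "card BG = dim G"
    using basis_exists by blast
  have fBG: "finite BG" using BG(1) G(1) finite_subset by blast
  have "span G \<subseteq> span BG" using BG(3) by (intro span_minimal) auto
  then have mem: "mon (fst e) (snd e) \<in> span BG" if "e \<in> S \<times> B" for e
  proof -
    have "mon (fst e) (snd e) \<in> span G" using that S(1) by (intro G(2)) auto
    then show ?thesis using \<open>span G \<subseteq> span BG\<close> by blast
  qed
  have "card {()} * card BG < card (S \<times> B)" using neg cS BG(4) by (simp add: card_cartesian_product)
  then obtain k where k: "\<exists>e\<in>S \<times> B. k e \<noteq> 0" "(\<Sum>e\<in>S \<times> B. sc (k e) (mon (fst e) (snd e))) = 0"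
    using common_linear_relation[of "S \<times> B" "{()}" BG "\<lambda>e w. mon (fst e) (snd e)"] fS B(1) fBG mem by auto
  \<comment> \<open>Collecting the coefficients belonging to one b turns the relation into a sum of
    operators applied to the elements of B, the form that \<open>density\<close> requires.\<close>
  define c where "c b = (\<Sum>s\<in>S. single s (k (s, b)))" for b
  have cA: "inA (2*n) (c b)" for b
    unfolding c_def using S(1) by (intro inA_sum) (auto simp: inA_single exps_def)
  have opc: "op (c b) x = (\<Sum>s\<in>S. sc (k (s, b)) (mon s x))" for b x
    by (simp add: c_def op_sum op_single)
  have "(\<Sum>b\<in>B. op (c b) b) = (\<Sum>s\<in>S. \<Sum>b\<in>B. sc (k (s, b)) (mon s b))"
    unfolding opc by (rule sum.swap)
  also have "\<dots> = 0" using k(2) by (simp add: sum.cartesian_product case_prod_unfold)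
  finally have sum0: "(\<Sum>b\<in>B. op (c b) b) = 0" .
  have "\<forall>b\<in>B. op (c b) u = 0"
    using density[OF ac unc u B(1,2) _ cA sum0] B(3) unfolding Qs_def by blast
  moreover obtain s b where sb: "s \<in> S" "b \<in> B" "k (s, b) \<noteq> 0" using k(1) by auto
  ultimately have "(\<Sum>s\<in>S. sc (k (s, b)) (?f s)) = 0" using opc by metis
  then have "(\<Sum>x\<in>B0. sc (k (the_inv_into S ?f x, b)) x) = 0"
    unfolding S(3) sum.reindex[OF S(2)] by (simp add: the_inv_into_f_f[OF S(2)])
  moreover have "finite B0" using S(3) fS by simp
  moreover have "?f s \<in> B0" using S(3) sb(1) by blast
  ultimately have "k (the_inv_into S ?f (?f s), b) = 0"
    using independentD[OF B0(2), of B0 "\<lambda>x. k (the_inv_into S ?f x, b)"] by blast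
  then show False using sb the_inv_into_f_f[OF S(2) sb(1)] by simp
qed

text \<open>A finite set, as growth estimates demand; the bound on the length is the one from which
  \<open>killed_generation\<close> reaches all higher degrees. Lists of length 1 supply gl_n and the
  Euler operator.\<close>

definition FT :: "('b \<Rightarrow> 'b) set" where
  "FT = (\<lambda>(js, p). T js p) ` ({js. set js \<subseteq> {..<n} \<and> length js \<le> 3 * n + 2} \<times> {..<n})"

lemma finite_FT: "finite FT"
  unfolding FT_def by (intro finite_imageI finite_cartesian_product finite_lists_length_le) auto

sublocale ft: operator_set sc FT
  by (intro operator_set.intro operator_set_axioms.intro vs) (auto simp: FT_def linear_T)

lemma words_FT_Qs: "w \<in> words FT m \<Longrightarrow> q \<in> Qs u \<Longrightarrow> w q \<in> Qs u"
proof -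
  assume w: "w \<in> words FT m" and q: "q \<in> Qs u"
  have "\<exists>k\<le>m. w q \<in> Qs u" using w
    by (induction rule: words_induct) (use q in \<open>auto simp: FT_def T_Qs\<close>)
  then show ?thesis by blast
qed

text \<open>An infinite-dimensional orbit in the multiplicity space would raise the growth rate of the
  module by one.\<close>

lemma locally_finite:
  assumes u: "simple_gen u" and q: "q \<in> Qs u" "q \<noteq> 0"
  shows "\<exists>m. \<forall>S\<in>FT. \<forall>x\<in>span ((\<lambda>w. w q) ` words FT m). S x \<in> span ((\<lambda>w. w q) ` words FT m)"
proof (rule ccontr)
  assume "\<not> ?thesis"
  then have big: "m + 1 \<le> dim ((\<lambda>w. w q) ` words FT m)" for m
    using ft.orbit_stabilizes_or_grows[OF finite_FT q(2)] by blast
  define F where "F = FT \<union> YY ` {..<2*n}"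
  have F: "finite F" "F \<subseteq> opalg sc (AV_ops n a v)"
    using finite_FT by (auto simp: F_def FT_def T_def SS_tau_in_opalg YY_in_opalg)
  obtain C where C: "\<And>m. (growth sc F {q} m)\<^sup>2 \<le> C * (m + 1) ^ (2 * n + 1)"
    using os.growth_slow[OF GKdim_AV F, of "{q}"] by auto
  obtain C' where C': "\<And>m. dim (Gam u m) \<le> C' * (m + 1) ^ n"
    using slow_imp_dim_Gam_le[OF slow_all] by blast
  define K where "K = (2*n) ^ (2*n) * C' * 2 ^ n"
  have "u \<noteq> 0" using u by (simp add: simple_gen_def)
  then have lower: "(m + 1) ^ n \<le> K * dim (Gam u m)" for m
    unfolding K_def by (rule dim_Gam_ge[OF _ C'])
  \<comment> \<open>A monomial of length m is composed with a word of length m in \<open>FT\<close>,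
    whence the argument 2 m.\<close>
  have prod: "dim (Gam u m) * (m + 1) \<le> growth sc F {q} (2 * m)" for m
  proof -
    let ?S = "(\<lambda>w. w q) ` words FT m" and ?G = "{w x | w x. w \<in> words F (2 * m) \<and> x \<in> {q}}"
    have finS: "finite ?S" using finite_words[OF finite_FT] by simp
    have finG: "finite ?G" using finite_words[OF F(1), of "2 * m"] by simp
    obtain B where B: "B \<subseteq> ?S" "independent B" "?S \<subseteq> span B" "card B = dim ?S"
      using basis_exists by blast
    have "dim (Gam u m) * card B \<le> dim ?G"
    proof (rule growth_product[OF u _ B(2)])
      show "finite B" using B(1) finS finite_subset by blast
      show "B \<subseteq> Qs u" using B(1) words_FT_Qs q(1) by blast
      fix s b assume s: "s \<in> exps (2*n) m" and "b \<in> B"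
      then obtain w where w: "b = w q" "w \<in> words FT m" using B(1) by blast
      have "mon s \<in> words F m" by (rule mon_in_words[OF _ s]) (auto simp: F_def)
      moreover have "w \<in> words F m" using w(2) words_mono[of FT F m m] by (auto simp: F_def)
      ultimately have "mon s \<circ> w \<in> words F (2 * m)" using words_comp[of "mon s" F m w m] by (simp add: mult_2)
      then have "(mon s \<circ> w) q \<in> ?G" by blast
      then show "mon s b \<in> span ?G" using w(1) by (auto intro: span_base)
    qed (rule finG)
    moreover have "dim (Gam u m) * (m + 1) \<le> dim (Gam u m) * card B" using big[of m] B(4) by (intro mult_le_mono2) simp
    ultimately show ?thesis unfolding growth_def by linarith
  qed
  \<comment> \<open>At this m the two bounds combine to m + 1 \<le> m after cancelling a power of m
    + 1.\<close>
  define m where "m = K\<^sup>2 * C * 2 ^ (2 * n + 1)"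
  have "x * x ^ (2 * n + 1) = (x ^ n * x)\<^sup>2" for x :: nat
  proof -
    have "x ^ (n * 2) = x ^ n * x ^ n" by (simp add: mult_2_right power_add)
    then show ?thesis by (simp add: power2_eq_square ac_simps)
  qed
  then have "(m + 1) * (m + 1) ^ (2 * n + 1) = ((m + 1) ^ n * (m + 1))\<^sup>2" .
  also have "\<dots> \<le> (K * dim (Gam u m) * (m + 1))\<^sup>2" using lower[of m] by (intro power_mono mult_le_mono1) auto
  also have "\<dots> = K\<^sup>2 * (dim (Gam u m) * (m + 1))\<^sup>2" by (simp only: power_mult_distrib ac_simps)
  also have "\<dots> \<le> K\<^sup>2 * (growth sc F {q} (2 * m))\<^sup>2" using prod[of m] by (intro mult_le_mono2 power_mono) auto
  also have "\<dots> \<le> K\<^sup>2 * (C * (2 * m + 1) ^ (2 * n + 1))" using C by (intro mult_le_mono2)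
  also have "\<dots> \<le> K\<^sup>2 * (C * (2 * (m + 1)) ^ (2 * n + 1))" by (intro mult_le_mono2 power_mono) auto
  also have "\<dots> = m * (m + 1) ^ (2 * n + 1)"
    unfolding power_mult_distrib by (simp only: m_def ac_simps)
  finally have "(m + 1) * (m + 1) ^ (2 * n + 1) \<le> m * (m + 1) ^ (2 * n + 1)" .
  then show False by (simp only: mult_le_cancel2) simp
qed

text \<open>The Euler operator shifts the degree of the operators T js p; an eigenvector with maximal
  eigenvalue in a finite-dimensional invariant space is killed by all of positive degree.\<close>

lemma finite_dim_killed_subspace:
  assumes u: "simple_gen u"
  shows "\<exists>W F. subspace W \<and> finite F \<and> W \<subseteq> span F \<and> W \<subseteq> Qs u \<and> W \<noteq> {0} \<and> (\<forall>w\<in>W. killed w)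
    \<and> (\<forall>i<n. \<forall>q<n. \<forall>w\<in>W. T [i] q w \<in> W)"
proof -
  \<comment> \<open>u itself lies in Q, so its own orbit provides the finite-dimensional space
    H.\<close>
  have uQ: "u \<in> Qs u" by (simp add: Qs_iff)
  have u0: "u \<noteq> 0" using u by (simp add: simple_gen_def)
  obtain m where m: "\<And>S x. S \<in> FT \<Longrightarrow> x \<in> span ((\<lambda>w. w u) ` words FT m) \<Longrightarrow> S x \<in> span ((\<lambda>w. w u) ` words FT m)"
    using locally_finite[OF u uQ u0] by blast
  define F where "F = (\<lambda>w. w u) ` words FT m"
  define H where "H = span F"
  have fF: "finite F" using finite_words[OF finite_FT] by (simp add: F_def)
  have subH: "subspace H" by (simp add: H_def)
  have HQ: "H \<subseteq> Qs u" unfolding H_def F_def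
    using words_FT_Qs[OF _ uQ] by (intro span_minimal subspace_Qs) auto
  have "u \<in> F" using imageI[OF id_in_words[of FT m], of "\<lambda>w. w u"] by (simp add: F_def)
  then have uH: "u \<in> H" by (simp add: H_def span_base)
  have mH: "S x \<in> H" if "S \<in> FT" "x \<in> H" for S x
    using m that unfolding H_def F_def by blast
  have TH: "T js p x \<in> H" if "set js \<subseteq> {..<n}" "length js \<le> 3 * n + 2" "p < n" "x \<in> H" for js p x
    by (rule mH[OF _ that(4)]) (use that in \<open>auto simp: FT_def intro!: image_eqI[of _ _ "(js, p)"]\<close>)
  define E where "E x = (\<Sum>i<n. T [i] i x)" for x
  interpret E: operator_on sc H E
  proof (unfold_locales, fact subH)
    fix x assume x: "x \<in> H"
    show "E x \<in> H" unfolding E_def using subH TH x by (intro subspace_sum) auto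
    show "E (x + y) = E x + E y" for y
      unfolding E_def sum.distrib[symmetric] by (intro sum.cong) (auto simp: A_linear_T)
    show "E (sc c x) = sc c (E x)" for c
      unfolding E_def scale_sum_right by (intro sum.cong) (auto simp: A_linear_T)
  qed
  have HF: "H \<subseteq> span F" by (simp add: H_def)
  obtain p where "p \<noteq> 0" "E.pact p u = 0" using E.annihilating_polynomial_exists[OF HF fF uH] by blast
  from E.eigenvector_exists[OF ac uH u0 this] obtain l z0 where z0: "z0 \<in> H" "z0 \<noteq> 0" "E z0 = sc l z0" by blast
  \<comment> \<open>Eigenvalues of the form l + k with k natural. They are pairwise distinct in
    characteristic 0, hence finitely many, and a largest k exists.\<close>
  let ?K = "{k. \<exists>z\<in>H. z \<noteq> 0 \<and> E z = sc (l + of_nat k) z}"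
  have "finite ?K"
  proof (rule ccontr)
    assume "infinite ?K"
    then obtain L where L: "L \<subseteq> ?K" "finite L" "card L = Suc (card F)" using infinite_arbitrarily_large by blast
    let ?g = "\<lambda>k::nat. l + of_nat k"
    have "inj_on ?g L" by (auto simp: inj_on_def)
    then have "card (?g ` L) = Suc (card F)" using L(3) by (simp add: card_image)
    moreover have "card (?g ` L) \<le> card F"
      by (rule E.eigenvalues_card_le[OF _ _ HF fF]) (use L in auto)
    ultimately show False by simp
  qed
  define k0 where "k0 = Max ?K"
  have "0 \<in> ?K" using z0 by (auto intro!: bexI[of _ z0])
  then have "?K \<noteq> {}" by blast
  then have "k0 \<in> ?K" unfolding k0_def by (rule Max_in[OF \<open>finite ?K\<close>])
  then obtain z where z: "z \<in> H" "z \<noteq> 0" "E z = sc (l + of_nat k0) z" by blast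
  have "killed z"
  proof (rule killed_generation)
    fix js p assume js: "set js \<subseteq> {..<n}" "2 \<le> length js" "length js \<le> 3 * n + 2" "p < n"
    show "T js p z = 0"
    proof (rule ccontr)
      assume nz: "T js p z \<noteq> 0"
      have "E (T js p z) = T js p (E z) + sc (of_nat (length js) - 1) (T js p z)"
        unfolding E_def by (rule euler_degree[OF js(1,4)])
      also have "\<dots> = sc (l + of_nat (k0 + (length js - 1))) (T js p z)"
      proof -
        have "(of_nat (k0 + (length js - 1)) :: 'a) = of_nat k0 + (of_nat (length js) - 1)"
          using js(2) by (simp add: of_nat_diff)
        then show ?thesis
          unfolding z(3) using js by (simp only: A_linear_T scale_left_distrib add.assoc)
      qed
      \<comment> \<open>A nonzero \<open>T js p z\<close> would be an eigenvector with k0 + (length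
        js - 1), which exceeds k0 because the list has length at least 2.\<close>
      finally have "k0 + (length js - 1) \<in> ?K" using TH[OF js(1,3,4) z(1)] nz by blast
      then have "k0 + (length js - 1) \<le> k0" unfolding k0_def using \<open>finite ?K\<close> by (intro Max_ge)
      then show False using js(2) by simp
    qed
  qed
  define W where "W = {w \<in> H. killed w}"
  have "subspace W"
    using subH unfolding W_def subspace_def killed_def by (auto simp: A_linear_T)
  moreover have "W \<subseteq> span F" "W \<subseteq> Qs u" using HF HQ by (auto simp: W_def)
  moreover have "W \<noteq> {0}" using z \<open>killed z\<close> by (auto simp: W_def)
  moreover have "\<forall>i<n. \<forall>q<n. \<forall>w\<in>W. T [i] q w \<in> W"
    using TH T_single_killed by (auto simp: W_def)
  ultimately show ?thesis using fF by (intro exI[of _ W] exI[of _ F]) (auto simp: W_def)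
qed

text \<open>On killed vectors a derivation acts through differential operators and the maps
  \<open>T [i] q\<close>, which commute with D and preserve W. So D W is an AV-submodule, and
  simplicity applies. This yields surjectivity of the splitting and simplicity of its second
  factor.\<close>

lemma op_span_eq_UNIV:
  assumes W: "subspace W" "\<And>w. w \<in> W \<Longrightarrow> killed w" "\<And>i q w. i < n \<Longrightarrow> q < n \<Longrightarrow> w \<in> W \<Longrightarrow> T [i] q w \<in> W"
    and w0: "w0 \<in> W" "w0 \<noteq> 0"
  shows "span {op c w | c w. inA (2*n) c \<and> w \<in> W} = UNIV"
proof -
  let ?S = "{op c w | c w. inA (2*n) c \<and> w \<in> W}"
  have aS: "a f (op c w) \<in> span ?S" if "inA n f" "inA (2*n) c" "w \<in> W" for f c w
  proof -
    have "a f (op c w) = op (star n f c) w" using that by (simp add: a_eq_op op_star)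
    then show ?thesis using that by (auto intro!: span_base exI[of _ "star n f c"] exI[of _ w] simp: inA_star)
  qed
  have VS: "V 1 p (op c w) = op (Ly n (n + p) c) w" if "p < n" "inA (2*n) c" for p c w
    using that by (simp add: op_Ly V_1_eq_Y)
  have vS: "v \<delta> (op c w) \<in> span ?S" if d: "\<delta> \<in> Der n" and c: "inA (2*n) c" and w: "w \<in> W" for \<delta> c w
  proof -
    have k: "killed (op c w)" using W(2)[OF w] by (rule killed_op)
    have dA: "inA n (\<delta> (Xv p))" if "p < n" for p using Der_inA[OF d] that by simp
    have "a (\<delta> (Xv p)) (V 1 p (op c w)) + tau p (\<delta> (Xv p)) (op c w) \<in> span ?S" if p: "p < n" for p
    proof (rule span_add)
      show "a (\<delta> (Xv p)) (V 1 p (op c w)) \<in> span ?S"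
        unfolding VS[OF p c] by (rule aS) (use p c w dA in \<open>auto simp: inA_Ly\<close>)
      show "tau p (\<delta> (Xv p)) (op c w) \<in> span ?S"
        unfolding tau_killed[OF k p dA[OF p]]
      proof (rule span_sum)
        fix j assume j: "j \<in> {..<n}"
        then have "T [j] p (op c w) = op c (T [j] p w)" by (intro T_op) auto
        then show "a (pd j (\<delta> (Xv p))) (T [j] p (op c w)) \<in> span ?S"
          using aS[of "pd j (\<delta> (Xv p))" c "T [j] p w"] dA p c w j W(3) by simp
      qed
    qed
    then show ?thesis unfolding v_expansion[OF d] by (intro span_sum) auto
  qed
  have "op_submodule sc (AV_ops n a v) UNIV (span ?S)"
    unfolding op_submodule_def
  proof (intro conjI ballI)
    show "module.subspace sc (span ?S)" by simp
    fix S x assume S: "S \<in> AV_ops n a v" and x: "x \<in> span ?S"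
    show "S x \<in> span ?S"
    proof (rule os.linear_maps_span[OF os.Ops_linear[OF S] x])
      show "S ` ?S \<subseteq> span ?S" using S aS vS by (auto simp: AV_ops_def)
    qed simp
  qed simp
  then have "span ?S = {0} \<or> span ?S = UNIV" using simple_AV unfolding op_simple_def by blast
  moreover have "w0 \<in> ?S" using w0(1) by (auto intro!: exI[of _ 1] exI[of _ w0])
  then have "w0 \<in> span ?S" by (rule span_base)
  ultimately show ?thesis using w0(2) by auto
qed

end

section \<open>The Weyl algebra as operators on polynomials\<close>

definition YA :: "nat \<Rightarrow> nat \<Rightarrow> 'k::comm_ring_1 mpol \<Rightarrow> 'k mpol" where
  "YA n j = (if j < n then (\<lambda>g. Xv j * g) else pd (j - n))"

abbreviation opA :: "nat \<Rightarrow> 'k::comm_ring_1 mpol \<Rightarrow> 'k mpol \<Rightarrow> 'k mpol" where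
  "opA n \<equiv> wop (\<lambda>c f. cst c * f) n (YA n)"

lemma weyl_rep_A: "weyl_rep (\<lambda>c f. cst c * f) n (YA n :: nat \<Rightarrow> 'k::field_char_0 mpol \<Rightarrow> 'k mpol)"
proof -
  have vs: "vector_space (\<lambda>(c::'k) f. cst c * f)"
    by unfold_locales (simp_all add: cst_add cst_mult algebra_simps)
  show ?thesis
    by (intro weyl_rep.intro weyl_rep_axioms.intro vs)
      (auto simp: YA_def Vector_Spaces.linear_iff vs distrib_left mult.left_commute pd_mult pd_Xv pd_commute)
qed

text \<open>c is the normal-ordered symbol of the operator S on A, with the same convention of value
  0 outside A as in \<open>Weyl\<close>.\<close>

definition rep :: "nat \<Rightarrow> ('k::field_char_0 mpol \<Rightarrow> 'k mpol) \<Rightarrow> 'k mpol \<Rightarrow> bool" where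
  "rep n S c \<longleftrightarrow> inA (2*n) c \<and> (\<forall>g. S g = (if inA n g then opA n c g else 0))"

lemma inA_opA: "inA n g \<Longrightarrow> inA n (opA n c g)" for g :: "'k::field_char_0 mpol"
proof -
  interpret A: weyl_rep "\<lambda>c f. cst c * f" n "YA n :: nat \<Rightarrow> 'k mpol \<Rightarrow> 'k mpol" by (rule weyl_rep_A)
  have "A.Y_stable {g. inA n g}"
    by (auto simp: A.Y_stable_def A.subspace_def YA_def)
  then show "inA n g \<Longrightarrow> inA n (opA n c g)" using A.op_stable by blast
qed

lemma rep_unique:
  fixes c d :: "'k::field_char_0 mpol"
  assumes "rep n S c" "rep n S d"
  shows "c = d"
proof -
  interpret A: weyl_rep "\<lambda>c f. cst c * f" n "YA n :: nat \<Rightarrow> 'k mpol \<Rightarrow> 'k mpol" by (rule weyl_rep_A)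
  have st: "A.Y_stable {g. inA n g}"
    by (auto simp: A.Y_stable_def A.subspace_def YA_def)
  have "opA n (c - d) g = 0" if "g \<in> {g. inA n g}" for g
  proof -
    have "opA n c g = S g" using assms(1) that by (simp add: rep_def)
    moreover have "opA n d g = S g" using assms(2) that by (simp add: rep_def)
    ultimately show ?thesis by simp
  qed
  then have "c - d = 0"
    using A.op_faithful[OF st, of 1 "c - d"] assms by (simp add: rep_def)
  then show ?thesis by simp
qed

lemma opA_inA: "inA n f \<Longrightarrow> opA n f g = f * g" for f g :: "'k::field_char_0 mpol"
proof -
  interpret A: weyl_rep "\<lambda>c f. cst c * f" n "YA n :: nat \<Rightarrow> 'k mpol \<Rightarrow> 'k mpol" by (rule weyl_rep_A)
  show "inA n f \<Longrightarrow> opA n f g = f * g"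
  proof (induction rule: inA_induct)
    case (Xv i f)
    have "YA n i h = Xv i * h" for h :: "'k mpol" using Xv(1) by (simp add: YA_def)
    then show ?case using Xv by (simp add: A.op_X mult.assoc)
  qed (simp_all add: distrib_right)
qed

lemma rep_mulop: "inA n f \<Longrightarrow> rep n (mulop n f) f"
  by (auto simp: rep_def mulop_def opA_inA intro: inA_mono)

text \<open>The derivative variable \<open>Xv (n + p)\<close> is applied first, so the symbol can be
  written as this commutative product.\<close>

lemma rep_Der: "\<delta> \<in> Der n \<Longrightarrow> rep n \<delta> (\<Sum>p<n. Xv (n + p) * \<delta> (Xv p))" for \<delta> :: "'k::field_char_0 mpol \<Rightarrow> 'k mpol"
proof -
  interpret A: weyl_rep "\<lambda>c f. cst c * f" n "YA n :: nat \<Rightarrow> 'k mpol \<Rightarrow> 'k mpol" by (rule weyl_rep_A)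
  assume d: "\<delta> \<in> Der n"
  have dA: "inA n (\<delta> (Xv p))" if "p < n" for p using Der_inA[OF d] that by simp
  have "opA n (\<Sum>p<n. Xv (n + p) * \<delta> (Xv p)) g = \<delta> g" if "inA n g" for g
    unfolding Der_expansion[OF d that] A.op_sum
    by (intro sum.cong refl) (simp add: A.op_D opA_inA dA YA_def)
  moreover have "\<delta> g = 0" if "\<not> inA n g" for g using d that by (simp add: Der_def)
  moreover have "inA (2*n) (\<delta> (Xv p))" if "p < n" for p by (rule inA_mono[OF dA[OF that]]) simp
  ultimately show ?thesis by (auto simp: rep_def intro!: inA_sum inA_mult)
qed

lemma rep_add: "rep n S c \<Longrightarrow> rep n S' d \<Longrightarrow> rep n (\<lambda>g. S g + S' g) (c + d)" for c d :: "'k::field_char_0 mpol"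
proof -
  interpret A: weyl_rep "\<lambda>c f. cst c * f" n "YA n :: nat \<Rightarrow> 'k mpol \<Rightarrow> 'k mpol" by (rule weyl_rep_A)
  show "rep n S c \<Longrightarrow> rep n S' d \<Longrightarrow> rep n (\<lambda>g. S g + S' g) (c + d)" by (simp add: rep_def)
qed

lemma rep_comp: "rep n S c \<Longrightarrow> rep n S' d \<Longrightarrow> rep n (S \<circ> S') (star n c d)" for c d :: "'k::field_char_0 mpol"
proof -
  interpret A: weyl_rep "\<lambda>c f. cst c * f" n "YA n :: nat \<Rightarrow> 'k mpol \<Rightarrow> 'k mpol" by (rule weyl_rep_A)
  show "rep n S c \<Longrightarrow> rep n S' d \<Longrightarrow> rep n (S \<circ> S') (star n c d)"
    by (auto simp: rep_def inA_star A.op_star inA_opA)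
qed

lemma Weyl_rep: "S \<in> Weyl n \<Longrightarrow> \<exists>c. rep n S c"
proof (induction rule: Weyl.induct)
  case (comp S S')
  then show ?case using rep_comp by blast
qed (auto intro: rep_mulop rep_Der rep_add)

context av_simple begin

text \<open>Elements of \<open>Weyl\<close> are functions on A and carry no expression in
  generators; the unique symbol transports them to operators on M.\<close>

definition dP :: "('a mpol \<Rightarrow> 'a mpol) \<Rightarrow> 'b \<Rightarrow> 'b" where
  "dP S = op (THE c. rep n S c)"

lemma dP_rep: "rep n S c \<Longrightarrow> dP S = op c"
  unfolding dP_def using rep_unique by (metis the_equality)

lemma dP_mulop: "inA n f \<Longrightarrow> dP (mulop n f) = op f"
  by (rule dP_rep[OF rep_mulop])

lemma dP_Weyl: "S \<in> Weyl n \<Longrightarrow> \<exists>c. rep n S c \<and> inA (2*n) c \<and> dP S = op c"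
  using Weyl_rep[of S n] dP_rep by (auto simp: rep_def)

lemma D_module_cyc: "D_module n sc (cyc u) dP"
  unfolding D_module_def
proof (intro conjI ballI allI)
  show "module.subspace sc (cyc u)" using Y_stable_cyc by (simp add: Y_stable_def)
  fix S :: "'a mpol \<Rightarrow> 'a mpol" assume "S \<in> Weyl n"
  then obtain c where c: "rep n S c" "inA (2*n) c" "dP S = op c" using dP_Weyl by blast
  fix x assume x: "x \<in> cyc u"
  show "dP S x \<in> cyc u" using c x by (simp add: op_cyc)
  show "dP S (x + y) = dP S x + dP S y" for y using c by simp
  show "dP S (sc k x) = sc k (dP S x)" for k using c by simp
  fix S' :: "'a mpol \<Rightarrow> 'a mpol" assume "S' \<in> Weyl n"
  then obtain d where d: "rep n S' d" "inA (2*n) d" "dP S' = op d" using dP_Weyl by blast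
  show "dP (\<lambda>g. S g + S' g) x = dP S x + dP S' x" using dP_rep[OF rep_add[OF c(1) d(1)]] c d by simp
  show "dP (S \<circ> S') x = dP S (dP S' x)" using dP_rep[OF rep_comp[OF c(1) d(1)]] c d by (simp add: op_star)
next
  fix c x show "dP (mulop n (cst c)) x = sc c x" by (simp add: dP_mulop)
qed

lemma YY_in_D_ops: "j < 2*n \<Longrightarrow> YY j \<in> D_ops n dP"
proof -
  assume j: "j < 2*n"
  show ?thesis
  proof (cases "j < n")
    case True
    then have "dP (mulop n (Xv j)) = YY j" using op_X[OF True, of 1] by (auto simp: dP_mulop)
    moreover have "mulop n (Xv j) \<in> Weyl n" using True by (intro Weyl.mult) simp
    then have "dP (mulop n (Xv j)) \<in> D_ops n dP" unfolding D_ops_def by blast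
    ultimately show ?thesis by (simp only:)
  next
    case False
    define p where "p = j - n"
    have p: "p < n" "j = n + p" using j False by (auto simp: p_def)
    have d: "fd n 1 p \<in> Der n" by (simp add: fd_Der)
    have "(\<Sum>q<n. Xv (n + q) * fd n 1 p (Xv q)) = (\<Sum>q<n. if q = p then Xv (n + q) else (0::'a mpol))"
      by (intro sum.cong) (auto simp: fd_def pd_Xv)
    then have "dP (fd n 1 p) = op (Xv (n + p))" using dP_rep[OF rep_Der[OF d]] p by simp
    also have "\<dots> = YY j" using op_D[OF p(1), of 1] p(2) by auto
    finally have "dP (fd n 1 p) = YY j" .
    moreover have "fd n 1 p \<in> Weyl n" using d by (rule Weyl.der)
    then have "dP (fd n 1 p) \<in> D_ops n dP" unfolding D_ops_def by blast
    ultimately show ?thesis by (simp only:)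
  qed
qed

lemma D_ops_op: "D_ops n dP \<subseteq> {op c | c. inA (2*n) c}"
  unfolding D_ops_def using dP_Weyl by blast

lemma D_submodule_eq_cyc:
  assumes u: "simple_gen u" and N: "op_submodule sc (D_ops n dP) (cyc u) N"
  shows "N = {0} \<or> N = cyc u"
proof (cases "N = {0}")
  case False
  have st: "Y_stable N" using N YY_in_D_ops unfolding op_submodule_def Y_stable_def by blast
  then have "0 \<in> N" by (simp add: Y_stable_def subspace_0)
  then obtain x where x: "x \<in> N" "x \<noteq> 0" using False by blast
  have "x \<in> cyc u" using x N by (auto simp: op_submodule_def)
  then obtain c where "op c x = u" using u x unfolding simple_gen_def by blast
  then have "u \<in> N" using op_stable[OF st x(1), of c] by simp
  then have "cyc u \<subseteq> N" using op_stable[OF st] by (auto simp: cyc_def)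
  then show ?thesis using N by (auto simp: op_submodule_def)
qed simp

lemma simple_cyc:
  assumes u: "simple_gen u"
  shows "op_simple sc (D_ops n dP) (cyc u)"
proof -
  have "cyc u \<noteq> {0}" using u u_in_cyc[of u] by (auto simp: simple_gen_def)
  then show ?thesis using D_submodule_eq_cyc[OF u] unfolding op_simple_def by blast
qed

lemma holonomic_cyc:
  assumes u: "simple_gen u"
  shows "op_holonomic n sc (D_ops n dP) (cyc u)"
proof -
  have u0: "u \<noteq> 0" using u by (simp add: simple_gen_def)
  have "op_fin_gen sc (D_ops n dP) (cyc u)"
    unfolding op_fin_gen_def
  proof (intro exI[of _ "{u}"] conjI allI impI)
    fix N assume N: "op_submodule sc (D_ops n dP) (cyc u) N \<and> {u} \<subseteq> N"
    then show "N = cyc u" using D_submodule_eq_cyc[OF u, of N] u0 by blast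
  qed (simp_all add: u_in_cyc)
  moreover have "GKdim sc (D_ops n dP) (cyc u) = ereal (real n)"
    by (rule GKdim_cyc[OF u0 slow_all D_ops_op YY_in_D_ops])
  ultimately show ?thesis by (simp add: op_holonomic_def)
qed

end

text \<open>The w l form a basis of a finite-dimensional space of killed vectors in Q, and r i p l j
  is the entry in row j and column l of the matrix by which E_ip acts on it.\<close>

locale av_split = av_simple +
  fixes u :: 'b and d :: nat and w :: "nat \<Rightarrow> 'b" and r :: "nat \<Rightarrow> nat \<Rightarrow> nat \<Rightarrow> nat \<Rightarrow> 'a"
  assumes u: "simple_gen u" and d: "d > 0"
    and w_inj: "inj_on w {..<d}" and w_indep: "independent (w ` {..<d})"
    and w_Qs: "l < d \<Longrightarrow> w l \<in> Qs u" and w_killed: "l < d \<Longrightarrow> killed (w l)"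
    and T_w: "i < n \<Longrightarrow> p < n \<Longrightarrow> l < d \<Longrightarrow> T [i] p (w l) = (\<Sum>j<d. sc (r i p l j) (w j))"
begin

lemma u0: "u \<noteq> 0"
  using u by (simp add: simple_gen_def)

lemma w_density:
  assumes "\<And>j. j < d \<Longrightarrow> inA (2*n) (e j)" "(\<Sum>j<d. op (e j) (w j)) = 0" "j < d"
  shows "op (e j) u = 0"
proof -
  let ?i = "the_inv_into {..<d} w"
  have i: "?i (w j) = j" if "j < d" for j using the_inv_into_f_f[OF w_inj] that by simp
  have "(\<Sum>b\<in>w ` {..<d}. op (e (?i b)) b) = (\<Sum>j<d. op (e j) (w j))"
    unfolding sum.reindex[OF w_inj] using i by (intro sum.cong) auto
  then have s0: "(\<Sum>b\<in>w ` {..<d}. op (e (?i b)) b) = 0" using assms(2) by simp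
  have "\<forall>b\<in>w ` {..<d}. op (e (?i b)) u = 0"
    by (rule density[OF ac unc u _ w_indep _ _ s0]) (use w_Qs assms(1) i in \<open>auto simp: Qs_def\<close>)
  then show ?thesis using assms(3) i by force
qed

lemma w_coeffs_0:
  assumes "(\<Sum>j<d. sc (k j) (w j)) = 0" "j < d"
  shows "k j = 0"
proof -
  have "op (cst (k j)) u = 0" by (rule w_density[of "\<lambda>j. cst (k j)"]) (use assms in auto)
  then show ?thesis using u0 by simp
qed

lemma w_coeffs_eq:
  assumes "(\<Sum>j<d. sc (k j) (w j)) = (\<Sum>j<d. sc (k' j) (w j))" "j < d"
  shows "k j = k' j"
proof -
  have "(\<Sum>j<d. sc (k j - k' j) (w j)) = 0" using assms(1) by (simp add: scale_left_diff_distrib sum_subtractf)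
  then have "k j - k' j = 0" by (rule w_coeffs_0) (rule assms(2))
  then show ?thesis by simp
qed

section \<open>The gl_n-action in coordinates\<close>

definition R :: "'a mat \<Rightarrow> 'a mat" where
  "R X = (\<lambda>j l. if j < d \<and> l < d then \<Sum>i<n. \<Sum>p<n. X i p * r i p l j else 0)"

definition TX :: "'a mat \<Rightarrow> 'b \<Rightarrow> 'b" where
  "TX X x = (\<Sum>i<n. \<Sum>p<n. sc (X i p) (T [i] p x))"

lemma TX_linear: "TX X (x + y) = TX X x + TX X y" "TX X (sc c x) = sc c (TX X x)"
proof -
  have s: "set [i] \<subseteq> {..<n}" if "i < n" for i using that by simp
  show "TX X (x + y) = TX X x + TX X y" unfolding TX_def sum.distrib[symmetric]
    by (intro sum.cong refl) (simp add: A_linear_T s scale_right_distrib)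
  show "TX X (sc c x) = sc c (TX X x)" unfolding TX_def scale_sum_right
    by (intro sum.cong refl) (simp add: A_linear_T s mult.commute)
qed

lemma TX_sum: "TX X (sum f S) = (\<Sum>i\<in>S. TX X (f i))"
  using TX_linear(2)[of X 0 0] by (induction S rule: infinite_finite_induct) (auto simp: TX_linear)

lemma R_Emat: "i < n \<Longrightarrow> p < n \<Longrightarrow> j < d \<Longrightarrow> l < d \<Longrightarrow> R (Emat i p) j l = r i p l j"
proof -
  assume a: "i < n" "p < n" "j < d" "l < d"
  have "R (Emat i p) j l = (\<Sum>i'<n. if i' = i then (\<Sum>p'<n. if p' = p then r i' p' l j else 0) else 0)"
  proof -
    have "(\<Sum>p'<n. Emat i p i' p' * r i' p' l j) = (if i' = i then (\<Sum>p'<n. if p' = p then r i' p' l j else 0) else 0)" for i'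
    proof (cases "i' = i")
      case True
      then have "(\<Sum>p'<n. Emat i p i' p' * r i' p' l j) = (\<Sum>p'<n. if p' = p then r i' p' l j else 0)"
        by (intro sum.cong) (auto simp: Emat_def)
      then show ?thesis using True by simp
    qed (simp add: Emat_def)
    then show ?thesis using a by (simp add: R_def)
  qed
  also have "\<dots> = r i p l j" using a by simp
  finally show ?thesis .
qed

lemma TX_w: "l < d \<Longrightarrow> TX X (w l) = (\<Sum>j<d. sc (R X j l) (w j))"
proof -
  assume l: "l < d"
  have "TX X (w l) = (\<Sum>i<n. \<Sum>p<n. \<Sum>j<d. sc (X i p * r i p l j) (w j))"
    unfolding TX_def using l by (intro sum.cong refl) (simp add: T_w scale_sum_right)
  also have "\<dots> = (\<Sum>i<n. \<Sum>j<d. \<Sum>p<n. sc (X i p * r i p l j) (w j))"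
    by (rule sum.cong[OF refl]) (rule sum.swap)
  also have "\<dots> = (\<Sum>j<d. \<Sum>i<n. \<Sum>p<n. sc (X i p * r i p l j) (w j))" by (rule sum.swap)
  also have "\<dots> = (\<Sum>j<d. sc (R X j l) (w j))"
    using l by (intro sum.cong refl) (simp add: R_def scale_sum_left)
  finally show ?thesis .
qed

lemma TX_TX: "TX X (TX Y x) = (\<Sum>i<n. \<Sum>p<n. \<Sum>j<n. \<Sum>q<n. sc (X i p * Y j q) (T [i] p (T [j] q x)))"
  unfolding TX_def
proof (intro sum.cong refl)
  fix i p assume "i \<in> {..<n}"
  then have s: "set [i] \<subseteq> {..<n}" by simp
  show "sc (X i p) (T [i] p (\<Sum>j<n. \<Sum>q<n. sc (Y j q) (T [j] q x))) =
      (\<Sum>j<n. \<Sum>q<n. sc (X i p * Y j q) (T [i] p (T [j] q x)))"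
    by (simp add: T_sum[OF s] A_linear_T(2)[OF s] scale_sum_right)
qed

lemma sum_swap4:
  "(\<Sum>j\<in>A. \<Sum>q\<in>A. \<Sum>i\<in>A. \<Sum>p\<in>A. f j q i p) = (\<Sum>i\<in>A. \<Sum>p\<in>A. \<Sum>j\<in>A. \<Sum>q\<in>A. f j q i p)"
  for f :: "nat \<Rightarrow> nat \<Rightarrow> nat \<Rightarrow> nat \<Rightarrow> 'b"
proof -
  have "(\<Sum>j\<in>A. \<Sum>q\<in>A. \<Sum>i\<in>A. \<Sum>p\<in>A. f j q i p) = (\<Sum>j\<in>A. \<Sum>i\<in>A. \<Sum>p\<in>A. \<Sum>q\<in>A. f j q i p)"
    by (rule sum.cong[OF refl]) (subst sum.swap, rule sum.cong[OF refl], rule sum.swap)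
  also have "\<dots> = (\<Sum>i\<in>A. \<Sum>j\<in>A. \<Sum>p\<in>A. \<Sum>q\<in>A. f j q i p)" by (rule sum.swap)
  also have "\<dots> = (\<Sum>i\<in>A. \<Sum>p\<in>A. \<Sum>j\<in>A. \<Sum>q\<in>A. f j q i p)"
    by (rule sum.cong[OF refl]) (rule sum.swap)
  finally show ?thesis .
qed

text \<open>For lists of length 1, \<open>bracket_single\<close> is the commutation rule of the
  matrix units E_ip; the rest is bilinear expansion.\<close>

lemma TX_bracket: "TX X (TX Y x) - TX Y (TX X x) = TX (mat_br n X Y) x"
proof -
  have b: "T [i] p (T [j] q x) - T [j] q (T [i] p x) = (if j = p then T [i] q x else 0) - (if q = i then T [j] p x else 0)"
    if "i < n" "p < n" "j < n" for i p j q
    using bracket_single[OF that(1,2), of "[j]" q x] that(3) by auto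
  have "TX Y (TX X x) = (\<Sum>i<n. \<Sum>p<n. \<Sum>j<n. \<Sum>q<n. sc (X i p * Y j q) (T [j] q (T [i] p x)))"
    unfolding TX_TX by (subst sum_swap4) (simp add: mult.commute)
  then have "TX X (TX Y x) - TX Y (TX X x) = (\<Sum>i<n. \<Sum>p<n. \<Sum>j<n. \<Sum>q<n. sc (X i p * Y j q)
      (T [i] p (T [j] q x) - T [j] q (T [i] p x)))"
    by (simp add: TX_TX[of X Y] sum_subtractf scale_right_diff_distrib)
  also have "\<dots> = (\<Sum>i<n. \<Sum>p<n. \<Sum>j<n. \<Sum>q<n. (if j = p then sc (X i p * Y j q) (T [i] q x) else 0)
      - (if q = i then sc (X i p * Y j q) (T [j] p x) else 0))"
    by (intro sum.cong refl) (auto simp: b scale_right_diff_distrib)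
  also have "\<dots> = (\<Sum>i<n. \<Sum>p<n. \<Sum>j<n. \<Sum>q<n. if j = p then sc (X i p * Y j q) (T [i] q x) else 0)
      - (\<Sum>i<n. \<Sum>p<n. \<Sum>j<n. \<Sum>q<n. if q = i then sc (X i p * Y j q) (T [j] p x) else 0)"
    by (simp only: sum_subtractf)
  also have "(\<Sum>i<n. \<Sum>p<n. \<Sum>j<n. \<Sum>q<n. if j = p then sc (X i p * Y j q) (T [i] q x) else 0)
      = (\<Sum>i<n. \<Sum>p<n. \<Sum>q<n. sc (X i p * Y p q) (T [i] q x))"
  proof (rule sum.cong[OF refl], rule sum.cong[OF refl])
    fix i p assume "p \<in> {..<n}"
    then show "(\<Sum>j<n. \<Sum>q<n. if j = p then sc (X i p * Y j q) (T [i] q x) else 0)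
        = (\<Sum>q<n. sc (X i p * Y p q) (T [i] q x))"
      by (subst sum.swap) simp
  qed
  also have "\<dots> = (\<Sum>i<n. \<Sum>q<n. sc (mat_mult n X Y i q) (T [i] q x))"
    by (rule sum.cong[OF refl], subst sum.swap) (simp add: mat_mult_def scale_sum_left)
  also have "(\<Sum>i<n. \<Sum>p<n. \<Sum>j<n. \<Sum>q<n. if q = i then sc (X i p * Y j q) (T [j] p x) else 0)
      = (\<Sum>i<n. \<Sum>p<n. \<Sum>j<n. sc (X i p * Y j i) (T [j] p x))"
    by (intro sum.cong refl) simp
  also have "\<dots> = (\<Sum>j<n. \<Sum>p<n. sc (mat_mult n Y X j p) (T [j] p x))"
  proof -
    have "(\<Sum>i<n. \<Sum>p<n. \<Sum>j<n. sc (X i p * Y j i) (T [j] p x)) = (\<Sum>p<n. \<Sum>i<n. \<Sum>j<n. sc (X i p * Y j i) (T [j] p x))"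
      by (rule sum.swap)
    also have "\<dots> = (\<Sum>p<n. \<Sum>j<n. \<Sum>i<n. sc (X i p * Y j i) (T [j] p x))"
      by (rule sum.cong[OF refl]) (rule sum.swap)
    also have "\<dots> = (\<Sum>j<n. \<Sum>p<n. \<Sum>i<n. sc (X i p * Y j i) (T [j] p x))" by (rule sum.swap)
    finally show ?thesis by (simp add: mat_mult_def scale_sum_left mult.commute)
  qed
  finally show ?thesis
    by (simp add: TX_def mat_br_def scale_left_diff_distrib sum_subtractf)
qed

lemma gl_rep_R: "gl_rep n d R"
  unfolding gl_rep_def
proof (intro conjI allI impI)
  fix X Y :: "'a mat" and c :: 'a
  show "is_mat d (R X)" by (simp add: is_mat_def R_def)
  show "R (\<lambda>i j. X i j + Y i j) = (\<lambda>i j. R X i j + R Y i j)"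
    by (auto simp: R_def fun_eq_iff distrib_right sum.distrib)
  show "R (\<lambda>i j. c * X i j) = (\<lambda>i j. c * R X i j)"
    by (auto simp: R_def fun_eq_iff sum_distrib_left mult.assoc)
  show "R (mat_br n X Y) = mat_br d (R X) (R Y)"
  proof (intro ext)
    fix j l
    show "R (mat_br n X Y) j l = mat_br d (R X) (R Y) j l"
    proof (cases "j < d \<and> l < d")
      case True
      have mm: "TX X (TX Y (w l)) = (\<Sum>j<d. sc (mat_mult d (R X) (R Y) j l) (w j))" for X Y
      proof -
        have "TX X (TX Y (w l)) = (\<Sum>k<d. \<Sum>j<d. sc (R X j k * R Y k l) (w j))"
          using True by (simp add: TX_w TX_sum TX_linear scale_sum_right mult.commute)
        also have "\<dots> = (\<Sum>j<d. \<Sum>k<d. sc (R X j k * R Y k l) (w j))" by (rule sum.swap)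
        finally show ?thesis by (simp add: mat_mult_def scale_sum_left)
      qed
      have "(\<Sum>j<d. sc (R (mat_br n X Y) j l) (w j)) = TX (mat_br n X Y) (w l)" using True by (simp add: TX_w)
      also have "\<dots> = (\<Sum>j<d. sc (mat_mult d (R X) (R Y) j l) (w j)) - (\<Sum>j<d. sc (mat_mult d (R Y) (R X) j l) (w j))"
        by (simp only: TX_bracket[symmetric] mm)
      also have "\<dots> = (\<Sum>j<d. sc (mat_br d (R X) (R Y) j l) (w j))"
        by (simp add: mat_br_def scale_left_diff_distrib sum_subtractf)
      finally show ?thesis by (rule w_coeffs_eq) (use True in simp)
    next
      case False
      then show ?thesis by (auto simp: R_def mat_br_def mat_mult_def intro!: sum.neutral)
    qed
  qed
qed

end

section \<open>The splitting as a tensor product\<close>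

lemma sum_reverse4:
  fixes f :: "'i \<Rightarrow> 'j \<Rightarrow> 'k \<Rightarrow> 'l \<Rightarrow> 'b::comm_monoid_add"
  shows "(\<Sum>l\<in>A. \<Sum>p\<in>B. \<Sum>i\<in>C. \<Sum>j\<in>D. f l p i j) = (\<Sum>j\<in>D. \<Sum>i\<in>C. \<Sum>p\<in>B. \<Sum>l\<in>A. f l p i j)"
proof -
  have "(\<Sum>l\<in>A. \<Sum>p\<in>B. \<Sum>i\<in>C. \<Sum>j\<in>D. f l p i j) = (\<Sum>l\<in>A. \<Sum>p\<in>B. \<Sum>j\<in>D. \<Sum>i\<in>C. f l p i j)"
    by (rule sum.cong[OF refl], rule sum.cong[OF refl], rule sum.swap)
  also have "\<dots> = (\<Sum>l\<in>A. \<Sum>j\<in>D. \<Sum>p\<in>B. \<Sum>i\<in>C. f l p i j)" by (rule sum.cong[OF refl], rule sum.swap)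
  also have "\<dots> = (\<Sum>j\<in>D. \<Sum>l\<in>A. \<Sum>p\<in>B. \<Sum>i\<in>C. f l p i j)" by (rule sum.swap)
  also have "\<dots> = (\<Sum>j\<in>D. \<Sum>l\<in>A. \<Sum>i\<in>C. \<Sum>p\<in>B. f l p i j)"
    by (rule sum.cong[OF refl], rule sum.cong[OF refl], rule sum.swap)
  also have "\<dots> = (\<Sum>j\<in>D. \<Sum>i\<in>C. \<Sum>l\<in>A. \<Sum>p\<in>B. f l p i j)" by (rule sum.cong[OF refl], rule sum.swap)
  also have "\<dots> = (\<Sum>j\<in>D. \<Sum>i\<in>C. \<Sum>p\<in>B. \<Sum>l\<in>A. f l p i j)"
    by (rule sum.cong[OF refl], rule sum.cong[OF refl], rule sum.swap)
  finally show ?thesis .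
qed

context av_split begin

text \<open>A nonzero invariant subspace of k^d gives a space V of killed vectors with D V = M. Each
  basis vector w j is then a D-combination of a basis of V, and density allows this only if w j lies
  in V.\<close>

lemma simple_fd_gl_R: "simple_fd_gl n d R"
  unfolding simple_fd_gl_def
proof (intro conjI allI impI gl_rep_R d)
  fix W :: "(nat \<Rightarrow> 'a) set"
  assume W: "W \<subseteq> kvec d \<and> (\<lambda>_. 0) \<in> W \<and> (\<forall>q\<in>W. \<forall>q'\<in>W. (\<lambda>j. q j + q' j) \<in> W)
        \<and> (\<forall>c. \<forall>q\<in>W. (\<lambda>j. c * q j) \<in> W)
        \<and> (\<forall>X. is_mat n X \<longrightarrow> (\<forall>q\<in>W. (\<lambda>j. \<Sum>l<d. R X j l * q l) \<in> W))"
  then have Wk: "W \<subseteq> kvec d" and W0: "(\<lambda>_. 0) \<in> W"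
    and Wadd: "\<And>q q'. q \<in> W \<Longrightarrow> q' \<in> W \<Longrightarrow> (\<lambda>j. q j + q' j) \<in> W"
    and Wscale: "\<And>c q. q \<in> W \<Longrightarrow> (\<lambda>j. c * q j) \<in> W"
    and WR: "\<And>X q. is_mat n X \<Longrightarrow> q \<in> W \<Longrightarrow> (\<lambda>j. \<Sum>l<d. R X j l * q l) \<in> W" by blast+
  let ?v = "\<lambda>q. \<Sum>l<d. sc (q l) (w l)"
  let ?V = "?v ` W"
  show "W = {\<lambda>_. 0} \<or> W = kvec d"
  proof (cases "W = {\<lambda>_. 0}")
    case False
    then obtain q0 where q0: "q0 \<in> W" "q0 \<noteq> (\<lambda>_. 0)" using W0 by blast
    then obtain j0 where j0: "q0 j0 \<noteq> 0" by (auto simp: fun_eq_iff)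
    have "j0 < d" 
    proof -
      have "q0 \<in> kvec d" using q0(1) Wk by blast
      then have "\<forall>j\<ge>d. q0 j = 0" by (simp add: kvec_def)
      then show ?thesis using j0 by (metis not_le)
    qed
    then have v0: "?v q0 \<noteq> 0" using w_coeffs_0 j0 by blast
    have sub: "subspace ?V"
      unfolding subspace_def
    proof (intro conjI ballI allI)
      show "0 \<in> ?V" by (rule image_eqI[OF _ W0]) simp
      fix x assume "x \<in> ?V"
      then obtain q where q: "q \<in> W" "x = ?v q" by blast
      have "sc c x = ?v (\<lambda>j. c * q j)" for c unfolding q(2) by (simp add: scale_sum_right)
      then show "sc c x \<in> ?V" for c
        using Wscale[OF q(1)] by (intro image_eqI[where f = ?v and x = "\<lambda>j. c * q j"])
      fix y assume "y \<in> ?V"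
      then obtain q' where q': "q' \<in> W" "y = ?v q'" by blast
      have "x + y = ?v (\<lambda>j. q j + q' j)" unfolding q(2) q'(2) by (simp add: scale_left_distrib sum.distrib)
      then show "x + y \<in> ?V"
        using Wadd[OF q(1) q'(1)] by (intro image_eqI[where f = ?v and x = "\<lambda>j. q j + q' j"])
    qed
    have Vk: "killed x" if x: "x \<in> ?V" for x
    proof -
      obtain q where "x = ?v q" using x by blast
      then show ?thesis using w_killed
        unfolding killed_def by (auto simp: T_sum A_linear_T)
    qed
    have VQ: "x \<in> Qs u" if x: "x \<in> ?V" for x
    proof -
      obtain q where "x = ?v q" using x by blast
      then show ?thesis using w_Qs
        by (auto intro!: subspace_sum[OF subspace_Qs] subspace_scale[OF subspace_Qs])
    qed
    have VT: "T [i] p x \<in> ?V" if ip: "i < n" "p < n" and x: "x \<in> ?V" for i p x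
    proof -
      obtain q where q: "q \<in> W" "x = ?v q" using x by blast
      have s: "set [i] \<subseteq> {..<n}" using ip by simp
      have E: "is_mat n (Emat i p :: 'a mat)" using ip by (auto simp: is_mat_def Emat_def)
      have "T [i] p x = (\<Sum>l<d. \<Sum>j<d. sc (q l * r i p l j) (w j))"
        unfolding q(2) using ip by (simp add: T_sum[OF s] A_linear_T(2)[OF s] T_w scale_sum_right)
      also have "\<dots> = (\<Sum>j<d. \<Sum>l<d. sc (q l * r i p l j) (w j))" by (rule sum.swap)
      also have "\<dots> = ?v (\<lambda>j. \<Sum>l<d. R (Emat i p) j l * q l)"
        by (intro sum.cong refl) (simp add: R_Emat ip scale_sum_left mult.commute)
      finally show ?thesis
        using WR[OF E q(1)] by (intro image_eqI[where f = ?v and x = "\<lambda>j. \<Sum>l<d. R (Emat i p) j l * q l"])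
    qed
    have full: "span {op c x | c x. inA (2*n) c \<and> x \<in> ?V} = UNIV"
      using op_span_eq_UNIV[OF sub Vk VT _ v0] q0(1) by blast
    obtain B where B: "B \<subseteq> ?V" "independent B" "?V \<subseteq> span B" "card B = dim ?V" "finite B"
    proof (rule finite_basis_exists)
      show "?V \<subseteq> span (w ` {..<d})"
      proof clarify
        fix q show "?v q \<in> span (w ` {..<d})" by (intro span_sum span_scale span_base) auto
      qed
    qed (auto intro: that)
    have coords: "\<exists>c. (\<forall>b\<in>B. inA (2*n) (c b)) \<and> x = (\<Sum>b\<in>B. op (c b) b)" for x
    proof -
      let ?N = "{x. \<exists>c. (\<forall>b\<in>B. inA (2*n) (c b)) \<and> x = (\<Sum>b\<in>B. op (c b) b)}"
      have "subspace ?N"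
        unfolding subspace_def
      proof (intro conjI ballI allI)
        show "0 \<in> ?N" by (auto intro!: exI[of _ "\<lambda>_. 0"])
        fix x assume "x \<in> ?N"
        then obtain c where c: "\<forall>b\<in>B. inA (2*n) (c b)" "x = (\<Sum>b\<in>B. op (c b) b)" by blast
        show "sc k x \<in> ?N" for k
          using c by (auto intro!: exI[of _ "\<lambda>b. cst k * c b"] simp: scale_sum_right)
        fix y assume "y \<in> ?N"
        then obtain c' where c': "\<forall>b\<in>B. inA (2*n) (c' b)" "y = (\<Sum>b\<in>B. op (c' b) b)" by blast
        show "x + y \<in> ?N"
          using c c' by (auto intro!: exI[of _ "\<lambda>b. c b + c' b"] simp: sum.distrib)
      qed
      moreover have "op c y \<in> ?N" if "inA (2*n) c" "y \<in> ?V" for c y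
      proof -
        have "y \<in> span B" using that(2) B(3) by blast
        then obtain k where "y = (\<Sum>b\<in>B. sc (k b) b)" unfolding span_finite[OF B(5)] by blast
        then have "op c y = (\<Sum>b\<in>B. op (cst (k b) * c) b)" by (simp add: op_sum_right)
        then show ?thesis using that(1) by (auto intro!: exI[of _ "\<lambda>b. cst (k b) * c"])
      qed
      ultimately have "span {op c x | c x. inA (2*n) c \<and> x \<in> ?V} \<subseteq> ?N" by (intro span_minimal) blast+
      then show ?thesis using full by blast
    qed
    have w_in: "w j \<in> ?V" if j: "j < d" for j
    proof (rule ccontr)
      assume "w j \<notin> ?V"
      then have nB: "w j \<notin> span B" using B(1) sub span_minimal by blast
      then have ind: "independent (insert (w j) B)" using B(2) by (intro independent_insertI)
      have nB': "w j \<notin> B" using nB span_base by blast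
      obtain c where c: "\<forall>b\<in>B. inA (2*n) (c b)" "w j = (\<Sum>b\<in>B. op (c b) b)" using coords by blast
      \<comment> \<open>The expression of w j becomes a relation with coefficient -1 at w j. For
        independent vectors, density would force -u = 0.\<close>
      define e where "e = c(w j := - 1)"
      have "(\<Sum>b\<in>B. op (e b) b) = (\<Sum>b\<in>B. op (c b) b)" using nB' by (intro sum.cong) (auto simp: e_def)
      then have "(\<Sum>b\<in>insert (w j) B. op (e b) b) = - w j + w j"
        using B(5) nB' c(2) by (simp add: e_def)
      then have s0: "(\<Sum>b\<in>insert (w j) B. op (e b) b) = 0" by simp
      have "\<forall>b\<in>insert (w j) B. op (e b) u = 0"
        by (rule density[OF ac unc u _ ind _ _ s0])
          (use B(1,5) VQ w_Qs[OF j] c(1) in \<open>auto simp: Qs_def e_def\<close>)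
      then have "op (e (w j)) u = 0" by blast
      then show False using u0 by (simp add: e_def)
    qed
    have unit: "(\<lambda>k. if k = j then 1 else 0) \<in> W" if j: "j < d" for j
    proof -
      obtain q where q: "q \<in> W" "w j = ?v q" using w_in[OF j] by blast
      have "?v q = ?v (\<lambda>k. if k = j then 1 else 0)"
      proof -
        have "?v (\<lambda>k. if k = j then 1 else 0) = (\<Sum>l<d. if l = j then w l else 0)" by (intro sum.cong) auto
        then show ?thesis using j q(2) by simp
      qed
      then have "q k = (if k = j then 1 else 0)" if "k < d" for k
        using that by (rule w_coeffs_eq[where k = q and k' = "\<lambda>k. if k = j then 1 else 0"])
      moreover have "q k = (if k = j then 1 else 0)" if "\<not> k < d" for k
        using q(1) Wk that j by (auto simp: kvec_def)
      ultimately have "q = (\<lambda>k. if k = j then 1 else 0)" by blast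
      then show ?thesis using q(1) by simp
    qed
    have "kvec d \<subseteq> W"
    proof
      fix y :: "nat \<Rightarrow> 'a" assume y: "y \<in> kvec d"
      have part: "(\<lambda>k. \<Sum>j<m. y j * (if k = j then 1 else 0)) \<in> W" if "m \<le> d" for m
        using that
      proof (induction m)
        case (Suc m)
        then show ?case using Wadd[OF _ Wscale[OF unit[of m], of "y m"]] by simp
      qed (simp add: W0)
      have y_eq: "y = (\<lambda>k. \<Sum>j<d. y j * (if k = j then 1 else 0))"
      proof
        fix k
        have "(\<Sum>j<d. y j * (if k = j then 1 else 0)) = (\<Sum>j<d. if j = k then y j else 0)"
          by (intro sum.cong) auto
        then show "y k = (\<Sum>j<d. y j * (if k = j then 1 else 0))" using y by (auto simp: kvec_def)
      qed
      show "y \<in> W" by (subst y_eq) (rule part[OF order_refl])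
    qed
    then show ?thesis using Wk by blast
  qed simp
qed

text \<open>The graph of the splitting map. It is introduced as a relation because the operators c j
  are not unique; the tuple z is unique by density, and x is determined by z since every w j is
  annihilated by \<open>Ann u\<close>.\<close>

definition rel :: "'b \<Rightarrow> (nat \<Rightarrow> 'b) \<Rightarrow> bool" where
  "rel x z \<longleftrightarrow> (\<exists>c. (\<forall>j<d. inA (2*n) (c j)) \<and> x = (\<Sum>j<d. op (c j) (w j))
     \<and> z = (\<lambda>j. if j < d then op (c j) u else 0))"

lemma relI:
  "(\<And>j. j < d \<Longrightarrow> inA (2*n) (c j)) \<Longrightarrow> rel (\<Sum>j<d. op (c j) (w j)) (\<lambda>j. if j < d then op (c j) u else 0)"
  unfolding rel_def by blast

lemma rel_functional: "rel x z \<Longrightarrow> rel x z' \<Longrightarrow> z = z'"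
proof -
  assume "rel x z" "rel x z'"
  then obtain c c' where c: "\<forall>j<d. inA (2*n) (c j)" "x = (\<Sum>j<d. op (c j) (w j))"
      "z = (\<lambda>j. if j < d then op (c j) u else 0)"
    and c': "\<forall>j<d. inA (2*n) (c' j)" "x = (\<Sum>j<d. op (c' j) (w j))"
      "z' = (\<lambda>j. if j < d then op (c' j) u else 0)" unfolding rel_def by blast
  have "op (c j - c' j) u = 0" if "j < d" for j
    by (rule w_density[of "\<lambda>j. c j - c' j"]) (use c c' that in \<open>auto simp: sum_subtractf\<close>)
  then show ?thesis using c(3) c'(3) by (auto simp: fun_eq_iff)
qed

lemma rel_injective: "rel x z \<Longrightarrow> rel x' z \<Longrightarrow> x = x'"
proof -
  assume "rel x z" "rel x' z"
  then obtain c c' where c: "\<forall>j<d. inA (2*n) (c j)" "x = (\<Sum>j<d. op (c j) (w j))"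
      "z = (\<lambda>j. if j < d then op (c j) u else 0)"
    and c': "\<forall>j<d. inA (2*n) (c' j)" "x' = (\<Sum>j<d. op (c' j) (w j))"
      "z = (\<lambda>j. if j < d then op (c' j) u else 0)" unfolding rel_def by blast
  have "op (c j - c' j) (w j) = 0" if "j < d" for j
  proof -
    have "op (c j - c' j) u = 0" using fun_cong[OF c(3), of j] fun_cong[OF c'(3), of j] that by simp
    moreover have "inA (2*n) (c j - c' j)" using c(1) c'(1) that by simp
    ultimately show ?thesis using w_Qs[OF that] unfolding Qs_iff by blast
  qed
  then show ?thesis unfolding c(2) c'(2) by (intro sum.cong) auto
qed

lemma rel_add: "rel x z \<Longrightarrow> rel y z' \<Longrightarrow> rel (x + y) (\<lambda>j. z j + z' j)"
proof -
  assume "rel x z" "rel y z'"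
  then obtain c c' where c: "\<forall>j<d. inA (2*n) (c j)" "x = (\<Sum>j<d. op (c j) (w j))"
      "z = (\<lambda>j. if j < d then op (c j) u else 0)"
    and c': "\<forall>j<d. inA (2*n) (c' j)" "y = (\<Sum>j<d. op (c' j) (w j))"
      "z' = (\<lambda>j. if j < d then op (c' j) u else 0)" unfolding rel_def by blast
  then show ?thesis unfolding rel_def
    by (intro exI[of _ "\<lambda>j. c j + c' j"]) (auto simp: sum.distrib)
qed

lemma rel_scale: "rel x z \<Longrightarrow> rel (sc k x) (\<lambda>j. sc k (z j))"
proof -
  assume "rel x z"
  then obtain c where c: "\<forall>j<d. inA (2*n) (c j)" "x = (\<Sum>j<d. op (c j) (w j))"
      "z = (\<lambda>j. if j < d then op (c j) u else 0)" unfolding rel_def by blast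
  then show ?thesis unfolding rel_def
    by (intro exI[of _ "\<lambda>j. cst k * c j"]) (auto simp: scale_sum_right)
qed

lemma rel_a:
  assumes f: "inA n f" and "rel x z"
  shows "rel (a f x) (tensor_actA n d dP f z)"
proof -
  obtain c where c: "\<forall>j<d. inA (2*n) (c j)" "x = (\<Sum>j<d. op (c j) (w j))"
      "z = (\<lambda>j. if j < d then op (c j) u else 0)" using assms(2) unfolding rel_def by blast
  show ?thesis unfolding rel_def
    by (intro exI[of _ "\<lambda>j. star n f (c j)"])
      (use c f in \<open>auto simp: inA_star a_eq_op op_sum_right op_star tensor_actA_def dP_mulop\<close>)
qed

text \<open>Both sides come from one family of operators e j, applied to w j for the action on M and
  to u for the action on the tensor product.\<close>

lemma rel_v:
  assumes \<delta>: "\<delta> \<in> Der n" and "rel x z"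
  shows "rel (v \<delta> x) (tensor_actV n sc d dP R \<delta> z)"
proof -
  obtain c where c: "\<And>j. j < d \<Longrightarrow> inA (2*n) (c j)" "x = (\<Sum>j<d. op (c j) (w j))"
      "z = (\<lambda>j. if j < d then op (c j) u else 0)" using assms(2) unfolding rel_def by blast
  define D where "D = (\<Sum>p<n. Xv (n + p) * \<delta> (Xv p))"
  have dA: "inA n (\<delta> (Xv p))" if "p < n" for p using Der_inA[OF \<delta>] that by simp
  have dP\<delta>: "dP \<delta> = op D" unfolding D_def by (rule dP_rep[OF rep_Der[OF \<delta>]])
  have opD: "op D y = (\<Sum>p<n. a (\<delta> (Xv p)) (V 1 p y))" for y
    unfolding D_def op_sum by (intro sum.cong refl) (simp add: op_D a_eq_op dA V_1_eq_Y)
  define g where "g i p = pd i (\<delta> (Xv p))" for i p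
  have gA: "inA n (g i p)" if "p < n" for i p using dA that by (simp add: g_def)
  \<comment> \<open>The operator at w j in v \<delta> x: the differential part acts on c j, and the
    L_+ part moves w l to w j with the matrix entry r i p l j.\<close>
  define e where "e j = star n D (c j) + (\<Sum>i<n. \<Sum>p<n. \<Sum>l<d. cst (r i p l j) * star n (g i p) (c l))" for j
  have eA: "inA (2*n) (e j)" if "j < d" for j
    unfolding e_def using c(1) that by (intro inA_add inA_sum inA_cst_mult inA_star) auto
  have ope: "op (e j) y = op D (op (c j) y) + (\<Sum>i<n. \<Sum>p<n. \<Sum>l<d. sc (r i p l j) (op (g i p) (op (c l) y)))"
    if "j < d" for j y
  proof -
    have "op (star n D (c j)) y = op D (op (c j) y)" using c(1)[OF that] by (rule op_star)
    moreover have "(\<Sum>i<n. \<Sum>p<n. \<Sum>l<d. sc (r i p l j) (op (star n (g i p) (c l)) y)) =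
        (\<Sum>i<n. \<Sum>p<n. \<Sum>l<d. sc (r i p l j) (op (g i p) (op (c l) y)))"
      using c(1) by (intro sum.cong refl) (simp add: op_star)
    ultimately show ?thesis by (simp add: e_def op_sum)
  qed
  have vop: "v \<delta> (op (c l) (w l)) = op D (op (c l) (w l))
      + (\<Sum>p<n. \<Sum>i<n. \<Sum>j<d. sc (r i p l j) (op (g i p) (op (c l) (w j))))" if l: "l < d" for l
  proof -
    have k: "killed (op (c l) (w l))" by (rule killed_op[OF w_killed[OF l]])
    have "tau p (\<delta> (Xv p)) (op (c l) (w l)) = (\<Sum>i<n. \<Sum>j<d. sc (r i p l j) (op (g i p) (op (c l) (w j))))"
      if p: "p < n" for p
      unfolding tau_killed[OF k p dA[OF p]]
    proof (intro sum.cong refl)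
      fix i assume i: "i \<in> {..<n}"
      then have "T [i] p (op (c l) (w l)) = op (c l) (T [i] p (w l))" by (intro T_op) auto
      also have "\<dots> = (\<Sum>j<d. sc (r i p l j) (op (c l) (w j)))" using i p l by (simp add: T_w op_sum_right)
      finally have "T [i] p (op (c l) (w l)) = (\<Sum>j<d. sc (r i p l j) (op (c l) (w j)))" .
      then show "a (pd i (\<delta> (Xv p))) (T [i] p (op (c l) (w l))) = (\<Sum>j<d. sc (r i p l j) (op (g i p) (op (c l) (w j))))"
        using gA[OF p] by (simp add: a_eq_op g_def[symmetric] op_sum_right)
    qed
    then show ?thesis unfolding v_expansion[OF \<delta>] sum.distrib opD by simp
  qed
  have v_sum: "v \<delta> (\<Sum>l<d. f l) = (\<Sum>l<d. v \<delta> (f l))" for f :: "nat \<Rightarrow> 'b"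
    by (rule module_hom.sum[OF linear_v[OF \<delta>, folded module_hom_iff_linear]])
  have "v \<delta> x = (\<Sum>l<d. op D (op (c l) (w l)))
      + (\<Sum>l<d. \<Sum>p<n. \<Sum>i<n. \<Sum>j<d. sc (r i p l j) (op (g i p) (op (c l) (w j))))"
    unfolding c(2) v_sum sum.distrib[symmetric] by (intro sum.cong refl) (simp add: vop)
  also have "(\<Sum>l<d. \<Sum>p<n. \<Sum>i<n. \<Sum>j<d. sc (r i p l j) (op (g i p) (op (c l) (w j))))
      = (\<Sum>j<d. \<Sum>i<n. \<Sum>p<n. \<Sum>l<d. sc (r i p l j) (op (g i p) (op (c l) (w j))))"
    by (rule sum_reverse4)
  also have "(\<Sum>l<d. op D (op (c l) (w l))) + \<dots> = (\<Sum>j<d. op (e j) (w j))"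
    unfolding sum.distrib[symmetric] by (intro sum.cong refl) (simp add: ope)
  finally have "v \<delta> x = (\<Sum>j<d. op (e j) (w j))" .
  moreover have "tensor_actV n sc d dP R \<delta> z = (\<lambda>j. if j < d then op (e j) u else 0)"
  proof
    fix j
    have "(\<Sum>i<n. \<Sum>p<n. \<Sum>l<d. sc (R (Emat i p) j l) (dP (mulop n (pd i (\<delta> (Xv p)))) (z l)))
        = (\<Sum>i<n. \<Sum>p<n. \<Sum>l<d. sc (r i p l j) (op (g i p) (op (c l) u)))" if "j < d"
      using that gA by (intro sum.cong refl) (simp add: R_Emat c(3) g_def dP_mulop)
    then show "tensor_actV n sc d dP R \<delta> z j = (if j < d then op (e j) u else 0)"
      by (simp add: tensor_actV_def ope dP\<delta> c(3))
  qed
  ultimately show ?thesis using relI[OF eA] by simp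
qed

text \<open>The span of the w l satisfies the hypotheses of \<open>op_span_eq_UNIV\<close>, so every
  vector of M is a D-combination of the w l.\<close>

lemma rel_total: "\<exists>z. rel x z"
proof -
  let ?W = "span (w ` {..<d})"
  have k: "killed y" if y: "y \<in> ?W" for y
  proof -
    obtain q where "y = (\<Sum>b\<in>w ` {..<d}. sc (q b) b)" using y by (auto simp: span_finite)
    then show ?thesis using w_killed unfolding killed_def by (auto simp: T_sum A_linear_T intro!: sum.neutral)
  qed
  have TW: "T [i] p y \<in> ?W" if "i < n" "p < n" "y \<in> ?W" for i p y
  proof -
    have s: "set [i] \<subseteq> {..<n}" using that by simp
    show ?thesis
    proof (rule os.linear_maps_span[OF linear_T[OF s] that(3)])
      show "T [i] p ` (w ` {..<d}) \<subseteq> ?W" 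
      proof clarify
        fix l assume "l < d"
        show "T [i] p (w l) \<in> ?W" unfolding T_w[OF that(1,2) \<open>l < d\<close>]
          by (intro span_sum span_scale span_base) auto
      qed
    qed simp
  qed
  have w0: "w 0 \<in> ?W" "w 0 \<noteq> 0"
  proof -
    have "w 0 \<in> w ` {..<d}" using d by blast
    then show "w 0 \<in> ?W" by (rule span_base)
    show "w 0 \<noteq> 0" using w_indep \<open>w 0 \<in> w ` {..<d}\<close> dependent_zero by metis
  qed
  have full: "span {op c y | c y. inA (2*n) c \<and> y \<in> ?W} = UNIV"
    by (rule op_span_eq_UNIV[OF subspace_span k TW w0])
  have "subspace {x. \<exists>z. rel x z}"
    unfolding subspace_def
  proof (intro conjI ballI allI)
    show "0 \<in> {x. \<exists>z. rel x z}" using relI[of "\<lambda>_. 0"] by auto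
  qed (use rel_add rel_scale in blast)+
  moreover have "op c y \<in> {x. \<exists>z. rel x z}" if c: "inA (2*n) c" and y: "y \<in> ?W" for c y
  proof -
    obtain q where "y = (\<Sum>b\<in>w ` {..<d}. sc (q b) b)" using y by (auto simp: span_finite)
    then have "op c y = (\<Sum>j<d. op (cst (q (w j)) * c) (w j))"
      by (simp add: op_sum_right sum.reindex[OF w_inj])
    then show ?thesis using relI[of "\<lambda>j. cst (q (w j)) * c"] c by auto
  qed
  ultimately have "span {op c y | c y. inA (2*n) c \<and> y \<in> ?W} \<subseteq> {x. \<exists>z. rel x z}"
    by (intro span_minimal) blast+
  then show ?thesis using full by blast
qed

lemma rel_carrier: "rel x z \<Longrightarrow> z \<in> tensor_carrier (cyc u) d"
  by (auto simp: rel_def tensor_carrier_def op_in_cyc)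

lemma rel_surj:
  assumes "z \<in> tensor_carrier (cyc u) d"
  shows "\<exists>x. rel x z"
proof -
  have "\<forall>j\<in>{..<d}. \<exists>c. inA (2*n) c \<and> z j = op c u" using assms by (auto simp: tensor_carrier_def cyc_def)
  from bchoice[OF this] obtain c where c: "\<forall>j\<in>{..<d}. inA (2*n) (c j) \<and> z j = op (c j) u" ..
  then have "z = (\<lambda>j. if j < d then op (c j) u else 0)" using assms by (auto simp: tensor_carrier_def)
  then show ?thesis using relI[of c] c by auto
qed

definition \<Phi> :: "'b \<Rightarrow> nat \<Rightarrow> 'b" where
  "\<Phi> x = (THE z. rel x z)"

lemma Phi_rel: "rel x (\<Phi> x)"
proof -
  obtain z where z: "rel x z" using rel_total by blast
  have "\<Phi> x = z" unfolding \<Phi>_def using z rel_functional by (intro the_equality) blast+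
  then show ?thesis using z by simp
qed

lemma AV_iso: "AV_iso_tensor n sc a v (cyc u) dP d R \<Phi>"
  unfolding AV_iso_tensor_def
proof (intro conjI allI impI ballI)
  show "bij_betw \<Phi> UNIV (tensor_carrier (cyc u) d)"
    unfolding bij_betw_def
  proof
    show "inj \<Phi>" using Phi_rel rel_injective by (metis injI)
    show "range \<Phi> = tensor_carrier (cyc u) d"
    proof
      show "range \<Phi> \<subseteq> tensor_carrier (cyc u) d" using Phi_rel rel_carrier by blast
      show "tensor_carrier (cyc u) d \<subseteq> range \<Phi>" using rel_surj Phi_rel rel_functional by blast
    qed
  qed
  show "\<Phi> (x + y) = (\<lambda>j. \<Phi> x j + \<Phi> y j)" for x y
    by (rule rel_functional[OF Phi_rel rel_add[OF Phi_rel Phi_rel]])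
  show "\<Phi> (sc c x) = (\<lambda>j. sc c (\<Phi> x j))" for c x
    by (rule rel_functional[OF Phi_rel rel_scale[OF Phi_rel]])
  show "\<Phi> (a f x) = tensor_actA n d dP f (\<Phi> x)" if "inA n f" for f x
    by (rule rel_functional[OF Phi_rel rel_a[OF that Phi_rel]])
  show "\<Phi> (v \<delta> x) = tensor_actV n sc d dP R \<delta> (\<Phi> x)" if "\<delta> \<in> Der n" for \<delta> x
    by (rule rel_functional[OF Phi_rel rel_v[OF that Phi_rel]])
qed

end

context av_simple begin

lemma splitting_exists: "\<exists>u d w r. av_split n sc a v u d w r"
proof -
  obtain u where u: "simple_gen u" using simple_gen_ex by blast
  obtain W F where W: "subspace W" "finite F" "W \<subseteq> span F" "W \<subseteq> Qs u" "W \<noteq> {0}" "\<forall>w\<in>W. killed w"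
    "\<forall>i<n. \<forall>q<n. \<forall>w\<in>W. T [i] q w \<in> W" using finite_dim_killed_subspace[OF u] by blast
  obtain B where B: "B \<subseteq> W" "independent B" "W \<subseteq> span B" "card B = dim W" "finite B"
    by (rule finite_basis_exists[OF W(3,2)])
  obtain w where w: "bij_betw w {0..<card B} B" using ex_bij_betw_nat_finite[OF B(5)] by blast
  define d where "d = card B"
  have wB: "w ` {..<d} = B" "inj_on w {..<d}"
    using w unfolding bij_betw_def d_def by (simp_all add: lessThan_atLeast0)
  have wW: "w l \<in> W" if "l < d" for l using wB(1) B(1) that by blast
  have "0 \<in> W" using W(1) subspace_0 by blast
  have "d > 0"
  proof (rule ccontr)
    assume "\<not> d > 0"
    then have "B = {}" using B(5) by (simp add: d_def)
    then have "W \<subseteq> {0}" using B(3) by simp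
    then show False using W(5) \<open>0 \<in> W\<close> by blast
  qed
  have "\<exists>k. i < n \<longrightarrow> p < n \<longrightarrow> l < d \<longrightarrow> T [i] p (w l) = (\<Sum>j<d. sc (k j) (w j))" for i p l
  proof (cases "i < n \<and> p < n \<and> l < d")
    case True
    then have "T [i] p (w l) \<in> span B" using W(7) wW B(3) by blast
    then obtain q where "T [i] p (w l) = (\<Sum>b\<in>B. sc (q b) b)" unfolding span_finite[OF B(5)] by blast
    also have "\<dots> = (\<Sum>j<d. sc (q (w j)) (w j))" unfolding wB(1)[symmetric] sum.reindex[OF wB(2)] by simp
    finally show ?thesis by (intro exI[of _ "\<lambda>j. q (w j)"] impI)
  qed blast
  then obtain r where r: "\<And>i p l. i < n \<Longrightarrow> p < n \<Longrightarrow> l < d \<Longrightarrow> T [i] p (w l) = (\<Sum>j<d. sc (r i p l j) (w j))" by metis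
  have "av_split n sc a v u d w r"
  proof (intro av_split.intro av_simple_axioms av_split_axioms.intro)
    show "independent (w ` {..<d})" using wB B(2) by simp
  qed (use u \<open>d > 0\<close> wB wW W(4,6) r in auto)
  then show ?thesis by blast
qed

end

theorem theorem3p7:
  fixes n :: nat
    and sc :: "'k::field_char_0 \<Rightarrow> 'm::ab_group_add \<Rightarrow> 'm"
    and a :: "'k mpol \<Rightarrow> 'm \<Rightarrow> 'm"
    and v :: "('k mpol \<Rightarrow> 'k mpol) \<Rightarrow> 'm \<Rightarrow> 'm"
  assumes "alg_closed TYPE('k)"
    and "uncountable (UNIV :: 'k set)"
    and "AV_module n sc a v"
    and "op_simple sc (AV_ops n a v) UNIV"
    and "op_holonomic n sc (AV_ops n a v) UNIV"
  shows "\<exists>P dP d R \<Phi>.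
           D_module n sc P dP
         \<and> op_simple sc (D_ops n dP) P
         \<and> op_holonomic n sc (D_ops n dP) P
         \<and> simple_fd_gl n d R
         \<and> AV_iso_tensor n sc a v P dP d R \<Phi>"
proof -
  interpret av_simple n sc a v
    by (intro av_simple.intro av.intro av_simple_axioms.intro) (fact assms)+
  obtain u d w r where "av_split n sc a v u d w r" using splitting_exists by blast
  then interpret av_split n sc a v u d w r .
  show ?thesis
    using D_module_cyc[of u] simple_cyc[OF u] holonomic_cyc[OF u] simple_fd_gl_R AV_iso by blast
qed

end
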